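(* Let $(A_1,A_2)$ be $\zeta$-comparable operators with spectral cut $R_\theta$ and scattering operators $\mathcal S_\lambda$, and put $\mathcal S=\mathcal S_0$. Then $$\det{}_{\zeta,\theta}(A_1,A_2)=\det{}_F\mathcal S\cdot e^{-\mathrm{LIM}^\theta_{\lambda\to\infty}\log\det_F\mathcal S_\lambda}.$$ With $\zeta_{\rm rel}(0):=\zeta_\theta(A_1,A_2,0)$ one has $$\mathrm{LIM}^\theta_{\lambda\to\infty}\log\det{}_F\mathcal S_\lambda=\lim_{\lambda\to\infty,\ \lambda\in\Lambda_\theta}\Big[\log\det{}_F\mathcal S_\lambda-\zeta_{\rm rel}(0)\log(-\lambda)-\sum_{j=0}^{J-1}\sum_{k=0}^1b'_{j,k}(-\lambda)^{-\alpha_j+1}\log^k(-\lambda)\Big],$$ where $b'_{j,0}=b_{j,0}(1-\alpha_j)^{-1}-b_{j,1}(1-\alpha_j)^{-2}$ and $b'_{j,1}=b_{j,1}(1-\alpha_j)^{-1}$ for $j\ne J$. If in addition $A_1,A_2$ are $\zeta$-admissible, then $$\det{}_{\zeta,\theta}(A_1,A_2)=\frac{\det_{\zeta,\theta}A_1}{\det_{\zeta,\theta}A_2}.$$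
   Context: $H$ is a complex Hilbert space, $\theta\in[0,2\pi)$, $R_\theta=\{re^{i\theta}:r\ge0\}$. $R_\theta$ is a spectral cut for the invertible closed operator $A$ on $H$ if there are $\delta,\varrho>0$ such that $(A-\lambda)^{-1}$ exists and is holomorphic on $\Lambda_\theta=\{z:|\arg z-\theta|<\delta\text{ or }|z|<\varrho\}$, with $\|(A-\lambda)^{-1}\|=O(|\lambda|^{-1})$ as $\lambda\to\infty$ in $\Lambda_\theta$. Powers $\lambda^{-s}=|\lambda|^{-s}e^{-is\arg\lambda}$ and logarithms use $\theta-2\pi\le\arg<\theta$; thus for large $\lambda\in\Lambda_\theta$, $\arg(-\lambda)$ is near $\theta-\pi$. $C=C_\theta$ is the contour coming in along $\arg\lambda=\theta$ from $\infty$ to $|\lambda|=\rho<\varrho$, running clockwise around $|\lambda|=\rho$ to argument $\theta-2\pi$, and going out to $\infty$ along $\arg\lambda=\theta-2\pi$. $A^{-s}=\frac{i}{2\pi}\int_C\lambda^{-s}(A-\lambda)^{-1}d\lambda$ for $\mathrm{Re}(s)>0$. An expansion $f(\lambda)\sim\sum_{j\ge0}\sum_{k=0}^1c_{j,k}(-\lambda)^{-\beta_j}\log^k(-\lambda)$ (with $\beta_j\nearrow+\infty$, plus possibly finitely many extra terms) as $\lambda\to\infty$ in $\Lambda_\theta$ means that for all $\epsilon>0$ and all large $N$ the remainder after the terms $j<N$ (and the extra terms) is $O(|\lambda|^{-\beta_N+\epsilon})$. $\zeta$-comparable: a pair $(A_1,A_2)$ of invertible closed operators with common spectral cut $R_\theta$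 such that for $\lambda\in\Lambda_\theta$: (I) $(A_1-\lambda)^{-1}-(A_2-\lambda)^{-1}$ is trace class and $\mathrm{Tr}((A_1-\lambda)^{-1}-(A_2-\lambda)^{-1})=-\frac{\partial}{\partial\lambda}\log\det_F\mathcal S_\lambda$, where the scattering operator $\mathcal S_\lambda=\mathrm{Id}+W_\lambda$ acts on a Hilbert space $\mathcal H_\lambda\subseteq H$ with $W_\lambda$ trace class, and $\det_F$ is the Fredholm determinant on $\mathcal H_\lambda$; (II) as $\lambda\to\infty$ in $\Lambda_\theta$, $$\mathrm{Tr}((A_1-\lambda)^{-1}-(A_2-\lambda)^{-1})\sim\sum_{j\ge0,\,j\ne J}\sum_{k=0}^1b_{j,k}(-\lambda)^{-\alpha_j}\log^k(-\lambda)+b_{J,0}(-\lambda)^{-1},$$ with $0<\alpha_0<\dots<\alpha_j\nearrow+\infty$ and $\alpha_J=1$. $\log\det_F\mathcal S_\lambda$ denotes a fixed smooth branch on $\Lambda_\theta$. For such a pair, $\zeta_\theta(A_1,A_2,s)=\mathrm{Tr}(A_1^{-s}-A_2^{-s})$ for $\mathrm{Re}(s)>1$; it extends meromorphically to $\mathbb C$ and is regular at $s=0$, and $\det_{\zeta,\theta}(A_1,A_2)=\exp(-\zeta_\theta'(A_1,A_2,0))$. Regularized limit: if $f(\lambda)\sim\sum_j\sum_{k=0}^1c_{j,k}(-\lambda)^{-\beta_j}\log^k(-\lambda)+c_0\log(-\lambda)+c_1$ in $\Lambda_\theta$ with $\beta_j\nearrow+\infty$, $\beta_j\ne0$, then $\mathrm{LIM}^\theta_{\lambda\to\infty}f(\lambda)=c_1$.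 ($\log\det_F\mathcal S_\lambda$ has such an expansion.) $\zeta$-admissible: invertible closed operators $A_1,A_2$ with spectral cut $R_\theta$ are $\zeta$-admissible if there are reals $\alpha_0<\alpha_1<\dots\nearrow+\infty$ such that for integers $m>-\alpha_0$ the operators $\partial_\lambda^m(A_i-\lambda)^{-1}$ are trace class with $\mathrm{Tr}(\partial_\lambda^m(A_i-\lambda)^{-1})\sim\sum_{j\ge0}\sum_{k=0}^1a^{(i)}_{j,k}(m)(-\lambda)^{-\alpha_j-m}\log^k(-\lambda)$ as $\lambda\to\infty$ in $\Lambda_\theta$, and the log-coefficient $a^{(i)}_{j,1}(m)$ vanishes for the index $j$ with $\alpha_j=1$. Then $\zeta_\theta(A_i,s)=\mathrm{Tr}(A_i^{-s})$, $\mathrm{Re}(s)\gg0$, extends meromorphically to $\mathbb C$, is regular at $0$, and $\det_{\zeta,\theta}A_i=\exp(-\zeta'_\theta(A_i,0))$. *)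

theory Defs
  imports "HOL-Complex_Analysis.Complex_Analysis"
begin

section \<open>Complex Hilbert spaces\<close>

text \<open>The inner product is linear in the first and conjugate linear in the second argument.
  No separability is assumed.\<close>

class chilbert_space = banach +
  fixes scaleC :: "complex \<Rightarrow> 'a \<Rightarrow> 'a" (infixr \<open>*\<^sub>C\<close> 75)
    and cinner :: "'a \<Rightarrow> 'a \<Rightarrow> complex"
  assumes scaleC_add_right: "c *\<^sub>C (x + y) = c *\<^sub>C x + c *\<^sub>C y"
    and scaleC_add_left: "(c + d) *\<^sub>C x = c *\<^sub>C x + d *\<^sub>C x"
    and scaleC_scaleC: "c *\<^sub>C (d *\<^sub>C x) = (c * d) *\<^sub>C x"
    and scaleR_scaleC: "scaleR r x = complex_of_real r *\<^sub>C x"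
    and cinner_commute: "cinner x y = cnj (cinner y x)"
    and cinner_add_left: "cinner (x + y) z = cinner x z + cinner y z"
    and cinner_scaleC_left: "cinner (c *\<^sub>C x) y = c * cinner x y"
    and cinner_self: "cinner x x = complex_of_real ((norm x)\<^sup>2)"

definition csubspace :: "'h::chilbert_space set \<Rightarrow> bool" where
  "csubspace V \<longleftrightarrow> 0 \<in> V \<and> (\<forall>x\<in>V. \<forall>y\<in>V. x + y \<in> V) \<and> (\<forall>c. \<forall>x\<in>V. c *\<^sub>C x \<in> V)"

text \<open>A closed subspace \<open>V\<close> is itself a Hilbert space with the induced inner product; the notions
  below are relative to \<open>V\<close>, and the values of an operator on \<open>V\<close> outside of \<open>V\<close> are irrelevant.\<close>

definition bounded_op_on :: "'h::chilbert_space set \<Rightarrow> ('h \<Rightarrow> 'h) \<Rightarrow> bool" where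
  "bounded_op_on V T \<longleftrightarrow>
     (\<forall>x\<in>V. T x \<in> V) \<and>
     (\<forall>x\<in>V. \<forall>y\<in>V. T (x + y) = T x + T y) \<and>
     (\<forall>c. \<forall>x\<in>V. T (c *\<^sub>C x) = c *\<^sub>C T x) \<and>
     (\<exists>C. \<forall>x\<in>V. norm (T x) \<le> C * norm x)"

definition orthonormal_basis :: "'h::chilbert_space set \<Rightarrow> 'h set \<Rightarrow> bool" where
  "orthonormal_basis V E \<longleftrightarrow>
     E \<subseteq> V \<and>
     (\<forall>e\<in>E. \<forall>e'\<in>E. cinner e e' = (if e = e' then 1 else 0)) \<and>
     (\<forall>x\<in>V. (\<forall>e\<in>E. cinner x e = 0) \<longrightarrow> x = 0)"

section \<open>Trace class operators and the Fredholm determinant\<close>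

text \<open>\<open>P = |T|\<close>, i.e. \<open>P \<ge> 0\<close> and \<open>P\<^sup>2 = T\<^sup>*T\<close>; the latter is written with the sesquilinear
  forms \<open>\<langle>P\<^sup>2x, y\<rangle> = \<langle>Px, Py\<rangle>\<close> and \<open>\<langle>T\<^sup>*Tx, y\<rangle> = \<langle>Tx, Ty\<rangle>\<close>.\<close>

definition abs_op_on :: "'h::chilbert_space set \<Rightarrow> ('h \<Rightarrow> 'h) \<Rightarrow> ('h \<Rightarrow> 'h) \<Rightarrow> bool" where
  "abs_op_on V T P \<longleftrightarrow>
     bounded_op_on V P \<and>
     (\<forall>x\<in>V. cinner (P x) x \<in> \<real> \<and> 0 \<le> Re (cinner (P x) x)) \<and>
     (\<forall>x\<in>V. \<forall>y\<in>V. cinner (P x) (P y) = cinner (T x) (T y))"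

definition trace_class :: "'h::chilbert_space set \<Rightarrow> ('h \<Rightarrow> 'h) \<Rightarrow> bool" where
  "trace_class V T \<longleftrightarrow>
     bounded_op_on V T \<and>
     (\<exists>P E. abs_op_on V T P \<and> orthonormal_basis V E \<and>
            (\<lambda>e. Re (cinner (P e) e)) summable_on E)"

text \<open>Any orthonormal basis may be used in the next two definitions: for trace class operators
  the values do not depend on it.\<close>

definition op_trace :: "'h::chilbert_space set \<Rightarrow> ('h \<Rightarrow> 'h) \<Rightarrow> complex" where
  "op_trace V T = (\<Sum>\<^sub>\<infinity>e\<in>(SOME E. orthonormal_basis V E). cinner (T e) e)"

text \<open>\<open>det\<^sub>F(Id + W) = \<Sum>\<^sub>k Tr(\<Lambda>\<^sup>k W)\<close>. The wedge products of the \<open>k\<close>-element subsets \<open>F\<close> of an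
  orthonormal basis form an orthonormal basis of the \<open>k\<close>-th exterior power, and the corresponding
  diagonal entry of \<open>\<Lambda>\<^sup>k W\<close> is the principal minor of \<open>W\<close> given by \<open>F\<close>.\<close>

definition principal_minor :: "('h::chilbert_space \<Rightarrow> 'h) \<Rightarrow> 'h set \<Rightarrow> complex" where
  "principal_minor W F =
     (\<Sum>p | p permutes F. of_int (sign p) * (\<Prod>e\<in>F. cinner (W e) (p e)))"

definition fredholm_det :: "'h::chilbert_space set \<Rightarrow> ('h \<Rightarrow> 'h) \<Rightarrow> complex" where
  "fredholm_det V S =
     (let E = (SOME E. orthonormal_basis V E); W = (\<lambda>x. S x - x) in
      \<Sum>k. \<Sum>\<^sub>\<infinity>F\<in>{F. F \<subseteq> E \<and> finite F \<and> card F = k}. principal_minor W F)"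

section \<open>Unbounded operators and resolvents\<close>

record 'h operator =
  op_dom :: "'h set"
  op_app :: "'h \<Rightarrow> 'h"

definition closed_operator :: "'h::chilbert_space operator \<Rightarrow> bool" where
  "closed_operator A \<longleftrightarrow>
     csubspace (op_dom A) \<and>
     (\<forall>x\<in>op_dom A. \<forall>y\<in>op_dom A. op_app A (x + y) = op_app A x + op_app A y) \<and>
     (\<forall>c. \<forall>x\<in>op_dom A. op_app A (c *\<^sub>C x) = c *\<^sub>C op_app A x) \<and>
     closed {(x, op_app A x) |x. x \<in> op_dom A}"

definition resolvent :: "'h::chilbert_space operator \<Rightarrow> complex \<Rightarrow> 'h \<Rightarrow> 'h" where
  "resolvent A z = inv_into (op_dom A) (\<lambda>x. op_app A x - z *\<^sub>C x)"

definition resolvent_set :: "'h::chilbert_space operator \<Rightarrow> complex set" where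
  "resolvent_set A =
     {z. bij_betw (\<lambda>x. op_app A x - z *\<^sub>C x) (op_dom A) UNIV \<and>
         bounded_op_on UNIV (resolvent A z)}"

definition invertible_operator :: "'h::chilbert_space operator \<Rightarrow> bool" where
  "invertible_operator A \<longleftrightarrow> 0 \<in> resolvent_set A"

text \<open>Complex derivative with respect to the operator norm of an operator-valued function.\<close>

definition has_op_derivative ::
  "(complex \<Rightarrow> 'h::chilbert_space \<Rightarrow> 'h) \<Rightarrow> ('h \<Rightarrow> 'h) \<Rightarrow> complex \<Rightarrow> bool" where
  "has_op_derivative F D z \<longleftrightarrow>
     bounded_op_on UNIV D \<and>
     (\<forall>\<epsilon>>0. \<forall>\<^sub>F w in at z. \<forall>x.
        norm (F w x - F z x - (w - z) *\<^sub>C D x) \<le> \<epsilon> * cmod (w - z) * norm x)"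

definition op_deriv :: "(complex \<Rightarrow> 'h::chilbert_space \<Rightarrow> 'h) \<Rightarrow> complex \<Rightarrow> 'h \<Rightarrow> 'h" where
  "op_deriv F z = (SOME D. has_op_derivative F D z)"

section \<open>Spectral cuts\<close>

text \<open>\<open>|Arg (z e\<^sup>-\<^sup>i\<^sup>\<theta>)|\<close> with the principal argument is the distance from \<open>arg z\<close> to \<open>\<theta>\<close>
  modulo \<open>2\<pi>\<close>.\<close>

definition cut_region :: "real \<Rightarrow> real \<Rightarrow> real \<Rightarrow> complex set" where
  "cut_region \<theta> \<delta> \<rho> = {z. z \<noteq> 0 \<and> \<bar>Arg (z * cis (- \<theta>))\<bar> < \<delta>} \<union> {z. cmod z < \<rho>}"

definition at_infinity_within :: "complex set \<Rightarrow> complex filter" where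
  "at_infinity_within \<Lambda> = inf at_infinity (principal \<Lambda>)"

definition spectral_cut_on :: "real \<Rightarrow> real \<Rightarrow> real \<Rightarrow> 'h::chilbert_space operator \<Rightarrow> bool" where
  "spectral_cut_on \<theta> \<delta> \<rho> A \<longleftrightarrow>
     \<delta> > 0 \<and> \<rho> > 0 \<and>
     cut_region \<theta> \<delta> \<rho> \<subseteq> resolvent_set A \<and>
     (\<forall>z\<in>cut_region \<theta> \<delta> \<rho>. \<exists>D. has_op_derivative (resolvent A) D z) \<and>
     (\<lambda>z. onorm (resolvent A z)) \<in> O[at_infinity_within (cut_region \<theta> \<delta> \<rho>)](\<lambda>z. 1 / cmod z)"

section \<open>Logarithm, powers and asymptotic expansions\<close>

text \<open>The argument in \<open>[\<theta> - 2\<pi>, \<theta>)\<close>.\<close>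

definition arg_cut :: "real \<Rightarrow> complex \<Rightarrow> real" where
  "arg_cut \<theta> z = \<theta> - 2 * pi + Arg2pi (z * cis (- \<theta>))"

lemma arg_cut:
  "\<theta> - 2 * pi \<le> arg_cut \<theta> z" "arg_cut \<theta> z < \<theta>" "z = rcis (cmod z) (arg_cut \<theta> z)"
proof -
  show "\<theta> - 2 * pi \<le> arg_cut \<theta> z" "arg_cut \<theta> z < \<theta>"
    using Arg2pi_ge_0 Arg2pi_lt_2pi by (simp_all add: arg_cut_def)
  have "z * cis (- \<theta>) = of_real (cmod z) * cis (Arg2pi (z * cis (- \<theta>)))"
    using Arg2pi_eq[of "z * cis (- \<theta>)"] by (simp add: norm_mult cis_conv_exp)
  then have "z * cis (- \<theta>) * cis \<theta> = of_real (cmod z) * cis (Arg2pi (z * cis (- \<theta>))) * cis \<theta>"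
    by simp
  then have "z = of_real (cmod z) * cis (Arg2pi (z * cis (- \<theta>)) + \<theta>)"
    by (simp add: mult.assoc cis_mult)
  moreover have "cis (arg_cut \<theta> z) = cis (Arg2pi (z * cis (- \<theta>)) + \<theta>)"
  proof -
    have "arg_cut \<theta> z + 2 * pi = Arg2pi (z * cis (- \<theta>)) + \<theta>"
      by (simp add: arg_cut_def)
    moreover have "cis (arg_cut \<theta> z + 2 * pi) = cis (arg_cut \<theta> z)"
      by (simp add: cis_mult[symmetric] del: cis_mult)
    ultimately show ?thesis by metis
  qed
  ultimately show "z = rcis (cmod z) (arg_cut \<theta> z)"
    by (simp add: rcis_def)
qed

definition log_cut :: "real \<Rightarrow> complex \<Rightarrow> complex" where
  "log_cut \<theta> z = Complex (ln (cmod z)) (arg_cut \<theta> z)"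

definition pow_cut :: "real \<Rightarrow> complex \<Rightarrow> real \<Rightarrow> complex" where
  "pow_cut \<theta> z a = exp (of_real a * log_cut \<theta> z)"

text \<open>\<open>f(\<lambda>) \<sim> \<Sum>\<^sub>j\<^sub>\<ge>\<^sub>0 \<Sum>\<^sub>k\<^sub>=\<^sub>0\<^sub>,\<^sub>1 c\<^sub>j\<^sub>,\<^sub>k (-\<lambda>)\<^bsup>-\<beta>\<^sub>j\<^esup> log\<^sup>k(-\<lambda>) + g(\<lambda>)\<close> as \<open>\<lambda> \<rightarrow> \<infinity>\<close> in \<open>\<Lambda>\<close>,
  where \<open>g\<close> collects the finitely many extra terms.\<close>

definition log_expansion ::
  "real \<Rightarrow> complex set \<Rightarrow> (complex \<Rightarrow> complex) \<Rightarrow> (nat \<Rightarrow> real) \<Rightarrow> (nat \<Rightarrow> nat \<Rightarrow> complex) \<Rightarrow>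
   (complex \<Rightarrow> complex) \<Rightarrow> bool" where
  "log_expansion \<theta> \<Lambda> f \<beta> c g \<longleftrightarrow>
     strict_mono \<beta> \<and> filterlim \<beta> at_top sequentially \<and>
     (\<forall>\<epsilon>>0. \<forall>\<^sub>F N in sequentially.
        (\<lambda>z. cmod (f z - (\<Sum>j<N. \<Sum>k\<le>1. c j k * pow_cut \<theta> (- z) (- \<beta> j) * log_cut \<theta> (- z) ^ k) - g z))
          \<in> O[at_infinity_within \<Lambda>](\<lambda>z. cmod z powr (- \<beta> N + \<epsilon>)))"

definition reg_limit :: "real \<Rightarrow> complex set \<Rightarrow> (complex \<Rightarrow> complex) \<Rightarrow> complex" where
  "reg_limit \<theta> \<Lambda> f =
     (THE c1. \<exists>\<beta> c c0. (\<forall>j. \<beta> j \<noteq> 0) \<and>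
        log_expansion \<theta> \<Lambda> f \<beta> c (\<lambda>z. c0 * log_cut \<theta> (- z) + c1))"

section \<open>Complex powers, zeta functions and zeta determinants\<close>

text \<open>\<open>A\<^sup>-\<^sup>s x = i/(2\<pi>) \<integral>\<^sub>C \<lambda>\<^sup>-\<^sup>s (A - \<lambda>)\<^sup>-\<^sup>1 x d\<lambda>\<close>. The contour is parametrised by \<open>\<lambda> = r e\<^sup>i\<^sup>\<phi>\<close> with
  \<open>\<lambda>\<^sup>-\<^sup>s = exp (- s (ln r + i \<phi>))\<close>. On the incoming leg \<open>\<phi> = \<theta>\<close>, on the outgoing leg
  \<open>\<phi> = \<theta> - 2\<pi>\<close>; the incoming leg and the (clockwise) circle are run through in the direction
  of decreasing \<open>r\<close> and \<open>\<phi>\<close>, whence the signs.\<close>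

definition polar_power :: "real \<Rightarrow> real \<Rightarrow> complex \<Rightarrow> complex" where
  "polar_power r \<phi> w = exp (w * Complex (ln r) \<phi>)"

definition op_power ::
  "real \<Rightarrow> real \<Rightarrow> 'h::chilbert_space operator \<Rightarrow> complex \<Rightarrow> 'h \<Rightarrow> 'h" where
  "op_power \<theta> \<rho> A s x =
     (\<i> / (2 * of_real pi)) *\<^sub>C
       (- integral {\<rho>..} (\<lambda>r. (polar_power r \<theta> (- s) * cis \<theta>) *\<^sub>C resolvent A (rcis r \<theta>) x)
        - integral {\<theta> - 2 * pi..\<theta>}
            (\<lambda>\<phi>. (polar_power \<rho> \<phi> (- s) * (\<i> * rcis \<rho> \<phi>)) *\<^sub>C resolvent A (rcis \<rho> \<phi>) x)
        + integral {\<rho>..}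
            (\<lambda>r. (polar_power r (\<theta> - 2 * pi) (- s) * cis (\<theta> - 2 * pi)) *\<^sub>C
                  resolvent A (rcis r (\<theta> - 2 * pi)) x))"

text \<open>The meromorphic continuation to the whole plane of a function given on a half plane.
  Nicely meromorphic functions are normalised at removable singularities (and are 0 at poles), so
  the continuation is unique.\<close>

definition mero_extension ::
  "real \<Rightarrow> (complex \<Rightarrow> complex) \<Rightarrow> (complex \<Rightarrow> complex) \<Rightarrow> bool" where
  "mero_extension a f F \<longleftrightarrow>
     F nicely_meromorphic_on UNIV \<and> (\<forall>s. Re s > a \<longrightarrow> F s = f s)"

text \<open>The number \<open>\<rho>\<close> is the radius of the circle in the contour.\<close>

definition zeta_rel ::
  "real \<Rightarrow> real \<Rightarrow> 'h::chilbert_space operator \<Rightarrow> 'h operator \<Rightarrow> complex \<Rightarrow> complex" where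
  "zeta_rel \<theta> \<rho> A\<^sub>1 A\<^sub>2 =
     (THE F. mero_extension 1
        (\<lambda>s. op_trace UNIV (\<lambda>x. op_power \<theta> \<rho> A\<^sub>1 s x - op_power \<theta> \<rho> A\<^sub>2 s x)) F)"

definition det_zeta_rel ::
  "real \<Rightarrow> real \<Rightarrow> 'h::chilbert_space operator \<Rightarrow> 'h operator \<Rightarrow> complex" where
  "det_zeta_rel \<theta> \<rho> A\<^sub>1 A\<^sub>2 = exp (- deriv (zeta_rel \<theta> \<rho> A\<^sub>1 A\<^sub>2) 0)"

definition zeta_op :: "real \<Rightarrow> real \<Rightarrow> 'h::chilbert_space operator \<Rightarrow> complex \<Rightarrow> complex" where
  "zeta_op \<theta> \<rho> A =
     (THE F. \<exists>a. mero_extension a (\<lambda>s. op_trace UNIV (op_power \<theta> \<rho> A s)) F)"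

definition det_zeta :: "real \<Rightarrow> real \<Rightarrow> 'h::chilbert_space operator \<Rightarrow> complex" where
  "det_zeta \<theta> \<rho> A = exp (- deriv (zeta_op \<theta> \<rho> A) 0)"

section \<open>Zeta-comparable and zeta-admissible operators\<close>

text \<open>\<open>S \<lambda>\<close> is the scattering operator on the closed subspace \<open>K \<lambda>\<close>, and \<open>L\<close> is the chosen branch
  of \<open>log det\<^sub>F S\<^sub>\<lambda>\<close>. The coefficient \<open>b J 1\<close> plays no role.\<close>

definition zeta_comparable ::
  "real \<Rightarrow> real \<Rightarrow> real \<Rightarrow> 'h::chilbert_space operator \<Rightarrow> 'h operator \<Rightarrow>
   (complex \<Rightarrow> 'h set) \<Rightarrow> (complex \<Rightarrow> 'h \<Rightarrow> 'h) \<Rightarrow> (complex \<Rightarrow> complex) \<Rightarrow>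
   (nat \<Rightarrow> real) \<Rightarrow> nat \<Rightarrow> (nat \<Rightarrow> nat \<Rightarrow> complex) \<Rightarrow> bool" where
  "zeta_comparable \<theta> \<delta> \<rho> A\<^sub>1 A\<^sub>2 K S L \<alpha> J b \<longleftrightarrow>
     (let \<Lambda> = cut_region \<theta> \<delta> \<rho>; D = (\<lambda>z x. resolvent A\<^sub>1 z x - resolvent A\<^sub>2 z x) in
      closed_operator A\<^sub>1 \<and> closed_operator A\<^sub>2 \<and>
      invertible_operator A\<^sub>1 \<and> invertible_operator A\<^sub>2 \<and>
      spectral_cut_on \<theta> \<delta> \<rho> A\<^sub>1 \<and> spectral_cut_on \<theta> \<delta> \<rho> A\<^sub>2 \<and>
      (\<forall>z\<in>\<Lambda>. trace_class UNIV (D z)) \<and>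
      (\<forall>z\<in>\<Lambda>. csubspace (K z) \<and> closed (K z) \<and> trace_class (K z) (\<lambda>x. S z x - x)) \<and>
      L holomorphic_on \<Lambda> \<and> (\<forall>z\<in>\<Lambda>. exp (L z) = fredholm_det (K z) (S z)) \<and>
      (\<forall>z\<in>\<Lambda>. op_trace UNIV (D z) = - deriv L z) \<and>
      0 < \<alpha> 0 \<and> \<alpha> J = 1 \<and>
      log_expansion \<theta> \<Lambda> (\<lambda>z. op_trace UNIV (D z)) \<alpha>
        (\<lambda>j k. if j = J then 0 else b j k) (\<lambda>z. b J 0 * pow_cut \<theta> (- z) (- 1)))"

definition zeta_admissible ::
  "real \<Rightarrow> 'h::chilbert_space operator \<Rightarrow> 'h operator \<Rightarrow> bool" where
  "zeta_admissible \<theta> A\<^sub>1 A\<^sub>2 \<longleftrightarrow>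
     (\<exists>\<delta> \<rho>. \<exists>\<alpha> :: nat \<Rightarrow> real. strict_mono \<alpha> \<and> filterlim \<alpha> at_top sequentially \<and>
       (\<forall>A\<in>{A\<^sub>1, A\<^sub>2}.
          closed_operator A \<and> invertible_operator A \<and> spectral_cut_on \<theta> \<delta> \<rho> A \<and>
          (\<exists>a :: nat \<Rightarrow> nat \<Rightarrow> nat \<Rightarrow> complex. \<forall>m. real m > - \<alpha> 0 \<longrightarrow>
             (\<forall>z\<in>cut_region \<theta> \<delta> \<rho>. trace_class UNIV ((op_deriv ^^ m) (resolvent A) z)) \<and>
             log_expansion \<theta> (cut_region \<theta> \<delta> \<rho>)
               (\<lambda>z. op_trace UNIV ((op_deriv ^^ m) (resolvent A) z))
               (\<lambda>j. \<alpha> j + real m) (a m) (\<lambda>_. 0) \<and>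
             (\<forall>j. \<alpha> j = 1 \<longrightarrow> a m j 1 = 0))))"

end

theory Submission
  imports Defs "HOL-Real_Asymp.Real_Asymp"
begin

text \<open>
  By the resolvent identity \<open>R\<^sub>1(\<lambda>) - R\<^sub>2(\<lambda>) = (1 + \<lambda>R\<^sub>2(\<lambda>)) (R\<^sub>1(0) - R\<^sub>2(0)) (1 + \<lambda>R\<^sub>1(\<lambda>))\<close>, the trace
  norm of the resolvent difference is bounded on the contour, so for \<open>Re s > 1\<close> the trace and the
  contour integral may be interchanged and the relative zeta function is the contour integral of
  \<open>\<lambda>\<^sup>-\<^sup>s f(\<lambda>)\<close> with \<open>f = - L'\<close>, where \<open>L = log det\<^sub>F S\<^sub>\<lambda>\<close>. The two rays combine to \<open>sin (\<pi>s)\<close> times a Mellin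
  transform of \<open>f\<close>, whose poles are read off from the expansion of \<open>f\<close>; the sine removes the pole at
  \<open>s = 0\<close>. Differentiating at \<open>0\<close>, the circle contributes \<open>L(0) - L(\<rho>e\<^sup>i\<^sup>\<theta>)\<close> by the mean value property, and
  the finite part of the Mellin transform completes \<open>L(\<rho>e\<^sup>i\<^sup>\<theta>)\<close> to the regularized limit, because the
  expansion of \<open>L\<close> is obtained by integrating that of \<open>f\<close>. For admissible operators, \<open>m\<close> integrations by
  parts turn \<open>\<lambda>\<^sup>-\<^sup>s R(\<lambda>)\<close> into \<open>\<lambda>\<^sup>m\<^sup>-\<^sup>s R(\<lambda>)\<^sup>m\<^sup>+\<^sup>1\<close>, and the same argument applies to each operator separately.
\<close>

section \<open>Bessel, Parseval and the trace norm\<close>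

text \<open>Trace class means that <|T|e, e> is summable over one basis, while traces are taken over
  a basis picked by \<open>SOME\<close>. What is needed is therefore an absolute bound for the sums
  of <ZTXe, e> over arbitrary finite orthonormal families, linear in the norms of X and Z. It is
  proved for a single operator at \<lambda> = 0. The factors 1 + \<lambda>R(\<lambda>), bounded on
  the contour because \<lambda>R(\<lambda>) is, carry it to all other \<lambda>; no adjoint is
  formed. That (-\<lambda>)^-1 comes without a logarithm makes the pole of the Mellin transform at s
  = 0 simple; a double pole would survive the sine. For the m-th derivative of a resolvent the point
  s = 0 becomes -m, again a zero of the sine, and the critical exponent is again 1. Zeta functions
  are compared as normalised meromorphic functions on the plane, so agreement far to the right is
  agreement everywhere. The quotient formula then follows from the additivity of the trace and the
  regularity of both single zeta functions at 0; their derivatives there are never computed.\<close>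

lemma scaleC_zero_right [simp]: "c *\<^sub>C (0::'h::chilbert_space) = 0"
  using scaleC_add_right[of c 0 "0::'h"] by simp

lemma scaleC_zero_left [simp]: "0 *\<^sub>C (x::'h::chilbert_space) = 0"
  using scaleC_add_left[of 0 0 x] by simp

lemma scaleC_one [simp]: "1 *\<^sub>C (x::'h::chilbert_space) = x"
  using scaleR_scaleC[of 1 x] by simp

lemma scaleC_minus_left [simp]: "(- c) *\<^sub>C (x::'h::chilbert_space) = - (c *\<^sub>C x)"
  by (metis add_eq_0_iff scaleC_add_left add.right_inverse scaleC_zero_left)

lemma scaleC_minus_right [simp]: "c *\<^sub>C (- x::'h::chilbert_space) = - (c *\<^sub>C x)"
  by (metis add_eq_0_iff scaleC_add_right add.right_inverse scaleC_zero_right)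

lemma scaleC_diff_left: "(c - d) *\<^sub>C (x::'h::chilbert_space) = c *\<^sub>C x - d *\<^sub>C x"
  by (metis diff_conv_add_uminus scaleC_add_left scaleC_minus_left)

lemma scaleC_diff_right: "c *\<^sub>C (x - y::'h::chilbert_space) = c *\<^sub>C x - c *\<^sub>C y"
  by (metis diff_conv_add_uminus scaleC_add_right scaleC_minus_right)

lemma scaleC_sum_right: "c *\<^sub>C (\<Sum>i\<in>I. f i :: 'h::chilbert_space) = (\<Sum>i\<in>I. c
    *\<^sub>C f i)"
  by (induction I rule: infinite_finite_induct) (auto simp: scaleC_add_right)

lemma cinner_add_right: "cinner x (y + z) = cinner x y + cinner x (z::'h::chilbert_space)"
  by (metis cinner_add_left cinner_commute complex_cnj_add)

lemma cinner_scaleC_right: "cinner x (c *\<^sub>C y) = cnj c * cinner x (y::'h::chilbert_space)"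
  by (metis cinner_scaleC_left cinner_commute complex_cnj_mult)

lemma cinner_zero_left [simp]: "cinner (0::'h::chilbert_space) x = 0"
  using cinner_scaleC_left[of 0 "0::'h"] by simp

lemma cinner_zero_right [simp]: "cinner x (0::'h::chilbert_space) = 0"
  using cinner_scaleC_right[of _ 0 "0::'h"] by simp

lemma cinner_minus_left [simp]: "cinner (- x) y = - cinner x (y::'h::chilbert_space)"
  using cinner_scaleC_left[of "-1" x] by simp

lemma cinner_diff_left: "cinner (x - y) z = cinner x z - cinner y (z::'h::chilbert_space)"
  by (metis cinner_add_left cinner_minus_left diff_conv_add_uminus)

lemma cinner_sum_left: "cinner (\<Sum>i\<in>I. f i) (y::'h::chilbert_space) = (\<Sum>i\<in>I.
    cinner (f i) y)"
  by (induction I rule: infinite_finite_induct) (auto simp: cinner_add_left)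

lemma cinner_sum_right: "cinner (y::'h::chilbert_space) (\<Sum>i\<in>I. f i) = (\<Sum>i\<in>I.
    cinner y (f i))"
  by (induction I rule: infinite_finite_induct) (auto simp: cinner_add_right)

lemma norm_scaleC: "norm (c *\<^sub>C (x::'h::chilbert_space)) = cmod c * norm x"
proof -
  have "complex_of_real ((norm (c *\<^sub>C x))\<^sup>2) = c * cnj c * complex_of_real ((norm
      x)\<^sup>2)"
    unfolding cinner_self[symmetric] by (simp add: cinner_scaleC_left cinner_scaleC_right)
  also have "\<dots> = complex_of_real ((cmod c * norm x)\<^sup>2)"
    by (simp add: complex_norm_square[symmetric] power_mult_distrib del: of_real_mult
        of_real_power) (simp add: complex_norm_square)
  finally have "(norm (c *\<^sub>C x))\<^sup>2 = (cmod c * norm x)\<^sup>2"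
    using of_real_eq_iff by blast
  then show ?thesis by simp
qed

section \<open>Positive semidefinite sesquilinear forms\<close>

definition psd_form :: "('h::chilbert_space \<Rightarrow> 'h \<Rightarrow> complex) \<Rightarrow>
    bool" where
  "psd_form q \<longleftrightarrow>
     (\<forall>x y z. q (x + y) z = q x z + q y z) \<and> (\<forall>c x y. q (c *\<^sub>C x) y = c
         * q x y) \<and>
     (\<forall>x y z. q z (x + y) = q z x + q z y) \<and> (\<forall>c x y. q x (c *\<^sub>C y) =
         cnj c * q x y) \<and>
     (\<forall>x. q x x \<in> \<real> \<and> 0 \<le> Re (q x x))"

text \<open>Realness of the diagonal forces the symmetry: testing x + y settles the imaginary parts,
  testing x + iy the real parts.\<close>

lemma psd_form_sym:
  assumes "psd_form q"
  shows "q y x = cnj (q x y)"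
proof -
  note q = assms[unfolded psd_form_def]
  have "q (x + y) (x + y) = q x x + q y y + (q x y + q y x)"
    using q by (simp add: algebra_simps)
  then have "Im (q x y + q y x) = 0"
    using q by (metis (no_types, opaque_lifting) complex_is_Real_iff add_cancel_right_right
        plus_complex.simps(2))
  moreover have "q (x + \<i> *\<^sub>C y) (x + \<i> *\<^sub>C y) = q x x + q y y + \<i> * (q y x -
      q x y)"
    using q by (simp add: algebra_simps)
  then have "Im (\<i> * (q y x - q x y)) = 0"
    using q by (metis (no_types, opaque_lifting) complex_is_Real_iff add_cancel_right_right
        plus_complex.simps(2))
  ultimately show ?thesis
    by (simp add: complex_eq_iff)
qed

lemma psd_form_Cauchy_Schwarz:
  assumes "psd_form q"
  shows "(cmod (q x y))\<^sup>2 \<le> Re (q x x) * Re (q y y)"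
proof -
  note q = assms[unfolded psd_form_def]
  define p where "p = Re (q x x)"
  define r where "r = Re (q y y)"
  have p: "q x x = of_real p" "p \<ge> 0" and r: "q y y = of_real r" "r \<ge> 0"
    using q by (auto simp: p_def r_def of_real_Re)
  \<comment> \<open>Positivity of q at t x - q(x,y) y. The coefficient q(x,y) aligns the phases, so
    a real parameter t suffices.\<close>
  have key: "0 \<le> p * t\<^sup>2 - 2 * t * (cmod (q x y))\<^sup>2 + (cmod (q x y))\<^sup>2 * r"
      for t :: real
  proof -
    have "q (of_real t *\<^sub>C x + (- q x y) *\<^sub>C y) (of_real t *\<^sub>C x + (- q x y)
        *\<^sub>C y) =
      of_real (t\<^sup>2 * p) - of_real (2 * t) * (q x y * cnj (q x y)) + q x y * cnj (q x y) *
          of_real r"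
      using q psd_form_sym[OF assms, of x y] p r
      by (simp add: algebra_simps power2_eq_square del: scaleC_minus_left)
    also have "\<dots> = of_real (p * t\<^sup>2 - 2 * t * (cmod (q x y))\<^sup>2 + (cmod (q x
        y))\<^sup>2 * r)"
      by (simp add: complex_norm_square[symmetric] algebra_simps)
    finally show ?thesis
      using q by (metis Re_complex_of_real)
  qed
  show ?thesis
  proof (cases "p = 0")
    case True
    show ?thesis
    proof (cases "q x y = 0")
      case False
      \<comment> \<open>For p = 0 the bound is linear in t, and t = r + 1 already makes it negative
        unless q(x,y) = 0.\<close>
      have "0 \<le> (cmod (q x y))\<^sup>2 * (r - 2 * (r + 1))"
        using key[of "r + 1"] True by (simp add: algebra_simps)
      then have "r - 2 * (r + 1) \<ge> 0"
        using False by (simp add: zero_le_mult_iff)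
      then show ?thesis using r by simp
    qed (use p r in \<open>simp add: p_def[symmetric] r_def[symmetric]\<close>)
  next
    case False
    define m where "m = (cmod (q x y))\<^sup>2"
    \<comment> \<open>The value t = m / p minimises the quadratic polynomial in t.\<close>
    have "0 \<le> p * (m / p)\<^sup>2 - 2 * (m / p) * m + m * r"
      using key[of "m / p"] by (simp add: m_def)
    also have "\<dots> = m * (p * r - m) / p"
      using False by (simp add: field_simps power2_eq_square)
    finally have "m * (p * r - m) \<ge> 0"
      using False p by (simp add: zero_le_divide_iff)
    moreover have m0: "m \<ge> 0" by (simp add: m_def)
    ultimately have "m = 0 \<or> m \<le> p * r"
      using m0 by (auto simp: zero_le_mult_iff)
    moreover have "p * r \<ge> 0" using p r by simp
    ultimately have "m \<le> p * r" by linarith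
    then show ?thesis unfolding m_def p_def r_def .
  qed
qed

lemma psd_form_cinner: "psd_form (cinner :: 'h::chilbert_space \<Rightarrow> 'h \<Rightarrow>
    complex)"
  by (simp add: psd_form_def cinner_add_left cinner_add_right cinner_scaleC_left
      cinner_scaleC_right cinner_self del: of_real_power)

lemma cinner_Cauchy_Schwarz: "cmod (cinner x (y::'h::chilbert_space)) \<le> norm x * norm y"
proof -
  have "(cmod (cinner x y))\<^sup>2 \<le> (norm x * norm y)\<^sup>2"
    using psd_form_Cauchy_Schwarz[OF psd_form_cinner, of x y]
    by (simp add: cinner_self power_mult_distrib del: of_real_power)
  then show ?thesis by (rule power2_le_imp_le) simp
qed

section \<open>Bounded operators with explicit bounds\<close>

lemma bounded_bilinear_scaleC: "bounded_bilinear (\<lambda>c (x::'h::chilbert_space). c *\<^sub>C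
    x)"
  by (rule bounded_bilinear.intro)
     (auto simp: scaleC_add_right scaleC_add_left scaleR_scaleC scaleC_scaleC norm_scaleC
        scaleR_conv_of_real mult.commute intro!: exI[of _ 1])

lemmas continuous_on_scaleC [continuous_intros] =
  bounded_bilinear.continuous_on[OF bounded_bilinear_scaleC]

lemma bounded_linear_cinner_left: "bounded_linear (\<lambda>x::'h::chilbert_space. cinner x y)"
  by (rule bounded_linear_intro[where K = "norm y"])
     (simp_all add: cinner_add_left scaleR_scaleC cinner_scaleC_left cinner_Cauchy_Schwarz
        scaleR_conv_of_real)

text \<open>The bound is an explicit parameter because the trace estimate is linear in it. Its sign
  is part of the definition since bounds get multiplied, and on the zero space the norm inequality
  alone would admit negative C.\<close>

definition op_bound :: "('h::chilbert_space \<Rightarrow> 'h) \<Rightarrow> real \<Rightarrow>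
    bool" where
  "op_bound T C \<longleftrightarrow> (\<forall>x y. T (x + y) = T x + T y) \<and> (\<forall>c x. T
      (c *\<^sub>C x) = c *\<^sub>C T x) \<and>
     (\<forall>x. norm (T x) \<le> C * norm x) \<and> 0 \<le> C"

lemma op_boundD:
  assumes "op_bound T C"
  shows "T (x + y) = T x + T y" "T (c *\<^sub>C x) = c *\<^sub>C T x" "norm (T x) \<le> C * norm x"
      "0 \<le> C"
    "T 0 = 0" "T (x - y) = T x - T y" "T (- x) = - T x"
proof -
  show *: "T (x + y) = T x + T y" "T (c *\<^sub>C x) = c *\<^sub>C T x" "norm (T x) \<le> C * norm
      x" "0 \<le> C"
    for x y c
    using assms by (auto simp: op_bound_def)
  show "T 0 = 0" using *(2)[of 0 0] by simp
  show m: "T (- x) = - T x" for x using *(2)[of "-1" x] by simp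
  show "T (x - y) = T x - T y"
    using *(1)[of x "- y"] m[of y] by simp
qed

lemma op_bound_sum: "op_bound T C \<Longrightarrow> T (\<Sum>i\<in>I. f i) = (\<Sum>i\<in>I. T (f
    i))"
  by (induction I rule: infinite_finite_induct) (auto simp: op_boundD)

lemma op_bound_mono: "op_bound T C \<Longrightarrow> C \<le> C' \<Longrightarrow> op_bound T C'"
  unfolding op_bound_def by (meson mult_right_mono norm_ge_zero order_trans)

lemma op_bound_comp: "op_bound T C \<Longrightarrow> op_bound U D \<Longrightarrow> op_bound
    (\<lambda>x. T (U x)) (C * D)"
  unfolding op_bound_def
  by (metis (no_types, lifting) mult.assoc mult_left_mono mult_nonneg_nonneg order_trans)

lemma bounded_op_on_UNIV_iff: "bounded_op_on UNIV T \<longleftrightarrow> (\<exists>C. op_bound T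
    C)"
proof
  assume "bounded_op_on UNIV T"
  then obtain C where C: "\<And>x. norm (T x) \<le> C * norm x"
    and l: "(\<forall>x y. T (x + y) = T x + T y) \<and> (\<forall>c x. T (c *\<^sub>C x) = c
        *\<^sub>C T x)"
    by (auto simp: bounded_op_on_def)
  have "norm (T x) \<le> \<bar>C\<bar> * norm x" for x
    using C[of x] by (meson abs_ge_self mult_right_mono norm_ge_zero order_trans)
  then show "\<exists>C. op_bound T C"
    using l by (auto simp: op_bound_def intro!: exI[of _ "\<bar>C\<bar>"])
qed (auto simp: bounded_op_on_def op_bound_def)

lemma op_bound_imp_bounded_linear:
  assumes "op_bound T C" shows "bounded_linear T"
  by (rule bounded_linear_intro[where K = C])
     (use assms in \<open>auto simp: op_boundD scaleR_scaleC mult.commute\<close>)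

section \<open>Orthonormal families, Bessel and Parseval\<close>

definition orthonormal :: "'h::chilbert_space set \<Rightarrow> bool" where
  "orthonormal E \<longleftrightarrow> (\<forall>e\<in>E. \<forall>e'\<in>E. cinner e e' = (if e =
      e' then 1 else 0))"

lemma orthonormal_subset: "orthonormal E \<Longrightarrow> F \<subseteq> E \<Longrightarrow>
    orthonormal F"
  unfolding orthonormal_def by blast

lemma orthonormal_basis_imp_orthonormal: "orthonormal_basis V E \<Longrightarrow> orthonormal E"
  by (simp add: orthonormal_basis_def orthonormal_def)

definition proj_span :: "'h::chilbert_space set \<Rightarrow> 'h \<Rightarrow> 'h" where
  "proj_span F x = (\<Sum>e\<in>F. cinner x e *\<^sub>C e)"

lemma norm_orthonormal_sum:
  assumes "orthonormal F" "finite F"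
  shows "(norm (\<Sum>e\<in>F. c e *\<^sub>C e))\<^sup>2 = (\<Sum>e\<in>F. (cmod (c e))\<^sup>2)"
proof -
  have "cinner (\<Sum>e\<in>F. c e *\<^sub>C e) (\<Sum>e\<in>F. c e *\<^sub>C e) =
      (\<Sum>e\<in>F. \<Sum>e'\<in>F. c e * (cnj (c e') * (if e = e' then 1 else 0)))"
    unfolding cinner_sum_left cinner_sum_right cinner_scaleC_left cinner_scaleC_right
        sum_distrib_left
    by (intro sum.cong refl) (use assms(1) in \<open>simp add: orthonormal_def\<close>)
  also have "\<dots> = (\<Sum>e\<in>F. c e * cnj (c e))"
    using assms(2) by (intro sum.cong refl) (simp add: if_distrib if_distribR sum.delta' cong:
        if_cong)
  also have "\<dots> = of_real (\<Sum>e\<in>F. (cmod (c e))\<^sup>2)"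
    unfolding of_real_sum complex_norm_square ..
  finally show ?thesis
    unfolding cinner_self using of_real_eq_iff by blast
qed

lemma proj_span_orthogonal:
  assumes "orthonormal F" "finite F" "e \<in> F"
  shows "cinner (x - proj_span F x) e = 0"
proof -
  have "cinner (proj_span F x) e = (\<Sum>e'\<in>F. cinner x e' * (if e' = e then 1 else 0))"
    unfolding proj_span_def cinner_sum_left cinner_scaleC_left
    by (intro sum.cong refl) (use assms in \<open>simp add: orthonormal_def\<close>)
  also have "\<dots> = cinner x e"
    using assms by (simp add: if_distrib if_distribR cong: if_cong)
  finally show ?thesis by (simp add: cinner_diff_left)
qed

lemma pythagoras:
  assumes "cinner x (y::'h::chilbert_space) = 0"
  shows "(norm (x + y))\<^sup>2 = (norm x)\<^sup>2 + (norm y)\<^sup>2"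
proof -
  have "cinner y x = 0" using assms cinner_commute[of y x] by simp
  then have "complex_of_real ((norm (x + y))\<^sup>2) = complex_of_real ((norm x)\<^sup>2 + (norm
      y)\<^sup>2)"
    using assms unfolding of_real_add cinner_self[symmetric] by (simp add: cinner_add_left
        cinner_add_right)
  then show ?thesis using of_real_eq_iff by blast
qed

lemma norm_proj_span:
  assumes "orthonormal F" "finite F"
  shows "(norm x)\<^sup>2 = (norm (x - proj_span F x))\<^sup>2 + (\<Sum>e\<in>F. (cmod (cinner x
      e))\<^sup>2)"
proof -
  have "cinner (x - proj_span F x) (proj_span F x) = 0"
    using proj_span_orthogonal[OF assms]
    by (subst (2) proj_span_def) (simp add: cinner_sum_right cinner_scaleC_right)
  from pythagoras[OF this] show ?thesis
    using norm_orthonormal_sum[OF assms, of "cinner x"] by (simp add: proj_span_def)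
qed

lemma Bessel:
  assumes "orthonormal F" "finite F"
  shows "(\<Sum>e\<in>F. (cmod (cinner x e))\<^sup>2) \<le> (norm x)\<^sup>2"
  using norm_proj_span[OF assms, of x] by simp

lemma op_bound_proj_span:
  assumes "orthonormal F" "finite F"
  shows "op_bound (proj_span F) 1"
proof -
  have "norm (proj_span F x) \<le> norm x" for x
    by (rule power2_le_imp_le)
       (use norm_orthonormal_sum[OF assms, of "cinner x"] Bessel[OF assms, of x] in
        \<open>simp_all add: proj_span_def\<close>)
  then show ?thesis
    by (simp add: op_bound_def proj_span_def cinner_add_left scaleC_add_left sum.distrib
        cinner_scaleC_left scaleC_sum_right scaleC_scaleC)
qed

text \<open>A basis is defined by its trivial orthogonal complement. By Bessel the net of partial
  sums is Cauchy, and its limit y leaves x - y orthogonal to every basis vector, so y = x. Nets are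
  used because E may be uncountable.\<close>

lemma tendsto_proj_span:
  fixes E :: "'h::chilbert_space set"
  assumes "orthonormal_basis UNIV E"
  shows "((\<lambda>F. proj_span F x) \<longlongrightarrow> x) (finite_subsets_at_top E)"
proof -
  have on: "orthonormal E" and z: "\<And>y. (\<And>e. e \<in> E \<Longrightarrow> cinner y e = 0)
      \<Longrightarrow> y = 0"
    using assms by (auto simp: orthonormal_basis_def orthonormal_def)
  have on': "orthonormal F" if "F \<subseteq> E" for F
    using orthonormal_subset[OF on that] .
  define g where "g e = (cmod (cinner x e))\<^sup>2" for e
  have "g summable_on E"
  proof (rule nonneg_bdd_above_summable_on)
    show "bdd_above (sum g ` {F. F \<subseteq> E \<and> finite F})"
      using Bessel[OF on'] by (auto simp: bdd_above_def g_def)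
  qed (simp add: g_def)
  define s where "s = (\<Sum>\<^sub>\<infinity>e\<in>E. g e)"
  have le: "sum g F \<le> s" if "finite F" "F \<subseteq> E" for F
    using \<open>g summable_on E\<close> that unfolding s_def by (intro finite_sum_le_infsum) (auto
        simp: g_def)
  have lim: "(sum g \<longlongrightarrow> s) (finite_subsets_at_top E)"
    using has_sum_infsum[OF \<open>g summable_on E\<close>] by (simp add: s_def has_sum_def)
  have "\<exists>P. eventually P (finite_subsets_at_top E) \<and>
      (\<forall>F G. P F \<and> P G \<longrightarrow> dist (proj_span F x) (proj_span G x) <
          \<epsilon>)" if "\<epsilon> > 0" for \<epsilon>
  proof -
    have "\<epsilon>\<^sup>2 / 4 > 0" using that by simp
    from tendstoD[OF lim this] have "\<exists>F0. finite F0 \<and> F0 \<subseteq> E \<and>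
        (\<forall>F. finite F \<and> F0 \<subseteq> F \<and> F \<subseteq> E \<longrightarrow> dist
            (sum g F) s < \<epsilon>\<^sup>2 / 4)"
      unfolding eventually_finite_subsets_at_top .
    then obtain F0 where F0: "finite F0 \<and> F0 \<subseteq> E \<and>
        (\<forall>F. finite F \<and> F0 \<subseteq> F \<and> F \<subseteq> E \<longrightarrow> dist
            (sum g F) s < \<epsilon>\<^sup>2 / 4)" ..
    have *: "norm (proj_span F x - proj_span F0 x) < \<epsilon> / 2" if "finite F" "F0 \<subseteq>
        F" "F \<subseteq> E" for F
    proof -
      have "proj_span F x - proj_span F0 x = (\<Sum>e\<in>F - F0. cinner x e *\<^sub>C e)"
        using that by (simp add: proj_span_def sum_diff)
      then have "(norm (proj_span F x - proj_span F0 x))\<^sup>2 = sum g (F - F0)"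
        using norm_orthonormal_sum[of "F - F0" "cinner x"] on' that
        by (metis (no_types, lifting) Diff_subset finite_Diff g_def order_trans sum.cong)
      also have "\<dots> = sum g F - sum g F0" using that by (simp add: sum_diff)
      also have "\<dots> < \<epsilon>\<^sup>2 / 4"
      proof -
        have "dist (sum g F0) s < \<epsilon>\<^sup>2 / 4" using F0 by simp
        then have "s - sum g F0 < \<epsilon>\<^sup>2 / 4" unfolding dist_real_def by linarith
        then show ?thesis using le[of F] that by simp
      qed
      finally have "(norm (proj_span F x - proj_span F0 x))\<^sup>2 < (\<epsilon> / 2)\<^sup>2"
        by (simp add: power_divide)
      then show ?thesis using \<open>\<epsilon> > 0\<close> by (meson less_le_not_le
          power2_less_imp_less half_gt_zero)
    qed
    show ?thesis
      using F0 * dist_triangle_half_r[of "proj_span F0 x"]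
      by (intro exI[of _ "\<lambda>F. finite F \<and> F0 \<subseteq> F \<and> F \<subseteq> E"])
         (auto simp: eventually_finite_subsets_at_top dist_norm norm_minus_commute)
  qed
  then have "cauchy_filter (filtermap (\<lambda>F. proj_span F x) (finite_subsets_at_top E))"
    by (simp add: cauchy_filter_metric_filtermap)
  moreover have "filtermap (\<lambda>F. proj_span F x) (finite_subsets_at_top E) \<noteq> bot"
    by (simp add: filtermap_bot_iff)
  moreover have "filtermap (\<lambda>F. proj_span F x) (finite_subsets_at_top E) \<le> principal
      UNIV"
    by simp
  moreover have "complete (UNIV :: 'h set)"
    by (simp add: complete_UNIV)
  ultimately obtain y where "filtermap (\<lambda>F. proj_span F x) (finite_subsets_at_top E) \<le>
      nhds y"
    unfolding complete_uniform by blast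
  then have y: "((\<lambda>F. proj_span F x) \<longlongrightarrow> y) (finite_subsets_at_top E)"
    by (simp add: filterlim_def)
  have "x - y = 0"
  proof (rule z)
    fix e assume e: "e \<in> E"
    have "((\<lambda>F. cinner (x - proj_span F x) e) \<longlongrightarrow> cinner (x - y) e)
        (finite_subsets_at_top E)"
      by (intro bounded_linear.tendsto[OF bounded_linear_cinner_left] tendsto_intros y)
    moreover have "eventually (\<lambda>F. cinner (x - proj_span F x) e = 0) (finite_subsets_at_top
        E)"
      unfolding eventually_finite_subsets_at_top
      using e proj_span_orthogonal on' by (intro exI[of _ "{e}"]) auto
    ultimately have "((\<lambda>F. 0) \<longlongrightarrow> cinner (x - y) e)
        (finite_subsets_at_top E)"
      using tendsto_cong by fastforce
    then show "cinner (x - y) e = 0"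
      by (simp add: tendsto_const_iff)
  qed
  then show ?thesis using y by simp
qed

lemma Parseval:
  assumes "orthonormal_basis UNIV E"
  shows "((\<lambda>e. (cmod (cinner x e))\<^sup>2) has_sum (norm x)\<^sup>2) E"
proof -
  have on: "orthonormal F" if "F \<subseteq> E" for F
    using orthonormal_subset[OF orthonormal_basis_imp_orthonormal[OF assms] that] .
  have "((\<lambda>F. (norm (proj_span F x))\<^sup>2) \<longlongrightarrow> (norm x)\<^sup>2)
      (finite_subsets_at_top E)"
    by (intro tendsto_intros tendsto_proj_span assms)
  moreover have "eventually (\<lambda>F. (norm (proj_span F x))\<^sup>2 = (\<Sum>e\<in>F. (cmod
      (cinner x e))\<^sup>2))
      (finite_subsets_at_top E)"
    unfolding proj_span_def
    by (rule eventually_finite_subsets_at_top_weakI) (use norm_orthonormal_sum on in blast)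
  ultimately show ?thesis
    unfolding has_sum_def using tendsto_cong by fastforce
qed

text \<open>Gram-Schmidt for the form \<open>\<langle>Px, y\<rangle>\<close>, skipping the vectors on which it
  degenerates: on the span of \<open>G\<close> both \<open>P = |T|\<close> and \<open>T\<close> become finite rank operators with the same
  coefficient functionals, which replaces the polar and the spectral decomposition.\<close>

lemma abs_op_Gram_Schmidt:
  fixes T P :: "'h::chilbert_space \<Rightarrow> 'h"
  assumes T: "op_bound T CT" and P: "op_bound P CP"
    and pos: "\<And>x. cinner (P x) x \<in> \<real> \<and> 0 \<le> Re (cinner (P x) x)"
    and abs: "\<And>x y. cinner (P x) (P y) = cinner (T x) (T y)"
    and "finite G"
  shows "\<exists>(n::nat) h. (\<forall>x. (\<Sum>k<n. (cmod (cinner x (P (h k))))\<^sup>2) \<le>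
      Re (cinner (P x) x)) \<and>
     (\<forall>g\<in>G. P g = (\<Sum>k<n. cinner g (P (h k)) *\<^sub>C P (h k)) \<and>
            T g = (\<Sum>k<n. cinner g (P (h k)) *\<^sub>C T (h k)))"
  using \<open>finite G\<close>
proof (induction G)
  case empty
  show ?case using pos by (intro exI[of _ 0]) auto
next
  case (insert g G)
  from insert.IH obtain n :: nat and h where
    IH: "(\<forall>x. (\<Sum>k<n. (cmod (cinner x (P (h k))))\<^sup>2) \<le> Re (cinner (P x) x))
        \<and>
     (\<forall>g\<in>G. P g = (\<Sum>k<n. cinner g (P (h k)) *\<^sub>C P (h k)) \<and>
            T g = (\<Sum>k<n. cinner g (P (h k)) *\<^sub>C T (h k)))"
    by (elim exE)
  have
    le: "\<And>x. (\<Sum>k<n. (cmod (cinner x (P (h k))))\<^sup>2) \<le> Re (cinner (P x) x)"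
    and PG: "\<And>g. g \<in> G \<Longrightarrow> P g = (\<Sum>k<n. cinner g (P (h k)) *\<^sub>C P
        (h k))"
    and TG: "\<And>g. g \<in> G \<Longrightarrow> T g = (\<Sum>k<n. cinner g (P (h k)) *\<^sub>C T
        (h k))"
    using IH by blast+
  define Q where "Q x = P x - (\<Sum>k<n. cinner x (P (h k)) *\<^sub>C P (h k))" for x
  have Q_inner: "cinner (Q x) y = cinner (P x) y - (\<Sum>k<n. cinner x (P (h k)) * cinner (P (h
      k)) y)" for x y
    by (simp add: Q_def cinner_diff_left cinner_sum_left cinner_scaleC_left)
  have Qxx: "cinner (Q x) x = cinner (P x) x - of_real (\<Sum>k<n. (cmod (cinner x (P (h
      k))))\<^sup>2)" for x
    unfolding Q_inner of_real_sum complex_norm_square by (metis cinner_commute)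
  have psd: "psd_form (\<lambda>x y. cinner (Q x) y)"
    unfolding psd_form_def
  proof (intro conjI allI)
    show "cinner (Q x) x \<in> \<real>" for x
      unfolding Qxx using pos by (intro Reals_diff) auto
    show "0 \<le> Re (cinner (Q x) x)" for x
      unfolding Qxx using le[of x] by simp
  qed (simp_all add: Q_inner op_boundD[OF P] cinner_add_left cinner_add_right cinner_scaleC_left
      cinner_scaleC_right algebra_simps sum.distrib sum_distrib_left)
  \<comment> \<open>The residual of g: P maps it to Q g, and T maps it to the part of T g still to
    be represented.\<close>
  define f where "f = g - (\<Sum>k<n. cinner g (P (h k)) *\<^sub>C h k)"
  have Pf: "P f = Q g" and Tf: "T f = T g - (\<Sum>k<n. cinner g (P (h k)) *\<^sub>C T (h k))"
    by (simp_all add: f_def Q_def op_boundD[OF P] op_boundD[OF T] op_bound_sum[OF P]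
        op_bound_sum[OF T])
  define r where "r = Re (cinner (Q g) g)"
  have r: "cinner (Q g) g = of_real r" "0 \<le> r"
    using psd by (auto simp: psd_form_def r_def of_real_Re)
  \<comment> \<open>Since Q g is orthogonal to the old vectors, the new coefficient functional
    vanishes on them and their representations stay valid.\<close>
  have QG: "cinner g' (Q g) = 0" if "g' \<in> G" for g'
  proof -
    have "Q g' = 0" using PG[OF that] by (simp add: Q_def)
    then have "cinner (Q g) g' = 0"
      using psd_form_sym[OF psd, of g g'] by simp
    then show ?thesis using cinner_commute[of g' "Q g"] by simp
  qed
  have CS: "(cmod (cinner x (Q g)))\<^sup>2 \<le> Re (cinner (Q x) x) * r" for x
  proof -
    have "cmod (cinner x (Q g)) = cmod (cinner (Q x) g)"
      using psd_form_sym[OF psd, of g x] cinner_commute[of x "Q g"] by simp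
    then show ?thesis using psd_form_Cauchy_Schwarz[OF psd, of x g] by (simp add: r_def)
  qed
  show ?case
  proof (cases "r = 0")
    case True
    \<comment> \<open>Degenerate case: Cauchy-Schwarz for the form of Q, tested at Q g itself, gives
      Q g = 0. Then P f = 0, and |Tf| = |Pf| gives T f = 0, so g is already represented.\<close>
    have "Q g = 0"
      using CS[of "Q g"] True by (simp add: cinner_self)
    then have "P f = 0" using Pf by simp
    then have "T f = 0"
      using abs[of f f] by (simp add: cinner_self)
    then have "T g = (\<Sum>k<n. cinner g (P (h k)) *\<^sub>C T (h k))" using Tf by simp
    moreover have "P g = (\<Sum>k<n. cinner g (P (h k)) *\<^sub>C P (h k))"
      using \<open>Q g = 0\<close> by (simp add: Q_def)
    ultimately show ?thesis
      using le PG TG by (intro exI[of _ n] exI[of _ h]) blast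
  next
    case False
    with r have r: "r > 0" "cinner (Q g) g = of_real r" by auto
    \<comment> \<open>The scaling gives <g, P h'> P h' = Q g: the two factors 1 / sqrt r cancel
      against <g, Q g> = r.\<close>
    define h' where "h' k = (if k = n then of_real (1 / sqrt r) *\<^sub>C f else h k)" for k
    have Ph': "P (h' n) = of_real (1 / sqrt r) *\<^sub>C Q g" and Th': "T (h' n) = of_real (1 /
        sqrt r) *\<^sub>C T f"
      by (simp_all add: h'_def op_boundD[OF P] op_boundD[OF T] Pf)
    have old: "cinner x (P (h' k)) = cinner x (P (h k))" "P (h' k) = P (h k)" "T (h' k) = T (h k)"
        if "k < n" for k x
      using that by (simp_all add: h'_def)
    have new: "cinner x (P (h' n)) = of_real (1 / sqrt r) * cinner x (Q g)" for x
      by (simp add: Ph' cinner_scaleC_right)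
    have gQ: "cinner g (Q g) = of_real r"
      using cinner_commute[of g "Q g"] r by simp
    show ?thesis
    proof (intro exI[of _ "Suc n"] exI[of _ h'] conjI allI ballI)
      fix x
      have "(cmod (cinner x (P (h' n))))\<^sup>2 = (cmod (cinner x (Q g)))\<^sup>2 / r"
        unfolding new using r by (simp add: norm_mult power_mult_distrib norm_divide power_divide)
      also have "\<dots> \<le> Re (cinner (Q x) x)"
        using CS[of x] r by (simp add: divide_le_eq)
      finally show "(\<Sum>k<Suc n. (cmod (cinner x (P (h' k))))\<^sup>2) \<le> Re (cinner (P x) x)"
        using Qxx[of x] by (simp add: old)
    next
      fix a assume a: "a \<in> insert g G"
      have "P a = (\<Sum>k<n. cinner a (P (h k)) *\<^sub>C P (h k)) + cinner a (P (h' n)) *\<^sub>C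
          P (h' n) \<and>
            T a = (\<Sum>k<n. cinner a (P (h k)) *\<^sub>C T (h k)) + cinner a (P (h' n)) *\<^sub>C
                T (h' n)"
      proof (cases "a \<in> G")
        case True
        then show ?thesis using PG TG QG by (simp add: new)
      next
        case False
        then have [simp]: "a = g" using a by simp
        have c: "cinner a (P (h' n)) = of_real (1 / sqrt r) * of_real r"
          by (simp only: new gQ \<open>a = g\<close>)
        have one: "complex_of_real (1 / sqrt r) * of_real r * of_real (1 / sqrt r) = 1"
          using r unfolding of_real_mult[symmetric] by simp
        have "cinner a (P (h' n)) *\<^sub>C P (h' n) = Q g" "cinner a (P (h' n)) *\<^sub>C T (h' n)
            = T f"
          unfolding c unfolding Ph' Th' scaleC_scaleC one by simp_all
        then show ?thesis by (simp add: Tf) (simp add: Q_def)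
      qed
      then show "P a = (\<Sum>k<Suc n. cinner a (P (h' k)) *\<^sub>C P (h' k))"
        and "T a = (\<Sum>k<Suc n. cinner a (P (h' k)) *\<^sub>C T (h' k))"
        by (simp_all add: old)
    qed
  qed
qed

section \<open>Absolute sums of matrix entries of trace class operators\<close>

lemma sum_cmod_cinner_le:
  assumes "orthonormal F" "finite F" "op_bound B C"
  shows "(\<Sum>e\<in>F. (cmod (cinner (B e) w))\<^sup>2) \<le> (C * norm w)\<^sup>2"
proof -
  define s where "s = (\<Sum>e\<in>F. (cmod (cinner (B e) w))\<^sup>2)"
  define y where "y = (\<Sum>e\<in>F. cnj (cinner (B e) w) *\<^sub>C e)"
  have y: "(norm y)\<^sup>2 = s"
    unfolding y_def s_def norm_orthonormal_sum[OF assms(1,2)] by simp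
  have "cinner (B y) w = of_real s"
    unfolding y_def s_def op_bound_sum[OF assms(3)] op_boundD[OF assms(3)] cinner_sum_left
      cinner_scaleC_left of_real_sum complex_norm_square by (simp add: mult.commute)
  then have "s \<le> norm (B y) * norm w"
    using cinner_Cauchy_Schwarz[of "B y" w] by (metis abs_ge_self norm_of_real order_trans)
  also have "\<dots> \<le> C * norm y * norm w"
    by (intro mult_right_mono op_boundD[OF assms(3)]) auto
  finally have le: "s \<le> norm y * (C * norm w)" by (simp add: algebra_simps)
  show ?thesis
  proof (cases "norm y = 0")
    case True
    then show ?thesis using y by (simp add: s_def[symmetric])
  next
    case False
    then have "norm y \<le> C * norm w"
      using le y by (metis mult_le_cancel_left_pos norm_ge_zero order_le_less power2_eq_square)
    then have "(norm y)\<^sup>2 \<le> (C * norm w)\<^sup>2" by (rule power_mono) simp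
    then show ?thesis by (simp add: y s_def[symmetric])
  qed
qed

text \<open>The number \<tau> is the trace of |T| in the basis E of the definition, whereas F is
  unrelated to E. On the span of a finite part G of E, T is a sum of rank one operators <., w_k> T
  h_k with |T h_k| = |w_k|. Cauchy-Schwarz over F bounds each by |w_k|^2 times the bounds of X and
  Z, and the sum of the |w_k|^2 is at most \<tau>, independently of G.\<close>

lemma trace_class_bound:
  fixes T :: "'h::chilbert_space \<Rightarrow> 'h"
  assumes "trace_class UNIV T"
  obtains \<tau> where "0 \<le> \<tau>"
    "\<And>X Z CX CZ F. op_bound X CX \<Longrightarrow> op_bound Z CZ \<Longrightarrow> orthonormal
        F \<Longrightarrow> finite F \<Longrightarrow>
       (\<Sum>e\<in>F. cmod (cinner (Z (T (X e))) e)) \<le> CX * CZ * \<tau>"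
proof -
  from assms obtain CT P CP E where T: "op_bound T CT" and P: "op_bound P CP"
    and pos: "\<And>x. cinner (P x) x \<in> \<real> \<and> 0 \<le> Re (cinner (P x) x)"
    and abs: "\<And>x y. cinner (P x) (P y) = cinner (T x) (T y)"
    and E: "orthonormal_basis UNIV E" and summ: "(\<lambda>e. Re (cinner (P e) e)) summable_on E"
    by (auto simp: trace_class_def abs_op_on_def bounded_op_on_UNIV_iff)
  define \<tau> where "\<tau> = (\<Sum>\<^sub>\<infinity>e\<in>E. Re (cinner (P e) e))"
  show ?thesis
  proof (rule that[of \<tau>])
    show "0 \<le> \<tau>" unfolding \<tau>_def by (intro infsum_nonneg) (use pos in auto)
    fix X Z :: "'h \<Rightarrow> 'h" and CX CZ and F :: "'h set"
    assume X: "op_bound X CX" and Z: "op_bound Z CZ" and F: "orthonormal F" "finite F"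
    have bound: "(\<Sum>e\<in>F. cmod (cinner (Z (T (proj_span G (X e)))) e)) \<le> CX * CZ *
        \<tau>"
      if G: "finite G" "G \<subseteq> E" for G
    proof -
      have onG: "orthonormal G"
        using orthonormal_subset[OF orthonormal_basis_imp_orthonormal[OF E] G(2)] .
      from abs_op_Gram_Schmidt[OF T P pos abs G(1)] obtain n :: nat and h where
        GS: "(\<forall>x. (\<Sum>k<n. (cmod (cinner x (P (h k))))\<^sup>2) \<le> Re (cinner (P x)
            x)) \<and>
          (\<forall>g\<in>G. P g = (\<Sum>k<n. cinner g (P (h k)) *\<^sub>C P (h k)) \<and>
            T g = (\<Sum>k<n. cinner g (P (h k)) *\<^sub>C T (h k)))"
        by (elim exE)
      have le: "\<And>x. (\<Sum>k<n. (cmod (cinner x (P (h k))))\<^sup>2) \<le> Re (cinner (P x) x)"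
        and TG: "\<And>g. g \<in> G \<Longrightarrow> T g = (\<Sum>k<n. cinner g (P (h k))
            *\<^sub>C T (h k))"
        using GS by blast+
      define w where "w k = P (h k)" for k
      \<comment> \<open>The diagonal case of the identity of forms P^2 = T^*T.\<close>
      have norm_w: "norm (T (h k)) = norm (w k)" for k
      proof -
        have "complex_of_real ((norm (T (h k)))\<^sup>2) = complex_of_real ((norm (w k))\<^sup>2)"
          unfolding cinner_self[symmetric] w_def abs ..
        then have "(norm (T (h k)))\<^sup>2 = (norm (w k))\<^sup>2"
          using of_real_eq_iff by blast
        then show ?thesis by simp
      qed
      \<comment> \<open>Parseval for each w_k in E, compared term by term with <Pe, e> through the
        inequality of the Gram-Schmidt step.\<close>
      have "((\<lambda>e. \<Sum>k<n. (cmod (cinner (w k) e))\<^sup>2) has_sum (\<Sum>k<n. (norm (w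
          k))\<^sup>2)) E"
        by (induction n) (auto intro!: has_sum_0 has_sum_add Parseval E)
      moreover have "((\<lambda>e. Re (cinner (P e) e)) has_sum \<tau>) E"
        using summ unfolding \<tau>_def by (rule has_sum_infsum)
      moreover have "(\<Sum>k<n. (cmod (cinner (w k) e))\<^sup>2) \<le> Re (cinner (P e) e)" for e
        using le[of e] cinner_commute[of "w _" e] by (simp add: w_def)
      ultimately have sum_w: "(\<Sum>k<n. (norm (w k))\<^sup>2) \<le> \<tau>"
        by (rule has_sum_mono)
      have Tproj: "T (proj_span G x) = (\<Sum>k<n. cinner (proj_span G x) (w k) *\<^sub>C T (h k))"
          for x
      proof -
        have "T (proj_span G x) = (\<Sum>g\<in>G. \<Sum>k<n. (cinner x g * cinner g (w k))
            *\<^sub>C T (h k))"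
          unfolding proj_span_def op_bound_sum[OF T] op_boundD[OF T]
          by (intro sum.cong refl) (simp add: TG scaleC_sum_right scaleC_scaleC w_def)
        also have "\<dots> = (\<Sum>k<n. \<Sum>g\<in>G. (cinner x g * cinner g (w k)) *\<^sub>C T
            (h k))"
          by (rule sum.swap)
        also have "\<dots> = (\<Sum>k<n. cinner (proj_span G x) (w k) *\<^sub>C T (h k))"
        proof (intro sum.cong refl)
          show "(\<Sum>g\<in>G. (cinner x g * cinner g (w k)) *\<^sub>C T (h k)) =
            cinner (proj_span G x) (w k) *\<^sub>C T (h k)" for k
            unfolding proj_span_def cinner_sum_left cinner_scaleC_left
            by (induction G rule: infinite_finite_induct) (auto simp: scaleC_add_left)
        qed
        finally show ?thesis .
      qed
      \<comment> \<open>The projection is absorbed into X at no cost, so the first factor can be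
        estimated over F by duality.\<close>
      have Y: "op_bound (\<lambda>x. proj_span G (X x)) CX"
        using op_bound_comp[OF op_bound_proj_span[OF onG G(1)] X] by simp
      have "(\<Sum>e\<in>F. cmod (cinner (Z (T (proj_span G (X e)))) e)) \<le>
          (\<Sum>e\<in>F. \<Sum>k<n. cmod (cinner (proj_span G (X e)) (w k)) * cmod (cinner (Z (T
              (h k))) e))"
        unfolding Tproj op_bound_sum[OF Z] op_boundD[OF Z] cinner_sum_left cinner_scaleC_left
        by (intro sum_mono order_trans[OF norm_sum]) (simp add: norm_mult)
      also have "\<dots> = (\<Sum>k<n. \<Sum>e\<in>F. cmod (cinner (proj_span G (X e)) (w k)) *
          cmod (cinner (Z (T (h k))) e))"
        by (rule sum.swap)
      also have "\<dots> \<le> (\<Sum>k<n. CX * norm (w k) * (CZ * norm (w k)))"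
      proof (intro sum_mono)
        fix k
        have "(\<Sum>e\<in>F. cmod (cinner (proj_span G (X e)) (w k)) * cmod (cinner (Z (T (h k)))
            e)) \<le>
          sqrt (\<Sum>e\<in>F. (cmod (cinner (proj_span G (X e)) (w k)))\<^sup>2) * sqrt
              (\<Sum>e\<in>F. (cmod (cinner (Z (T (h k))) e))\<^sup>2)"
          using L2_set_mult_ineq[of "\<lambda>e. cmod (cinner (proj_span G (X e)) (w k))"
              "\<lambda>e. cmod (cinner (Z (T (h k))) e)" F]
          by (simp add: L2_set_def)
        also have "\<dots> \<le> sqrt ((CX * norm (w k))\<^sup>2) * sqrt ((norm (Z (T (h
            k))))\<^sup>2)"
          by (intro mult_mono real_sqrt_le_mono sum_cmod_cinner_le[OF F Y] Bessel[OF F]) (auto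
              intro: sum_nonneg)
        also have "\<dots> \<le> CX * norm (w k) * (CZ * norm (w k))"
          using op_boundD(3)[OF Z, of "T (h k)"] op_boundD(4)[OF X]
          by (auto simp: norm_w real_sqrt_abs abs_mult intro!: mult_left_mono)
        finally show "(\<Sum>e\<in>F. cmod (cinner (proj_span G (X e)) (w k)) * cmod (cinner (Z (T
            (h k))) e)) \<le>
          CX * norm (w k) * (CZ * norm (w k))" .
      qed
      also have "\<dots> = CX * CZ * (\<Sum>k<n. (norm (w k))\<^sup>2)"
        by (simp add: sum_distrib_left power2_eq_square mult_ac)
      also have "\<dots> \<le> CX * CZ * \<tau>"
        using sum_w op_boundD(4)[OF X] op_boundD(4)[OF Z] by (intro mult_left_mono) auto
      finally show ?thesis .
    qed
    have ZT: "bounded_linear (\<lambda>x. Z (T x))"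
      by (rule op_bound_imp_bounded_linear[OF op_bound_comp[OF Z T]])
    \<comment> \<open>The estimate is uniform in G and F is finite, so it survives the exhaustion of
      E.\<close>
    have "((\<lambda>G. \<Sum>e\<in>F. cmod (cinner (Z (T (proj_span G (X e)))) e))
        \<longlongrightarrow>
        (\<Sum>e\<in>F. cmod (cinner (Z (T (X e))) e))) (finite_subsets_at_top E)"
      by (intro tendsto_sum tendsto_norm bounded_linear.tendsto[OF bounded_linear_cinner_left]
          bounded_linear.tendsto[OF ZT] tendsto_proj_span E)
    then show "(\<Sum>e\<in>F. cmod (cinner (Z (T (X e))) e)) \<le> CX * CZ * \<tau>"
      by (rule tendsto_upperbound) (use bound in \<open>auto intro!:
          eventually_finite_subsets_at_top_weakI\<close>)
  qed
qed

section \<open>Improper integrals\<close>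

text \<open>The explicit tail estimate serves twice: it makes truncated Mellin transforms converge
  locally uniformly, and it gives the rate at which L approaches its expansion along the
  ray.\<close>

lemma improper_integral_powr_bound:
  fixes g :: "real \<Rightarrow> 'a::banach"
  assumes "a > 0" "continuous_on {a..} g" "e < -1" "\<And>r. r \<ge> a \<Longrightarrow> norm (g r)
      \<le> C * r powr e"
  shows "g integrable_on {a..}"
    and "b \<ge> a \<Longrightarrow> norm (integral {a..} g - integral {a..b} g) \<le> C * (b powr
        (e + 1) / (- (e + 1)))"
    and "((\<lambda>b. integral {a..b} g) \<longlongrightarrow> integral {a..} g) at_top"
proof -
  have int: "g integrable_on {c..}" if "c \<ge> a" for c
  proof (rule integrable_on_all_intervals_integrable_bound[where g = "\<lambda>r. C * r powr e"])
    fix x y :: real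
    have "g integrable_on {max x c..y}"
      by (intro integrable_continuous_interval continuous_on_subset[OF assms(2)]) (use that in auto)
    moreover have "{max x c..y} = {c..} \<inter> cbox x y" by auto
    ultimately show "(\<lambda>t. if t \<in> {c..} then g t else 0) integrable_on cbox x y"
      by (simp only: integrable_restrict_Int)
  next
    show "(\<lambda>r. C * r powr e) integrable_on {c..}"
      using has_integral_powr_to_inf[of e c] assms that
      by (intro integrable_on_mult_right) (auto simp: integrable_on_def)
  qed (use assms that in auto)
  show "g integrable_on {a..}" using int by simp
  show tail: "norm (integral {a..} g - integral {a..b} g) \<le> C * (b powr (e + 1) / (- (e + 1)))"
      if "b \<ge> a" for b
  proof -
    have "(g has_integral (integral {a..b} g + integral {b..} g)) ({a..b} \<union> {b..})"
    proof (rule has_integral_Un)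
      show "(g has_integral integral {a..b} g) {a..b}"
        by (intro integrable_integral integrable_continuous_interval continuous_on_subset[OF
            assms(2)]) auto
      have "{a..b} \<inter> {b..} = {b}" using that by auto
      then show "negligible ({a..b} \<inter> {b..})" by simp
    qed (use int that in \<open>auto intro: integrable_integral\<close>)
    moreover have "{a..b} \<union> {b..} = {a..}" using that by auto
    ultimately have "integral {a..} g - integral {a..b} g = integral {b..} g"
      by (metis add_diff_cancel_left' integral_unique)
    moreover have "((\<lambda>r. C * r powr e) has_integral C * (- (b powr (e + 1)) / (e + 1)))
        {b..}"
      using has_integral_powr_to_inf[of e b] assms that by (intro has_integral_mult_right) auto
    then have "norm (integral {b..} g) \<le> C * (- (b powr (e + 1)) / (e + 1))"
      using integral_norm_bound_integral[OF int[OF that], of "\<lambda>r. C * r powr e"] assms that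
      by (metis (no_types, lifting) atLeast_iff has_integral_integrable integral_unique order_trans)
    ultimately show ?thesis by (metis minus_divide_left minus_divide_right)
  qed
  have "((\<lambda>b. C * (b powr (e + 1) / (- (e + 1)))) \<longlongrightarrow> 0) at_top"
    using assms(3) by real_asymp
  moreover have "eventually (\<lambda>b. norm (integral {a..b} g - integral {a..} g) \<le> C * (b
      powr (e + 1) / (- (e + 1)))) at_top"
    using eventually_ge_at_top[of a] by eventually_elim (use tail in \<open>metis
        norm_minus_commute\<close>)
  ultimately have "((\<lambda>b. integral {a..b} g - integral {a..} g) \<longlongrightarrow> 0)
      at_top"
    by (rule Lim_null_comparison[rotated])
  then show "((\<lambda>b. integral {a..b} g) \<longlongrightarrow> integral {a..} g) at_top"
    by (simp add: LIM_zero_cancel)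
qed

text \<open>Turns an estimate for large r into one from the start of the ray on, as the Mellin
  transform requires; the initial piece is compact.\<close>

lemma bounded_on_halfline:
  fixes f :: "real \<Rightarrow> 'a::real_normed_vector"
  assumes "continuous_on {a..} f" "continuous_on {a..} g" "\<And>r. r \<ge> a \<Longrightarrow> g r
      > (0::real)"
    and "eventually (\<lambda>r. norm (f r) \<le> C * g r) at_top"
  obtains C' where "C' \<ge> 0" "\<And>r. r \<ge> a \<Longrightarrow> norm (f r) \<le> C' * g r"
proof -
  obtain R where R: "\<And>r. r \<ge> R \<Longrightarrow> norm (f r) \<le> C * g r"
    using assms(4) by (auto simp: eventually_at_top_linorder)
  have "continuous_on {a..max a R} (\<lambda>r. norm (f r) / g r)"
    by (intro continuous_intros continuous_on_subset[OF assms(1)] continuous_on_subset[OF assms(2)])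
       (use assms(3) in fastforce)+
  then have "bounded ((\<lambda>r. norm (f r) / g r) ` {a..max a R})"
    by (intro compact_imp_bounded compact_continuous_image) auto
  then obtain B where B: "\<And>r. r \<in> {a..max a R} \<Longrightarrow> norm (f r) / g r \<le> B"
    unfolding bounded_iff by (metis (no_types, lifting) abs_le_D1 image_eqI real_norm_def)
  have "norm (f r) \<le> (\<bar>B\<bar> + \<bar>C\<bar>) * g r" if "r \<ge> a" for r
  proof (cases "r \<le> R")
    case True
    then have "norm (f r) \<le> B * g r" using B[of r] that assms(3)[of r] by (auto simp:
        divide_le_eq)
    also have "\<dots> \<le> (\<bar>B\<bar> + \<bar>C\<bar>) * g r" using assms(3)[OF that] by
        (intro mult_right_mono) auto
    finally show ?thesis .
  next
    case False
    then have "norm (f r) \<le> C * g r" using R by auto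
    also have "\<dots> \<le> (\<bar>B\<bar> + \<bar>C\<bar>) * g r" using assms(3)[OF that] by
        (intro mult_right_mono) auto
    finally show ?thesis .
  qed
  then show ?thesis using that[of "\<bar>B\<bar> + \<bar>C\<bar>"] by auto
qed

section \<open>Interchange of unordered sums and integrals\<close>

lemma filterlim_exhaust_countable:
  assumes "countable A"
  obtains X :: "nat \<Rightarrow> 'a set" where "\<And>n. finite (X n)" "\<And>n. X n \<subseteq> A"
    "filterlim X (finite_subsets_at_top A) sequentially"
proof (rule that)
  define X where "X n = from_nat_into A ` {..<n} \<inter> A" for n
  show "finite (X n)" "X n \<subseteq> A" for n by (auto simp: X_def)
  show "filterlim X (finite_subsets_at_top A) sequentially"
    unfolding filterlim_finite_subsets_at_top
  proof (intro allI impI)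
    fix F assume F: "finite F \<and> F \<subseteq> A"
    define m where "m = (if F = {} then 0 else Suc (Max (to_nat_on A ` F)))"
    have "F \<subseteq> X n" if "n \<ge> m" for n
    proof
      fix x assume x: "x \<in> F"
      then have "to_nat_on A x < m" using F by (auto simp: m_def less_Suc_eq_le)
      moreover have "x = from_nat_into A (to_nat_on A x)" using x F assms by auto
      ultimately show "x \<in> X n" using x F that unfolding X_def
        by (metis IntI image_eqI lessThan_iff order_less_le_trans subsetD)
    qed
    then show "\<forall>\<^sub>F n in sequentially. finite (X n) \<and> F \<subseteq> X n \<and> X
        n \<subseteq> A"
      using F by (intro eventually_mono[OF eventually_ge_at_top[of m]]) (auto simp: X_def)
  qed
qed

text \<open>The index set may be uncountable, but by continuity in \<open>t\<close> only countably many of the functions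
  \<open>g e\<close> do not vanish identically.\<close>

lemma has_sum_integral:
  fixes g :: "'e \<Rightarrow> real \<Rightarrow> complex"
  assumes S: "closed S" and cont: "\<And>e. e \<in> E \<Longrightarrow> continuous_on S (g e)"
    and M: "M integrable_on S"
    and bound: "\<And>F t. finite F \<Longrightarrow> F \<subseteq> E \<Longrightarrow> t \<in> S
        \<Longrightarrow> (\<Sum>e\<in>F. cmod (g e t)) \<le> M t"
  shows "((\<lambda>e. integral S (g e)) has_sum integral S (\<lambda>t.
      \<Sum>\<^sub>\<infinity>e\<in>E. g e t)) E"
proof -
  have Sl: "S \<in> sets lebesgue" using S by (simp add: lborelD)
  have gM: "cmod (g e t) \<le> M t" if "e \<in> E" "t \<in> S" for e t
    using bound[of "{e}" t] that by simp
  have ai: "g e absolutely_integrable_on S" if "e \<in> E" for e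
    by (rule measurable_bounded_by_integrable_imp_absolutely_integrable[OF _ Sl M])
       (use gM that cont in \<open>auto intro: continuous_imp_measurable_on_sets_lebesgue[OF _
           Sl]\<close>)
  have int: "g e integrable_on S" and nint: "(\<lambda>t. cmod (g e t)) integrable_on S" if "e
      \<in> E" for e
    using ai[OF that] by (auto simp: absolutely_integrable_on_def)
  have abs_summ: "(\<lambda>e. norm (g e t)) summable_on E" if "t \<in> S" for t
    by (rule nonneg_bdd_above_summable_on) (use bound that in \<open>auto simp:
        bdd_above_def\<close>)
  have "(\<lambda>e. norm (integral S (g e))) summable_on E"
  proof (rule nonneg_bdd_above_summable_on)
    have "(\<Sum>e\<in>F. cmod (integral S (g e))) \<le> integral S M" if F: "F \<subseteq> E"
        "finite F" for F
    proof -
      have "(\<Sum>e\<in>F. cmod (integral S (g e))) \<le> (\<Sum>e\<in>F. integral S (\<lambda>t.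
          cmod (g e t)))"
        using F by (intro sum_mono integral_norm_bound_integral int nint) auto
      also have "\<dots> = integral S (\<lambda>t. \<Sum>e\<in>F. cmod (g e t))"
        using F by (intro integral_sum[symmetric] nint) auto
      also have "\<dots> \<le> integral S M"
        using F by (intro integral_le integrable_sum nint M bound) auto
      finally show ?thesis .
    qed
    then show "bdd_above (sum (\<lambda>e. norm (integral S (g e))) ` {F. F \<subseteq> E \<and>
        finite F})"
      by (auto simp: bdd_above_def)
  qed auto
  then have summ: "(\<lambda>e. integral S (g e)) summable_on E"
    by (rule abs_summable_summable)
  \<comment> \<open>At each point of a countable dense set, absolute summability leaves countably
    many nonzero terms. A function outside their union \<open>E0\<close> vanishes on the dense set,
    hence on S.\<close>
  obtain Q where Q: "countable Q" "Q \<subseteq> S" "S \<subseteq> closure Q"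
    using separable[of S] by blast
  define E0 where "E0 = (\<Union>q\<in>Q. {e\<in>E. g e q \<noteq> 0})"
  have "countable E0"
    unfolding E0_def using Q abs_summ
    by (intro countable_UN abs_summable_countable) auto
  have E0: "E0 \<subseteq> E" by (auto simp: E0_def)
  have zero: "g e t = 0" if "e \<in> E - E0" "t \<in> S" for e t
  proof -
    have "continuous_on (closure Q \<inter> S) (g e)"
      using cont[of e] that by (auto intro: continuous_on_subset)
    moreover have "closure Q = S" using Q S by (simp add: closure_minimal subset_antisym)
    ultimately have "continuous_on (closure Q) (g e)" by simp
    moreover have "g e q = 0" if "q \<in> Q" for q
      using that \<open>e \<in> E - E0\<close> by (auto simp: E0_def)
    ultimately show ?thesis
      using continuous_constant_on_closure[of Q "g e" 0] that Q by blast
  qed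
  obtain X where X: "\<And>n::nat. finite (X n)" "\<And>n. X n \<subseteq> E0"
    "filterlim X (finite_subsets_at_top E0) sequentially"
    using filterlim_exhaust_countable[OF \<open>countable E0\<close>] by metis
  have "(\<lambda>n. integral S (\<lambda>t. \<Sum>e\<in>X n. g e t)) \<longlonglongrightarrow>
      integral S (\<lambda>t. \<Sum>\<^sub>\<infinity>e\<in>E. g e t)"
  proof -
    have 1: "(\<lambda>t. \<Sum>e\<in>X n. g e t) integrable_on S" for n
      using X E0 by (intro integrable_sum int) auto
    have 2: "norm (\<Sum>e\<in>X n. g e t) \<le> M t" if "t \<in> S" for n t
    proof -
      have "X n \<subseteq> E" using X(2)[of n] E0 by (rule order_trans)
      then have "(\<Sum>e\<in>X n. cmod (g e t)) \<le> M t" using bound[OF X(1)] that by simp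
      then show ?thesis using norm_sum[of "\<lambda>e. g e t" "X n"] by linarith
    qed
    have 3: "(\<lambda>n. \<Sum>e\<in>X n. g e t) \<longlonglongrightarrow>
        (\<Sum>\<^sub>\<infinity>e\<in>E. g e t)" if "t \<in> S" for t
    proof -
      have "((\<lambda>e. g e t) has_sum (\<Sum>\<^sub>\<infinity>e\<in>E. g e t)) E"
        using has_sum_infsum[OF abs_summable_summable[OF abs_summ[OF that]]] .
      then have "((\<lambda>e. g e t) has_sum (\<Sum>\<^sub>\<infinity>e\<in>E. g e t)) E0"
        using E0 zero that by (subst has_sum_cong_neutral[of E E0]) auto
      then show ?thesis
        unfolding has_sum_def using filterlim_compose[OF _ X(3)] by blast
    qed
    show ?thesis
      by (rule dominated_convergence(2)[OF 1 M 2 3])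
  qed
  moreover have "integral S (\<lambda>t. \<Sum>e\<in>X n. g e t) = (\<Sum>e\<in>X n. integral S (g
      e))" for n
    using X E0 by (intro integral_sum int) auto
  moreover have "(\<lambda>n. \<Sum>e\<in>X n. integral S (g e)) \<longlonglongrightarrow>
      (\<Sum>\<^sub>\<infinity>e\<in>E. integral S (g e))"
  proof -
    have "((\<lambda>e. integral S (g e)) has_sum (\<Sum>\<^sub>\<infinity>e\<in>E. integral S (g
        e))) E"
      using summ by (rule has_sum_infsum)
    moreover have "integral S (g e) = 0" if "e \<in> E - E0" for e
      using integral_cong[of S "g e" "\<lambda>_. 0"] zero[OF that] by simp
    ultimately have "((\<lambda>e. integral S (g e)) has_sum (\<Sum>\<^sub>\<infinity>e\<in>E.
        integral S (g e))) E0"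
      using E0 by (subst has_sum_cong_neutral[of E E0]) auto
    then show ?thesis
      unfolding has_sum_def using filterlim_compose[OF _ X(3)] by blast
  qed
  ultimately have "(\<Sum>\<^sub>\<infinity>e\<in>E. integral S (g e)) = integral S (\<lambda>t.
      \<Sum>\<^sub>\<infinity>e\<in>E. g e t)"
    using LIMSEQ_unique by simp
  then show ?thesis using has_sum_infsum[OF summ] by simp
qed

section \<open>The contour and the Mellin transform\<close>

definition ray_int :: "real \<Rightarrow> real \<Rightarrow> complex \<Rightarrow> (complex
    \<Rightarrow> complex) \<Rightarrow> complex" where
  "ray_int \<phi> \<rho> s p = integral {\<rho>..} (\<lambda>r. polar_power r \<phi> (- s) * cis
      \<phi> * p (rcis r \<phi>))"

definition circle_int :: "real \<Rightarrow> real \<Rightarrow> complex \<Rightarrow> (complex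
    \<Rightarrow> complex) \<Rightarrow> complex" where
  "circle_int \<theta> \<rho> s p =
     integral {\<theta> - 2 * pi..\<theta>} (\<lambda>\<phi>. polar_power \<rho> \<phi> (- s) *
         (\<i> * rcis \<rho> \<phi>) * p (rcis \<rho> \<phi>))"

definition contour_int :: "real \<Rightarrow> real \<Rightarrow> complex \<Rightarrow> (complex
    \<Rightarrow> complex) \<Rightarrow> complex" where
  "contour_int \<theta> \<rho> s p =
     - ray_int \<theta> \<rho> s p - circle_int \<theta> \<rho> s p + ray_int (\<theta> - 2 * pi)
         \<rho> s p"

definition contour_set :: "real \<Rightarrow> real \<Rightarrow> complex set" where
  "contour_set \<theta> \<rho> = (\<lambda>r. rcis r \<theta>) ` {\<rho>..} \<union> sphere 0
      \<rho>"

text \<open>The factor is r^(-s) and the lower limit is positive, so poles can only come from the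
  behaviour at infinity. With this normalisation a term r^(\<gamma>-1) has its pole at s =
  \<gamma>.\<close>

definition mellin :: "real \<Rightarrow> (real \<Rightarrow> complex) \<Rightarrow> complex
    \<Rightarrow> complex" where
  "mellin \<rho> q s = integral {\<rho>..} (\<lambda>r. exp (- s * of_real (ln r)) * q r)"

lemma cis_diff_2pi: "cis (\<theta> - 2 * pi) = cis \<theta>"
  by (simp add: cis_divide[symmetric])

lemma rcis_diff_2pi: "rcis r (\<theta> - 2 * pi) = rcis r \<theta>"
  by (simp add: rcis_def cis_diff_2pi)

lemma rcis_in_contour_set [simp]: "r \<ge> \<rho> \<Longrightarrow> rcis r \<theta> \<in>
    contour_set \<theta> \<rho>"
  and rcis_circle_in_contour_set [simp]: "\<rho> > 0 \<Longrightarrow> rcis \<rho> \<phi> \<in>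
      contour_set \<theta> \<rho>"
  by (auto simp: contour_set_def)

lemma norm_polar_power: "r > 0 \<Longrightarrow> norm (polar_power r \<phi> w) = r powr Re w * exp
    (- (Im w * \<phi>))"
  by (simp add: polar_power_def powr_def exp_add[symmetric] exp_diff mult.commute exp_minus
      divide_inverse)

lemma polar_power_mult_cis:
  "polar_power r \<phi> (- s) = exp (- \<i> * s * of_real \<phi>) * exp (- s * of_real (ln r))"
  by (simp add: polar_power_def Complex_eq exp_add[symmetric] algebra_simps)

lemma ray_int_mellin:
  "ray_int \<phi> \<rho> s p = exp (- \<i> * s * of_real \<phi>) * mellin \<rho> (\<lambda>r. cis
      \<phi> * p (rcis r \<phi>)) s"
  unfolding ray_int_def mellin_def polar_power_mult_cis integral_mult_right[symmetric]
  by (simp add: mult.assoc)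

text \<open>The two legs run through the same points, and only the phase of the power differs. The
  phases exp(-is(\<theta> - 2\<pi>)) and exp(-is\<theta>) are symmetric about exp(-is(\<theta> -
  \<pi>)), which is where the sine comes from.\<close>

lemma contour_int_mellin:
  "contour_int \<theta> \<rho> s p =
     2 * \<i> * sin (of_real pi * s) * exp (- \<i> * s * of_real (\<theta> - pi)) *
       mellin \<rho> (\<lambda>r. cis \<theta> * p (rcis r \<theta>)) s - circle_int \<theta>
           \<rho> s p"
proof -
  have "exp (- \<i> * s * of_real (\<theta> - 2 * pi)) - exp (- \<i> * s * of_real \<theta>) =
      exp (- \<i> * s * of_real (\<theta> - pi)) * (exp (\<i> * (of_real pi * s)) - exp (- (\<i> *
          (of_real pi * s))))"
    by (simp add: exp_add[symmetric] algebra_simps)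
  also have "\<dots> = exp (- \<i> * s * of_real (\<theta> - pi)) * (2 * \<i> * sin (of_real pi *
      s))"
    by (simp add: sin_exp_eq)
  finally show ?thesis
    unfolding contour_int_def ray_int_mellin cis_diff_2pi rcis_diff_2pi by (simp add: algebra_simps)
qed

lemma continuous_on_rcis [continuous_intros]:
  "continuous_on S f \<Longrightarrow> continuous_on S g \<Longrightarrow> continuous_on S
      (\<lambda>x. rcis (f x) (g x))"
  unfolding rcis_def by (intro continuous_intros) 

lemma continuous_on_polar_power [continuous_intros]:
  "continuous_on S f \<Longrightarrow> continuous_on S g \<Longrightarrow> continuous_on S h
      \<Longrightarrow> (\<And>x. x \<in> S \<Longrightarrow> f x > 0) \<Longrightarrow>
   continuous_on S (\<lambda>x. polar_power (f x) (g x) (h x))"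
  unfolding polar_power_def Complex_eq by (intro continuous_intros) force+

text \<open>The condition on \<phi> covers both legs, \<phi> = \<theta> and \<phi> = \<theta> -
  2\<pi>. Hilbert space values serve \<open>op_power\<close> and its scalar matrix coefficients at
  once.\<close>

lemma ray_integrand:
  fixes p :: "complex \<Rightarrow> 'h::chilbert_space"
  assumes "\<rho> > 0" "continuous_on (contour_set \<theta> \<rho>) p" "\<And>z. z \<in>
      contour_set \<theta> \<rho> \<Longrightarrow> norm (p z) \<le> M"
    and \<phi>: "cis \<phi> = cis \<theta>"
  shows "continuous_on {\<rho>..} (\<lambda>r. (polar_power r \<phi> (- s) * cis \<phi>) *\<^sub>C
      p (rcis r \<phi>))"
    and "r \<ge> \<rho> \<Longrightarrow> norm ((polar_power r \<phi> (- s) * cis \<phi>) *\<^sub>C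
        p (rcis r \<phi>)) \<le> (M * exp (Im s * \<phi>)) * r powr (- Re s)"
    and "Re s > 1 \<Longrightarrow> (\<lambda>r. (polar_power r \<phi> (- s) * cis \<phi>)
        *\<^sub>C p (rcis r \<phi>)) integrable_on {\<rho>..}"
proof -
  have eq: "rcis r \<phi> = rcis r \<theta>" for r using \<phi> by (simp add: rcis_def)
  show c: "continuous_on {\<rho>..} (\<lambda>r. (polar_power r \<phi> (- s) * cis \<phi>)
      *\<^sub>C p (rcis r \<phi>))"
    unfolding eq
    by (intro continuous_intros continuous_on_compose2[OF assms(2)]) (use assms(1) in auto)
  show b: "norm ((polar_power r \<phi> (- s) * cis \<phi>) *\<^sub>C p (rcis r \<phi>)) \<le> (M *
      exp (Im s * \<phi>)) * r powr (- Re s)"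
    if "r \<ge> \<rho>" for r
  proof -
    have "norm (p (rcis r \<phi>)) \<le> M" using assms(3) that by (simp add: eq)
    then have "r powr (- Re s) * exp (Im s * \<phi>) * norm (p (rcis r \<phi>)) \<le> r powr (- Re
        s) * exp (Im s * \<phi>) * M"
      by (intro mult_left_mono) auto
    then show ?thesis
      using that assms(1) by (simp add: norm_scaleC norm_mult norm_polar_power mult_ac)
  qed
  show "(\<lambda>r. (polar_power r \<phi> (- s) * cis \<phi>) *\<^sub>C p (rcis r \<phi>))
      integrable_on {\<rho>..}" if "Re s > 1"
    by (rule improper_integral_powr_bound(1)[OF assms(1) c, of "- Re s"]) (use that b in auto)
qed

lemma circle_integrand:
  fixes p :: "complex \<Rightarrow> 'h::chilbert_space"
  assumes "\<rho> > 0" "continuous_on (contour_set \<theta> \<rho>) p"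
  shows "continuous_on {\<theta> - 2 * pi..\<theta>} (\<lambda>\<phi>. (polar_power \<rho> \<phi>
      (- s) * (\<i> * rcis \<rho> \<phi>)) *\<^sub>C p (rcis \<rho> \<phi>))"
    and "(\<lambda>\<phi>. (polar_power \<rho> \<phi> (- s) * (\<i> * rcis \<rho> \<phi>))
        *\<^sub>C p (rcis \<rho> \<phi>)) integrable_on {\<theta> - 2 * pi..\<theta>}"
proof -
  show c: "continuous_on {\<theta> - 2 * pi..\<theta>} (\<lambda>\<phi>. (polar_power \<rho> \<phi>
      (- s) * (\<i> * rcis \<rho> \<phi>)) *\<^sub>C p (rcis \<rho> \<phi>))"
    by (intro continuous_intros continuous_on_compose2[OF assms(2)]) (use assms(1) in auto)
  show "(\<lambda>\<phi>. (polar_power \<rho> \<phi> (- s) * (\<i> * rcis \<rho> \<phi>)) *\<^sub>C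
      p (rcis \<rho> \<phi>)) integrable_on {\<theta> - 2 * pi..\<theta>}"
    by (intro integrable_continuous_interval c)
qed

text \<open>This makes the lemmas on vector-valued integrands available for scalar ones.\<close>

instantiation complex :: chilbert_space
begin

definition scaleC_complex :: "complex \<Rightarrow> complex \<Rightarrow> complex" where
    "scaleC_complex = (*)"
definition cinner_complex :: "complex \<Rightarrow> complex \<Rightarrow> complex" where
    "cinner_complex x y = x * cnj y"

instance
  by standard (simp_all add: scaleC_complex_def cinner_complex_def algebra_simps scaleR_conv_of_real
      complex_norm_square[symmetric] del: of_real_power)

end

section \<open>Matrix coefficients of complex powers as contour integrals\<close>

lemma op_power_inner:
  fixes A :: "'h::chilbert_space operator"
  assumes \<rho>: "\<rho> > 0" and cont: "continuous_on (contour_set \<theta> \<rho>) (\<lambda>z.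
      resolvent A z x)"
    and bd: "\<And>z. z \<in> contour_set \<theta> \<rho> \<Longrightarrow> norm (resolvent A z x)
        \<le> M" and s: "Re s > 1"
  shows "cinner (op_power \<theta> \<rho> A s x) y =
    \<i> / (2 * of_real pi) * contour_int \<theta> \<rho> s (\<lambda>z. cinner (resolvent A z x)
        y)"
proof -
  have L: "cinner (integral S f) y = integral S (\<lambda>t. cinner (f t) y)" if "f integrable_on S"
    for S :: "real set" and f :: "real \<Rightarrow> 'h"
    using integral_linear[OF that bounded_linear_cinner_left[of y]] by (simp add: o_def)
  show ?thesis
    unfolding op_power_def contour_int_def ray_int_def circle_int_def
    using L[OF ray_integrand(3)[OF \<rho> cont bd cis_diff_2pi s]]
    by (simp add: cinner_scaleC_left cinner_add_left cinner_diff_left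
        L[OF ray_integrand(3)[OF \<rho> cont bd _ s]] L[OF circle_integrand(2)[OF \<rho> cont]])
qed

lemma contour_int_diff:
  assumes \<rho>: "\<rho> > 0" and s: "Re s > 1"
    and p: "continuous_on (contour_set \<theta> \<rho>) p" "\<And>z. z \<in> contour_set \<theta>
        \<rho> \<Longrightarrow> norm (p z) \<le> M"
    and q: "continuous_on (contour_set \<theta> \<rho>) q" "\<And>z. z \<in> contour_set \<theta>
        \<rho> \<Longrightarrow> norm (q z) \<le> M'"
  shows "contour_int \<theta> \<rho> s (\<lambda>z. p z - q z) = contour_int \<theta> \<rho> s p -
      contour_int \<theta> \<rho> s q"
proof -
  have 1: "ray_int \<phi> \<rho> s (\<lambda>z. p z - q z) = ray_int \<phi> \<rho> s p - ray_int
      \<phi> \<rho> s q" if "cis \<phi> = cis \<theta>" for \<phi>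
    unfolding ray_int_def
    using integral_diff[OF ray_integrand(3)[OF \<rho> p that s] ray_integrand(3)[OF \<rho> q that
        s]]
    by (simp add: scaleC_complex_def right_diff_distrib)
  have "circle_int \<theta> \<rho> s (\<lambda>z. p z - q z) = circle_int \<theta> \<rho> s p -
      circle_int \<theta> \<rho> s q"
    unfolding circle_int_def
    using integral_diff[OF circle_integrand(2)[OF \<rho> p(1)] circle_integrand(2)[OF \<rho> q(1)]]
    by (simp add: scaleC_complex_def right_diff_distrib)
  with 1[OF refl] 1[OF cis_diff_2pi] show ?thesis by (simp add: contour_int_def)
qed

lemma has_sum_contour_int:
  assumes \<rho>: "\<rho> > 0" and s: "Re s > 1"
    and p: "\<And>e. e \<in> E \<Longrightarrow> continuous_on (contour_set \<theta> \<rho>) (p e)"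
    and M: "\<And>F z. finite F \<Longrightarrow> F \<subseteq> E \<Longrightarrow> z \<in>
        contour_set \<theta> \<rho> \<Longrightarrow> (\<Sum>e\<in>F. cmod (p e z)) \<le> M"
  shows "((\<lambda>e. contour_int \<theta> \<rho> s (p e)) has_sum contour_int \<theta> \<rho> s
      (\<lambda>z. \<Sum>\<^sub>\<infinity>e\<in>E. p e z)) E"
proof -
  have ray: "((\<lambda>e. ray_int \<phi> \<rho> s (p e)) has_sum ray_int \<phi> \<rho> s
      (\<lambda>z. \<Sum>\<^sub>\<infinity>e\<in>E. p e z)) E"
    if \<phi>: "cis \<phi> = cis \<theta>" for \<phi>
  proof -
    have "((\<lambda>e. integral {\<rho>..} (\<lambda>r. polar_power r \<phi> (- s) * cis \<phi> *
        p e (rcis r \<phi>))) has_sum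
        integral {\<rho>..} (\<lambda>r. \<Sum>\<^sub>\<infinity>e\<in>E. polar_power r \<phi> (-
            s) * cis \<phi> * p e (rcis r \<phi>))) E"
    proof (rule has_sum_integral[where M = "\<lambda>r. M * exp (Im s * \<phi>) * r powr (- Re s)"])
      show "continuous_on {\<rho>..} (\<lambda>r. polar_power r \<phi> (- s) * cis \<phi> * p e
          (rcis r \<phi>))" if "e \<in> E" for e
      proof -
        have "norm (p e z) \<le> M" if "z \<in> contour_set \<theta> \<rho>" for z
          using M[of "{e}" z] \<open>e \<in> E\<close> that by simp
        from ray_integrand(1)[OF \<rho> p[OF that] this \<phi>] show ?thesis
          by (simp add: scaleC_complex_def)
      qed
      show "(\<lambda>r. M * exp (Im s * \<phi>) * r powr (- Re s)) integrable_on {\<rho>..}"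
        using has_integral_powr_to_inf[of "- Re s" \<rho>] \<rho> s
        by (intro integrable_on_mult_right) (auto simp: integrable_on_def)
      fix F r assume F: "finite F" "F \<subseteq> E" "r \<in> {\<rho>..}"
      have "rcis r \<phi> = rcis r \<theta>" using \<phi> by (simp add: rcis_def)
      then have "(\<Sum>e\<in>F. cmod (p e (rcis r \<phi>))) \<le> M" using M F by simp
      then have "r powr (- Re s) * exp (Im s * \<phi>) * (\<Sum>e\<in>F. cmod (p e (rcis r
          \<phi>))) \<le> r powr (- Re s) * exp (Im s * \<phi>) * M"
        by (intro mult_left_mono) auto
      then show "(\<Sum>e\<in>F. cmod (polar_power r \<phi> (- s) * cis \<phi> * p e (rcis r
          \<phi>))) \<le> M * exp (Im s * \<phi>) * r powr (- Re s)"
        using F \<rho> by (simp add: norm_mult norm_polar_power sum_distrib_left mult_ac)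
    qed auto
    then show ?thesis by (simp add: ray_int_def infsum_cmult_right')
  qed
  have circ: "((\<lambda>e. circle_int \<theta> \<rho> s (p e)) has_sum circle_int \<theta> \<rho>
      s (\<lambda>z. \<Sum>\<^sub>\<infinity>e\<in>E. p e z)) E"
  proof -
    define g where "g \<phi> = cmod (polar_power \<rho> \<phi> (- s) * (\<i> * rcis \<rho>
        \<phi>))" for \<phi>
    have "((\<lambda>e. integral {\<theta> - 2 * pi..\<theta>} (\<lambda>\<phi>. polar_power \<rho>
        \<phi> (- s) * (\<i> * rcis \<rho> \<phi>) * p e (rcis \<rho> \<phi>))) has_sum
        integral {\<theta> - 2 * pi..\<theta>} (\<lambda>\<phi>. \<Sum>\<^sub>\<infinity>e\<in>E.
            polar_power \<rho> \<phi> (- s) * (\<i> * rcis \<rho> \<phi>) * p e (rcis \<rho>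
            \<phi>))) E"
    proof (rule has_sum_integral[where M = "\<lambda>\<phi>. g \<phi> * M"])
      show "continuous_on {\<theta> - 2 * pi..\<theta>} (\<lambda>\<phi>. polar_power \<rho> \<phi>
          (- s) * (\<i> * rcis \<rho> \<phi>) * p e (rcis \<rho> \<phi>))"
        if "e \<in> E" for e
        using circle_integrand(1)[OF \<rho> p[OF that]] by (simp add: scaleC_complex_def)
      show "(\<lambda>\<phi>. g \<phi> * M) integrable_on {\<theta> - 2 * pi..\<theta>}"
        unfolding g_def by (intro integrable_continuous_interval continuous_intros) (use \<rho> in
            auto)
      fix F \<phi> assume F: "finite F" "F \<subseteq> E"
      then have "g \<phi> * (\<Sum>e\<in>F. cmod (p e (rcis \<rho> \<phi>))) \<le> g \<phi> * M"
        using M[OF F, of "rcis \<rho> \<phi>"] \<rho> by (intro mult_left_mono) (auto simp: g_def)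
      then show "(\<Sum>e\<in>F. cmod (polar_power \<rho> \<phi> (- s) * (\<i> * rcis \<rho>
          \<phi>) * p e (rcis \<rho> \<phi>))) \<le> g \<phi> * M"
        by (simp add: g_def norm_mult[of _ "p _ _"] sum_distrib_left)
    qed auto
    then show ?thesis by (simp add: circle_int_def infsum_cmult_right')
  qed
  show ?thesis
    unfolding contour_int_def diff_conv_add_uminus
    by (intro has_sum_add) (auto intro!: ray circ cis_diff_2pi simp: has_sum_uminus)
qed

lemma contour_int_cong:
  assumes "\<rho> > 0" "\<And>z. z \<in> contour_set \<theta> \<rho> \<Longrightarrow> p z = q z"
  shows "contour_int \<theta> \<rho> s p = contour_int \<theta> \<rho> s q"
proof -
  have *: "rcis r \<phi> \<in> contour_set \<theta> \<rho>" if "r \<ge> \<rho>" "cis \<phi> = cis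
      \<theta>" for r \<phi>
    using rcis_in_contour_set[OF that(1), of \<theta>] that(2) by (simp add: rcis_def)
  show ?thesis
    unfolding contour_int_def ray_int_def circle_int_def
    by (intro arg_cong2[where f = "(+)"] arg_cong2[where f = "(-)"] arg_cong[where f = uminus]
        integral_cong)
       (use assms * cis_diff_2pi in auto)
qed

section \<open>Integration by parts along the contour\<close>

lemma tendsto_integral_FTC:
  fixes g G :: "real \<Rightarrow> 'a::banach"
  assumes deriv: "\<And>r. r \<ge> a \<Longrightarrow> (G has_vector_derivative g r) (at r)" and
      lim: "(G \<longlongrightarrow> 0) at_top"
    and I: "((\<lambda>b. integral {a..b} g) \<longlongrightarrow> I) at_top"
  shows "I = - G a"
proof -
  have "eventually (\<lambda>b. integral {a..b} g = G b - G a) at_top"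
    using eventually_ge_at_top[of a]
  proof eventually_elim
    case (elim b)
    then show ?case
      by (intro integral_unique fundamental_theorem_of_calculus has_vector_derivative_at_within[OF
          deriv]) auto
  qed
  moreover have "((\<lambda>b. G b - G a) \<longlongrightarrow> 0 - G a) at_top"
    by (intro tendsto_intros lim)
  ultimately have "((\<lambda>b. integral {a..b} g) \<longlongrightarrow> - G a) at_top"
    using tendsto_cong by fastforce
  then show ?thesis
    using I tendsto_unique trivial_limit_at_top_linorder by blast
qed

lemma polar_power_Suc:
  "r > 0 \<Longrightarrow> polar_power r \<phi> (1 - s) = polar_power r \<phi> (- s) * rcis r
      \<phi>"
  by (simp add: polar_power_def Complex_eq rcis_def cis_conv_exp exp_add[symmetric]
      exp_of_real[symmetric] algebra_simps)
     (simp add: exp_add exp_diff exp_minus exp_of_real divide_inverse algebra_simps)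

lemma has_vector_derivative_polar_power_ray:
  assumes "r > 0"
  shows "((\<lambda>r. polar_power r \<phi> w) has_vector_derivative (w / of_real r * polar_power r
      \<phi> w)) (at r)"
proof -
  have "((\<lambda>r. w * (of_real (ln r) + \<i> * of_real \<phi>)) has_vector_derivative w *
      (of_real (1 / r))) (at r)"
    using assms by (auto intro!: derivative_eq_intros has_vector_derivative_mult_right
        has_vector_derivative_add_const[THEN iffD2]
        has_vector_derivative_of_real simp:
            has_real_derivative_iff_has_vector_derivative[symmetric])
  from field_vector_diff_chain_at[OF this DERIV_exp]
  show ?thesis by (simp add: polar_power_def[abs_def] Complex_eq o_def algebra_simps)
qed

lemma has_vector_derivative_polar_power_circle:
  "((\<lambda>\<phi>. polar_power r \<phi> w) has_vector_derivative (\<i> * w * polar_power r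
      \<phi> w)) (at \<phi>)"
proof -
  have "((\<lambda>\<phi>. w * (of_real (ln r) + \<i> * of_real \<phi>)) has_vector_derivative w *
      (\<i> * of_real 1)) (at \<phi>)"
    by (auto intro!: derivative_eq_intros)
  from field_vector_diff_chain_at[OF this DERIV_exp]
  show ?thesis by (simp add: polar_power_def[abs_def] Complex_eq o_def algebra_simps)
qed

lemma has_vector_derivative_rcis_ray: "((\<lambda>r. rcis r \<phi>) has_vector_derivative cis
    \<phi>) (at r)"
  unfolding rcis_def by (auto intro!: derivative_eq_intros)

lemma has_vector_derivative_rcis_circle: "((\<lambda>\<phi>. rcis r \<phi>) has_vector_derivative
    \<i> * rcis r \<phi>) (at \<phi>)"
proof -
  have "((\<lambda>\<phi>. \<i> * of_real \<phi>) has_vector_derivative \<i> * of_real 1) (at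
      \<phi>)"
    by (auto intro!: derivative_eq_intros)
  from field_vector_diff_chain_at[OF this DERIV_exp]
  have "((\<lambda>\<phi>. exp (\<i> * of_real \<phi>)) has_vector_derivative \<i> * exp (\<i> *
      of_real \<phi>)) (at \<phi>)"
    by (simp add: o_def)
  then have "((\<lambda>\<phi>. of_real r * exp (\<i> * of_real \<phi>)) has_vector_derivative
      of_real r * (\<i> * exp (\<i> * of_real \<phi>))) (at \<phi>)"
    by (rule has_vector_derivative_mult_right)
  then show ?thesis by (simp add: rcis_def cis_conv_exp mult_ac)
qed

text \<open>The product \<lambda>^(1-s) p is single valued along the contour, so the boundary terms
  of the two legs at radius \<rho> are cancelled by those of the circle, while those at infinity
  vanish. The bound 2 on Re s gives absolute convergence for s - 1 as well.\<close>

lemma contour_int_by_parts: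
  assumes \<rho>: "\<rho> > 0" and U: "open U" "contour_set \<theta> \<rho> \<subseteq> U" and hol:
      "p holomorphic_on U"
    and M: "\<And>z. z \<in> contour_set \<theta> \<rho> \<Longrightarrow> norm (p z) \<le> M"
    and M': "\<And>z. z \<in> contour_set \<theta> \<rho> \<Longrightarrow> norm (deriv p z) \<le>
        M'"
    and s: "Re s > 2"
  shows "contour_int \<theta> \<rho> (s - 1) (deriv p) = (s - 1) * contour_int \<theta> \<rho> s p"
proof -
  have cont: "continuous_on (contour_set \<theta> \<rho>) p" "continuous_on (contour_set \<theta>
      \<rho>) (deriv p)"
    using holomorphic_on_imp_continuous_on continuous_on_subset[OF _ U(2)] hol
      holomorphic_deriv[OF hol U(1)] by blast+
  have dp: "(p has_field_derivative deriv p z) (at z)" if "z \<in> contour_set \<theta> \<rho>" for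
      z
    using holomorphic_derivI[OF hol U(1)] that U(2) by blast
  \<comment> \<open>The boundary term at radius \<rho>; legs and circle meet at the arguments
    \<theta> and \<theta> - 2\<pi>, where its values differ.\<close>
  define B where "B \<phi> = polar_power \<rho> \<phi> (1 - s) * p (rcis \<rho> \<phi>)" for \<phi>
  have ray: "(1 - s) * ray_int \<phi> \<rho> s p + ray_int \<phi> \<rho> (s - 1) (deriv p) = - B
      \<phi>"
    if \<phi>: "cis \<phi> = cis \<theta>" for \<phi>
  proof -
    have eq: "rcis r \<phi> = rcis r \<theta>" for r using \<phi> by (simp add: rcis_def)
    define f1 where "f1 r = polar_power r \<phi> (- s) * cis \<phi> * p (rcis r \<phi>)" for r
    define f2 where "f2 r = polar_power r \<phi> (1 - s) * cis \<phi> * deriv p (rcis r \<phi>)"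
        for r
    note i1 = ray_integrand[OF \<rho> cont(1) M \<phi>, where s = s, unfolded scaleC_complex_def,
        folded f1_def]
    note i2 = ray_integrand[OF \<rho> cont(2) M' \<phi>, where s = "s - 1", unfolded
        scaleC_complex_def]
    have eq2: "(\<lambda>r. polar_power r \<phi> (- (s - 1)) * cis \<phi> * deriv p (rcis r
        \<phi>)) = f2"
      by (simp add: f2_def fun_eq_iff)
    have lim1: "((\<lambda>b. integral {\<rho>..b} f1) \<longlongrightarrow> ray_int \<phi> \<rho>
        s p) at_top"
      using improper_integral_powr_bound(3)[OF \<rho> i1(1) _ i1(2)] s
      by (simp add: ray_int_def f1_def[abs_def])
    have c2: "continuous_on {\<rho>..} f2" using i2(1) by (simp only: eq2)
    have lim2: "((\<lambda>b. integral {\<rho>..b} f2) \<longlongrightarrow> ray_int \<phi> \<rho>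
        (s - 1) (deriv p)) at_top"
      using improper_integral_powr_bound(3)[OF \<rho> i2(1) _ i2(2)] s
      by (simp add: ray_int_def f2_def[abs_def])
    have "(1 - s) * ray_int \<phi> \<rho> s p + ray_int \<phi> \<rho> (s - 1) (deriv p) =
        - (\<lambda>r. polar_power r \<phi> (1 - s) * p (rcis r \<phi>)) \<rho>"
    proof (rule tendsto_integral_FTC[where g = "\<lambda>r. (1 - s) * f1 r + f2 r"
          and G = "\<lambda>r. polar_power r \<phi> (1 - s) * p (rcis r \<phi>)"])
      fix r assume r: "r \<ge> \<rho>"
      then have "r > 0" using \<rho> by simp
      have "((\<lambda>r. p (rcis r \<phi>)) has_vector_derivative cis \<phi> * deriv p (rcis r
          \<phi>)) (at r)"
        using field_vector_diff_chain_at[OF has_vector_derivative_rcis_ray dp, of r \<phi>] r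
        by (simp add: o_def eq)
      from has_vector_derivative_mult[OF has_vector_derivative_polar_power_ray[OF \<open>r >
          0\<close>] this]
      show "((\<lambda>r. polar_power r \<phi> (1 - s) * p (rcis r \<phi>)) has_vector_derivative
          (1 - s) * f1 r + f2 r) (at r)"
        by (rule has_vector_derivative_eq_rhs)
           (use \<open>r > 0\<close> in \<open>simp add: f1_def f2_def polar_power_Suc rcis_def
               field_simps\<close>)
    next
      have "((\<lambda>r. r powr (1 - Re s) * exp (Im s * \<phi>) * M) \<longlongrightarrow> 0)
          at_top"
        using s by (intro tendsto_mult_left_zero tendsto_neg_powr) (auto intro: filterlim_ident)
      moreover have "eventually (\<lambda>r. norm (polar_power r \<phi> (1 - s) * p (rcis r
          \<phi>)) \<le> r powr (1 - Re s) * exp (Im s * \<phi>) * M) at_top"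
        using eventually_ge_at_top[of \<rho>]
      proof eventually_elim
        case (elim r)
        then have "norm (p (rcis r \<phi>)) \<le> M" using M by (simp add: eq)
        then have "r powr (1 - Re s) * exp (Im s * \<phi>) * norm (p (rcis r \<phi>)) \<le> r powr
            (1 - Re s) * exp (Im s * \<phi>) * M"
          by (intro mult_left_mono) auto
        then show ?case using elim \<rho> by (simp add: norm_mult norm_polar_power)
      qed
      ultimately show "((\<lambda>r. polar_power r \<phi> (1 - s) * p (rcis r \<phi>))
          \<longlongrightarrow> 0) at_top"
        by (rule Lim_null_comparison[rotated])
    next
      have "eventually (\<lambda>b. (1 - s) * integral {\<rho>..b} f1 + integral {\<rho>..b} f2 =
          integral {\<rho>..b} (\<lambda>r. (1 - s) * f1 r + f2 r)) at_top"
      proof (rule always_eventually, rule allI)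
        fix b
        have "{\<rho>..b} \<subseteq> {\<rho>..}" by auto
        then have "f1 integrable_on {\<rho>..b}" "f2 integrable_on {\<rho>..b}"
          using continuous_on_subset[OF i1(1)] continuous_on_subset[OF c2]
          by (auto intro: integrable_continuous_interval)
        then show "(1 - s) * integral {\<rho>..b} f1 + integral {\<rho>..b} f2 = integral
            {\<rho>..b} (\<lambda>r. (1 - s) * f1 r + f2 r)"
          by (subst integral_add) (auto intro: integrable_on_mult_right)
      qed
      moreover have "((\<lambda>b. (1 - s) * integral {\<rho>..b} f1 + integral {\<rho>..b} f2)
          \<longlongrightarrow>
          (1 - s) * ray_int \<phi> \<rho> s p + ray_int \<phi> \<rho> (s - 1) (deriv p)) at_top"
        by (intro tendsto_intros lim1 lim2)
      ultimately show "((\<lambda>b. integral {\<rho>..b} (\<lambda>r. (1 - s) * f1 r + f2 r))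
          \<longlongrightarrow>
          (1 - s) * ray_int \<phi> \<rho> s p + ray_int \<phi> \<rho> (s - 1) (deriv p)) at_top"
        using tendsto_cong by fastforce
    qed
    then show ?thesis by (simp add: B_def)
  qed
  have circ: "(1 - s) * circle_int \<theta> \<rho> s p + circle_int \<theta> \<rho> (s - 1) (deriv
      p) = B \<theta> - B (\<theta> - 2 * pi)"
  proof -
    define f1 where "f1 \<phi> = polar_power \<rho> \<phi> (- s) * (\<i> * rcis \<rho> \<phi>) * p
        (rcis \<rho> \<phi>)" for \<phi>
    define f2 where "f2 \<phi> = polar_power \<rho> \<phi> (1 - s) * (\<i> * rcis \<rho> \<phi>) *
        deriv p (rcis \<rho> \<phi>)" for \<phi>
    have i1: "f1 integrable_on {\<theta> - 2 * pi..\<theta>}"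
      using circle_integrand(2)[OF \<rho> cont(1), where s = s] by (simp add: f1_def[abs_def]
          scaleC_complex_def)
    have i2: "f2 integrable_on {\<theta> - 2 * pi..\<theta>}"
      using circle_integrand(2)[OF \<rho> cont(2), where s = "s - 1"] by (simp add: f2_def[abs_def]
          scaleC_complex_def)
    have "((\<lambda>\<phi>. (1 - s) * f1 \<phi> + f2 \<phi>) has_integral (B \<theta> - B
        (\<theta> - 2 * pi))) {\<theta> - 2 * pi..\<theta>}"
    proof (rule fundamental_theorem_of_calculus)
      fix \<phi>
      have "((\<lambda>\<phi>. p (rcis \<rho> \<phi>)) has_vector_derivative (\<i> * rcis \<rho>
          \<phi>) * deriv p (rcis \<rho> \<phi>)) (at \<phi>)"
        using field_vector_diff_chain_at[OF has_vector_derivative_rcis_circle dp, of \<rho> \<phi>]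
            \<rho>
        by (simp add: o_def)
      from has_vector_derivative_mult[OF has_vector_derivative_polar_power_circle this]
      have "(B has_vector_derivative (1 - s) * f1 \<phi> + f2 \<phi>) (at \<phi>)"
        unfolding B_def[abs_def]
        by (rule has_vector_derivative_eq_rhs)
           (use \<rho> in \<open>simp add: f1_def f2_def polar_power_Suc algebra_simps\<close>)
      then show "(B has_vector_derivative (1 - s) * f1 \<phi> + f2 \<phi>) (at \<phi> within
          {\<theta> - 2 * pi..\<theta>})"
        by (rule has_vector_derivative_at_within)
    qed auto
    then have "integral {\<theta> - 2 * pi..\<theta>} (\<lambda>\<phi>. (1 - s) * f1 \<phi> + f2
        \<phi>) = B \<theta> - B (\<theta> - 2 * pi)"
      by (rule integral_unique)
    moreover have "integral {\<theta> - 2 * pi..\<theta>} (\<lambda>\<phi>. (1 - s) * f1 \<phi> +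
        f2 \<phi>) =
        (1 - s) * integral {\<theta> - 2 * pi..\<theta>} f1 + integral {\<theta> - 2 *
            pi..\<theta>} f2"
      using i1 i2 by (subst integral_add) (auto intro: integrable_on_mult_right)
    ultimately show ?thesis
      by (simp add: circle_int_def f1_def[abs_def] f2_def[abs_def])
  qed
  have "contour_int \<theta> \<rho> (s - 1) (deriv p) - (s - 1) * contour_int \<theta> \<rho> s p =
      - ((1 - s) * ray_int \<theta> \<rho> s p + ray_int \<theta> \<rho> (s - 1) (deriv p))
      - ((1 - s) * circle_int \<theta> \<rho> s p + circle_int \<theta> \<rho> (s - 1) (deriv p))
      + ((1 - s) * ray_int (\<theta> - 2 * pi) \<rho> s p + ray_int (\<theta> - 2 * pi) \<rho> (s -
          1) (deriv p))"
    by (simp add: contour_int_def algebra_simps)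
  also have "\<dots> = 0"
    unfolding ray[OF refl] ray[OF cis_diff_2pi] circ by simp
  finally show ?thesis by simp
qed

section \<open>Mellin transforms: holomorphy and explicit poles\<close>

lemma mellin_integrand:
  assumes \<rho>: "\<rho> > 0" and q: "continuous_on {\<rho>..} q" "\<And>r. r \<ge> \<rho>
      \<Longrightarrow> norm (q r) \<le> C * r powr (a - 1)"
  shows "continuous_on {\<rho>..} (\<lambda>r. exp (- s * of_real (ln r)) * q r)"
    and "r \<ge> \<rho> \<Longrightarrow> norm (exp (- s * of_real (ln r)) * q r) \<le> C * r powr
        (a - 1 - Re s)"
proof -
  show "continuous_on {\<rho>..} (\<lambda>r. exp (- s * of_real (ln r)) * q r)"
    by (intro continuous_intros q) (use \<rho> in auto)
  show "norm (exp (- s * of_real (ln r)) * q r) \<le> C * r powr (a - 1 - Re s)" if "r \<ge> \<rho>"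
  proof -
    have "norm (exp (- s * of_real (ln r))) = r powr (- Re s)"
      using that \<rho> by (simp add: powr_def)
    then have "norm (exp (- s * of_real (ln r)) * q r) \<le> r powr (- Re s) * (C * r powr (a - 1))"
      unfolding norm_mult using q(2)[OF that] by (simp add: mult_left_mono)
    also have "\<dots> = C * r powr (a - 1 - Re s)"
      using powr_add[of r "- Re s" "a - 1"] by (simp add: add.commute mult.left_commute)
    finally show ?thesis .
  qed
qed

lemma mellin_integrable:
  assumes "\<rho> > 0" "continuous_on {\<rho>..} q" "\<And>r. r \<ge> \<rho> \<Longrightarrow> norm
      (q r) \<le> C * r powr (a - 1)" "Re s > a"
  shows "(\<lambda>r. exp (- s * of_real (ln r)) * q r) integrable_on {\<rho>..}"
  by (rule improper_integral_powr_bound(1)[OF assms(1) mellin_integrand(1)[OF assms(1-3)] _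
        mellin_integrand(2)[OF assms(1-3)]]) (use assms(4) in auto)

text \<open>Truncated transforms are holomorphic by differentiation under the integral, and on small
  closed discs the tails tend to 0 uniformly.\<close>

lemma mellin_holomorphic:
  assumes \<rho>: "\<rho> > 0" and q: "continuous_on {\<rho>..} q" "\<And>r. r \<ge> \<rho>
      \<Longrightarrow> norm (q r) \<le> C * r powr (a - 1)"
  shows "mellin \<rho> q holomorphic_on {s. Re s > a}"
proof (rule holomorphic_uniform_sequence)
  define f where "f n s = integral (cbox \<rho> (\<rho> + real n)) (\<lambda>r. exp (- s * of_real
      (ln r)) * q r)" for n :: nat and s
  show "open {s. a < Re s}" by (rule open_halfspace_Re_gt)
  show "f n holomorphic_on {s. a < Re s}" for n
    unfolding f_def
  proof (rule leibniz_rule_holomorphic)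
    show "((\<lambda>s. exp (- s * of_real (ln t)) * q t) has_field_derivative - of_real (ln t) *
        exp (- s * of_real (ln t)) * q t)
        (at s within {s. a < Re s})" for s t
      by (auto intro!: derivative_eq_intros)
    show "(\<lambda>r. exp (- s * of_real (ln r)) * q r) integrable_on cbox \<rho> (\<rho> + real
        n)" for s
      unfolding box_real
      by (intro integrable_continuous_interval continuous_on_subset[OF mellin_integrand(1)[OF
          \<rho> q]]) auto
    show "continuous_on ({s. a < Re s} \<times> cbox \<rho> (\<rho> + real n))
        (\<lambda>(s, t). - of_real (ln t) * exp (- s * of_real (ln t)) * q t)"
      unfolding split_beta
      by (intro continuous_intros continuous_on_compose2[OF q(1)]) (use \<rho> in auto)
    show "convex {s. a < Re s}" by (rule convex_halfspace_Re_gt)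
  qed
  fix x assume x: "x \<in> {s. a < Re s}"
  \<comment> \<open>Half the distance from x to the line Re s = a: on the disc of this radius Re s
    >= a + d, so the tail beyond \<rho> + n is of order (\<rho> + n)^(-d).\<close>
  define d where "d = (Re x - a) / 2"
  have d: "d > 0" using x by (simp add: d_def)
  have Re: "Re s \<ge> a + d" if "s \<in> cball x d" for s
  proof -
    have "\<bar>Re (x - s)\<bar> \<le> d" using abs_Re_le_cmod[of "x - s"] that by (simp add:
        dist_norm)
    then show ?thesis unfolding d_def by (simp add: field_simps abs_if split: if_splits)
  qed
  have "uniform_limit (cball x d) f (mellin \<rho> q) sequentially"
  proof (rule uniform_limitI)
    fix e :: real assume "e > 0"
    have "((\<lambda>n. \<bar>C\<bar> * ((\<rho> + real n) powr (- d) / d))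
        \<longlonglongrightarrow> 0)"
      using d by real_asymp
    then have "eventually (\<lambda>n. \<bar>C\<bar> * ((\<rho> + real n) powr (- d) / d) < e)
        sequentially"
      using \<open>e > 0\<close> by (rule order_tendstoD)
    then show "\<forall>\<^sub>F n in sequentially. \<forall>s\<in>cball x d. dist (f n s) (mellin
        \<rho> q s) < e"
      using eventually_ge_at_top[of 1]
    proof eventually_elim
      case (elim n)
      show ?case
      proof
        fix s assume s: "s \<in> cball x d"
        have "norm (mellin \<rho> q s - f n s) \<le> C * ((\<rho> + n) powr (a - 1 - Re s + 1) / (-
            (a - 1 - Re s + 1)))"
          unfolding mellin_def f_def box_real
          by (rule improper_integral_powr_bound(2)[OF \<rho> mellin_integrand(1)[OF \<rho> q] _
              mellin_integrand(2)[OF \<rho> q]])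
             (use Re[OF s] d in auto)
        also have "\<dots> \<le> \<bar>C\<bar> * ((\<rho> + n) powr (a - 1 - Re s + 1) / (- (a - 1
            - Re s + 1)))"
          using Re[OF s] d by (intro mult_right_mono) auto
        also have "\<dots> \<le> \<bar>C\<bar> * ((\<rho> + n) powr (- d) / d)"
          using Re[OF s] d \<rho> elim by (intro mult_left_mono frac_le powr_mono) auto
        also have "\<dots> < e" by (rule elim)
        finally show "dist (f n s) (mellin \<rho> q s) < e"
          by (simp add: dist_norm norm_minus_commute)
      qed
    qed
  qed
  moreover have "cball x d \<subseteq> {s. a < Re s}" using Re d by fastforce
  ultimately show "\<exists>d>0. cball x d \<subseteq> {s. a < Re s} \<and> uniform_limit (cball x
      d) f (mellin \<rho> q) sequentially"
    using d by blast
qed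

lemma ln_powr_bounded:
  assumes "\<rho> > 0" "\<eta> > 0"
  obtains C where "C \<ge> 0" "\<And>r. r \<ge> \<rho> \<Longrightarrow> norm (A + B *
      complex_of_real (ln r)) \<le> C * r powr \<eta>"
proof (rule bounded_on_halfline)
  show "continuous_on {\<rho>..} (\<lambda>r. A + B * complex_of_real (ln r))" "continuous_on
      {\<rho>..} (\<lambda>r. r powr \<eta>)"
    using assms by (auto intro!: continuous_intros)
  show "r powr \<eta> > 0" if "r \<ge> \<rho>" for r using that assms by simp
  have "eventually (\<lambda>r. cmod A + cmod B * ln r \<le> 1 * r powr \<eta>) at_top"
    using assms(2) by real_asymp
  then show "eventually (\<lambda>r. norm (A + B * complex_of_real (ln r)) \<le> 1 * r powr \<eta>)
      at_top"
    using eventually_ge_at_top[of 1]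
  proof eventually_elim
    case (elim r)
    have "norm (A + B * complex_of_real (ln r)) \<le> cmod A + cmod B * ln r"
      using norm_triangle_ineq[of A "B * complex_of_real (ln r)"] elim by (simp add: norm_mult)
    with elim show ?case by simp
  qed
qed (use that in blast)

text \<open>In the variable x = ln r this is the integral of exp(kx)(A + Bx) with k = \<gamma> - s,
  which has an elementary primitive. The logarithm is the source of the double pole.\<close>

lemma mellin_power_log:
  assumes \<rho>: "\<rho> > 0" and s: "Re s > \<gamma>"
  shows "(\<lambda>r. exp (- s * of_real (ln r)) * ((A + B * of_real (ln r)) * of_real (r powr
      (\<gamma> - 1)))) integrable_on {\<rho>..}"
    and "mellin \<rho> (\<lambda>r. (A + B * of_real (ln r)) * of_real (r powr (\<gamma> - 1))) s =
      exp ((of_real \<gamma> - s) * of_real (ln \<rho>)) *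
        ((A + B * of_real (ln \<rho>)) / (s - of_real \<gamma>) + B / (s - of_real
            \<gamma>)\<^sup>2)"
proof -
  define q where "q r = (A + B * complex_of_real (ln r)) * of_real (r powr (\<gamma> - 1))" for r
  \<comment> \<open>A logarithm costs an arbitrarily small power of r; half of the available gap
    pays for it and leaves room for convergence.\<close>
  define \<eta> where "\<eta> = (Re s - \<gamma>) / 2"
  have \<eta>: "\<eta> > 0" "\<gamma> + \<eta> < Re s" using s by (simp_all add: \<eta>_def
      field_simps)
  have q: "continuous_on {\<rho>..} q"
    unfolding q_def using \<rho> by (auto intro!: continuous_intros)
  obtain C where C: "\<And>r. r \<ge> \<rho> \<Longrightarrow> norm (A + B * complex_of_real (ln
      r)) \<le> C * r powr \<eta>"
    using ln_powr_bounded[OF \<rho> \<eta>(1)] by metis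
  have qb: "norm (q r) \<le> C * r powr ((\<gamma> + \<eta>) - 1)" if "r \<ge> \<rho>" for r
  proof -
    have "norm (q r) \<le> (C * r powr \<eta>) * r powr (\<gamma> - 1)"
      unfolding q_def norm_mult using C[OF that] by (simp add: mult_right_mono)
    also have "\<dots> = C * r powr ((\<gamma> + \<eta>) - 1)"
      using powr_add[of r \<eta> "\<gamma> - 1"] by (simp add: algebra_simps)
    finally show ?thesis .
  qed
  show "(\<lambda>r. exp (- s * of_real (ln r)) * ((A + B * of_real (ln r)) * of_real (r powr
      (\<gamma> - 1)))) integrable_on {\<rho>..}"
    using mellin_integrable[OF \<rho> q qb \<eta>(2)] by (simp add: q_def)
  have lim: "((\<lambda>b. integral {\<rho>..b} (\<lambda>r. exp (- s * of_real (ln r)) * q r))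
      \<longlongrightarrow> mellin \<rho> q s) at_top"
    unfolding mellin_def
    by (rule improper_integral_powr_bound(3)[OF \<rho> mellin_integrand(1)[OF \<rho> q qb] _
        mellin_integrand(2)[OF \<rho> q qb]])
       (use \<eta> in auto)
  define k where "k = of_real \<gamma> - s"
  have k: "k \<noteq> 0" "Re k < 0" using s by (auto simp: k_def)
  define G where "G r = exp (k * of_real (ln r)) * ((A + B * of_real (ln r)) / k - B / k\<^sup>2)"
      for r
  have "mellin \<rho> q s = - G \<rho>"
  proof (rule tendsto_integral_FTC[OF _ _ lim])
    fix r assume "r \<ge> \<rho>"
    then have r: "r > 0" using \<rho> by simp
    have ln: "((\<lambda>r. complex_of_real (ln r)) has_vector_derivative of_real (1 / r)) (at r)"
      using r by (auto intro!: derivative_eq_intros has_vector_derivative_of_real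
          simp: has_real_derivative_iff_has_vector_derivative[symmetric])
    have "((\<lambda>x. exp (k * x) * ((A + B * x) / k - B / k\<^sup>2)) has_field_derivative
        exp (k * x) * (A + B * x)) (at x)" for x
      by (rule derivative_eq_intros refl | use k in \<open>simp add: field_simps
          power2_eq_square\<close>)+
    from field_vector_diff_chain_at[OF ln this]
    have "(G has_vector_derivative of_real (1 / r) * (exp (k * of_real (ln r)) * (A + B * of_real
        (ln r)))) (at r)"
      by (simp add: G_def[abs_def] o_def)
    moreover have "exp (k * of_real (ln r)) = exp (- s * of_real (ln r)) * of_real (r powr
        (\<gamma> - 1)) * of_real r"
    proof -
      have "complex_of_real (r powr (\<gamma> - 1)) * of_real r = of_real (r powr (\<gamma> - 1 +
          1))"
        using r by (subst powr_add) simp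
      also have "\<dots> = exp (of_real \<gamma> * of_real (ln r))"
        using r by (simp add: powr_def exp_of_real[symmetric])
      finally show ?thesis by (simp add: k_def left_diff_distrib exp_diff exp_minus field_simps)
    qed
    ultimately show "(G has_vector_derivative exp (- s * of_real (ln r)) * q r) (at r)"
      using r by (simp add: q_def mult_ac)
  next
    have n: "cmod (exp (k * of_real (ln r))) = exp (Re k * ln r)" for r by simp
    have "((\<lambda>r. exp (Re k * ln r) * (((cmod A + cmod B * ln r) / cmod k + cmod B / (cmod
        k)\<^sup>2))) \<longlongrightarrow> 0) at_top"
      using k by real_asymp
    moreover have "eventually (\<lambda>r. norm (G r) \<le> exp (Re k * ln r) * (((cmod A + cmod B
        * ln r) / cmod k + cmod B / (cmod k)\<^sup>2))) at_top"
      using eventually_ge_at_top[of 1]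
    proof eventually_elim
      case (elim r)
      have "norm ((A + B * of_real (ln r)) / k - B / k\<^sup>2) \<le> norm ((A + B * of_real (ln
          r)) / k) + norm (B / k\<^sup>2)"
        by (rule norm_triangle_ineq4)
      also have "\<dots> \<le> (cmod A + cmod B * ln r) / cmod k + cmod B / (cmod k)\<^sup>2"
        using norm_triangle_ineq[of A "B * complex_of_real (ln r)"] elim
        by (intro add_mono) (simp_all add: norm_divide norm_mult norm_power divide_right_mono)
      finally show ?case unfolding G_def norm_mult n by (intro mult_left_mono) auto
    qed
    ultimately show "(G \<longlongrightarrow> 0) at_top"
      by (rule Lim_null_comparison[rotated])
  qed
  also have "- G \<rho> = exp (k * of_real (ln \<rho>)) * ((A + B * of_real (ln \<rho>)) / (- k) +
      B / (- k)\<^sup>2)"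
    by (simp add: G_def algebra_simps)
  also have "- k = s - of_real \<gamma>" by (simp add: k_def)
  finally show "mellin \<rho> (\<lambda>r. (A + B * of_real (ln r)) * of_real (r powr (\<gamma> -
      1))) s =
      exp ((of_real \<gamma> - s) * of_real (ln \<rho>)) *
        ((A + B * of_real (ln \<rho>)) / (s - of_real \<gamma>) + B / (s - of_real
            \<gamma>)\<^sup>2)"
    unfolding q_def[abs_def] k_def .
qed

definition power_log_sum :: "(nat \<Rightarrow> real) \<Rightarrow> (nat \<Rightarrow> complex)
    \<Rightarrow> (nat \<Rightarrow> complex) \<Rightarrow> nat set \<Rightarrow> real
    \<Rightarrow> complex" where
  "power_log_sum \<gamma> A B I r = (\<Sum>j\<in>I. (A j + B j * of_real (ln r)) * of_real (r powr
      (\<gamma> j - 1)))"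

text \<open>The closed form of the Mellin transform of \<open>power_log_sum\<close>, now read for
  all s. At s = \<gamma> j the summand is 0 by division by zero, so later comparisons near a pole
  are made on punctured neighbourhoods.\<close>

definition polar_part :: "real \<Rightarrow> (nat \<Rightarrow> real) \<Rightarrow> (nat
    \<Rightarrow> complex) \<Rightarrow> (nat \<Rightarrow> complex) \<Rightarrow> nat set
    \<Rightarrow> complex \<Rightarrow> complex" where
  "polar_part \<rho> \<gamma> A B I s = (\<Sum>j\<in>I. exp ((of_real (\<gamma> j) - s) * of_real
      (ln \<rho>)) *
     ((A j + B j * of_real (ln \<rho>)) / (s - of_real (\<gamma> j)) + B j / (s - of_real (\<gamma>
         j))\<^sup>2))"

lemma continuous_on_power_log_sum: "\<rho> > 0 \<Longrightarrow> continuous_on {\<rho>..}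
    (power_log_sum \<gamma> A B I)"
  unfolding power_log_sum_def by (auto intro!: continuous_intros)

lemma mellin_decompose:
  assumes \<rho>: "\<rho> > 0" and fin: "finite I" and q: "continuous_on {\<rho>..} q"
    and rem: "\<And>r. r \<ge> \<rho> \<Longrightarrow> norm (q r - power_log_sum \<gamma> A B I r)
        \<le> C * r powr (\<sigma> - 1)"
    and s: "Re s > \<sigma>" "\<And>j. j \<in> I \<Longrightarrow> Re s > \<gamma> j"
  shows "mellin \<rho> q s = polar_part \<rho> \<gamma> A B I s + mellin \<rho> (\<lambda>r. q r -
      power_log_sum \<gamma> A B I r) s"
proof -
  have "continuous_on {\<rho>..} (\<lambda>r. q r - power_log_sum \<gamma> A B I r)"
    by (intro continuous_intros q continuous_on_power_log_sum \<rho>)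
  note int_rem = mellin_integrable[OF \<rho> this rem s(1)]
  have sum: "integral {\<rho>..} (\<lambda>r. \<Sum>j\<in>I. exp (- s * of_real (ln r)) * ((A j + B
      j * of_real (ln r)) * of_real (r powr (\<gamma> j - 1)))) =
      polar_part \<rho> \<gamma> A B I s"
    using fin s(2) mellin_power_log[OF \<rho>, of _ s]
    by (subst integral_sum) (auto simp: polar_part_def mellin_def intro!: sum.cong)
  have int_sum: "(\<lambda>r. \<Sum>j\<in>I. exp (- s * of_real (ln r)) * ((A j + B j * of_real (ln
      r)) * of_real (r powr (\<gamma> j - 1)))) integrable_on {\<rho>..}"
    using fin s(2) mellin_power_log(1)[OF \<rho>, of _ s] by (intro integrable_sum) auto
  have "mellin \<rho> q s = integral {\<rho>..} (\<lambda>r. (\<Sum>j\<in>I. exp (- s * of_real (ln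
      r)) * ((A j + B j * of_real (ln r)) * of_real (r powr (\<gamma> j - 1))))
      + exp (- s * of_real (ln r)) * (q r - power_log_sum \<gamma> A B I r))"
    unfolding mellin_def power_log_sum_def sum_distrib_left[symmetric] by (simp add: algebra_simps)
  also have "\<dots> = polar_part \<rho> \<gamma> A B I s + mellin \<rho> (\<lambda>r. q r -
      power_log_sum \<gamma> A B I r) s"
    using integral_add[OF int_sum int_rem] sum by (simp only: mellin_def)
  finally show ?thesis .
qed

lemma polar_part_holomorphic:
  "finite I \<Longrightarrow> polar_part \<rho> \<gamma> A B I holomorphic_on - (\<lambda>j.
      of_real (\<gamma> j)) ` I"
  unfolding polar_part_def by (intro holomorphic_intros) auto

lemma polar_part_meromorphic: "finite I \<Longrightarrow> polar_part \<rho> \<gamma> A B I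
    meromorphic_on S"
  unfolding polar_part_def
  by (intro meromorphic_intros) (auto intro!: analytic_on_imp_meromorphic_on analytic_intros)

section \<open>The circle term as an entire function of s\<close>

lemma circle_int_holomorphic:
  assumes \<rho>: "\<rho> > 0" and p: "continuous_on (sphere 0 \<rho>) p"
  shows "(\<lambda>s. circle_int \<theta> \<rho> s p) holomorphic_on UNIV"
    and "(\<lambda>s. circle_int \<theta> \<rho> s p) field_differentiable at s"
    and "deriv (\<lambda>s. circle_int \<theta> \<rho> s p) s = integral {\<theta> - 2 *
        pi..\<theta>}
      (\<lambda>\<phi>. - (of_real (ln \<rho>) + \<i> * of_real \<phi>) * polar_power \<rho> \<phi>
          (- s) * (\<i> * rcis \<rho> \<phi>) * p (rcis \<rho> \<phi>))"
proof -
  have d: "((\<lambda>s. polar_power \<rho> \<phi> (- s) * (\<i> * rcis \<rho> \<phi>) * p (rcis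
      \<rho> \<phi>)) has_field_derivative
      - (of_real (ln \<rho>) + \<i> * of_real \<phi>) * polar_power \<rho> \<phi> (- s) * (\<i> *
          rcis \<rho> \<phi>) * p (rcis \<rho> \<phi>)) (at s within UNIV)" for s \<phi>
    unfolding polar_power_def Complex_eq by (auto intro!: derivative_eq_intros)
  have i: "(\<lambda>\<phi>. polar_power \<rho> \<phi> (- s) * (\<i> * rcis \<rho> \<phi>) * p
      (rcis \<rho> \<phi>)) integrable_on cbox (\<theta> - 2 * pi) \<theta>" for s
    unfolding box_real
    by (intro integrable_continuous_interval continuous_intros continuous_on_compose2[OF p]) (use
        \<rho> in auto)
  have c: "continuous_on (UNIV \<times> cbox (\<theta> - 2 * pi) \<theta>)
      (\<lambda>(s, \<phi>). - (of_real (ln \<rho>) + \<i> * of_real \<phi>) * polar_power \<rho>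
          \<phi> (- s) * (\<i> * rcis \<rho> \<phi>) * p (rcis \<rho> \<phi>))"
    unfolding split_beta by (intro continuous_intros continuous_on_compose2[OF p]) (use \<rho> in
        auto)
  have fd: "((\<lambda>s. integral (cbox (\<theta> - 2 * pi) \<theta>) (\<lambda>\<phi>.
      polar_power \<rho> \<phi> (- s) * (\<i> * rcis \<rho> \<phi>) * p (rcis \<rho> \<phi>)))
      has_field_derivative
      integral (cbox (\<theta> - 2 * pi) \<theta>) (\<lambda>\<phi>. - (of_real (ln \<rho>) + \<i>
          * of_real \<phi>) * polar_power \<rho> \<phi> (- s) * (\<i> * rcis \<rho> \<phi>) * p
          (rcis \<rho> \<phi>))) (at s within UNIV)" for s
    by (rule leibniz_rule_field_derivative[OF d i c]) auto
  then show "(\<lambda>s. circle_int \<theta> \<rho> s p) field_differentiable at s" for s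
    unfolding circle_int_def box_real field_differentiable_def by blast
  then show "(\<lambda>s. circle_int \<theta> \<rho> s p) holomorphic_on UNIV"
    by (simp add: holomorphic_on_def)
  show "deriv (\<lambda>s. circle_int \<theta> \<rho> s p) s = integral {\<theta> - 2 *
      pi..\<theta>}
      (\<lambda>\<phi>. - (of_real (ln \<rho>) + \<i> * of_real \<phi>) * polar_power \<rho> \<phi>
          (- s) * (\<i> * rcis \<rho> \<phi>) * p (rcis \<rho> \<phi>))"
    using DERIV_imp_deriv[OF fd] unfolding circle_int_def box_real by simp
qed

section \<open>Meromorphic continuation\<close>

text \<open>The difference, freed from its removable singularities, vanishes far to the right and
  hence on the connected half plane. Thus f and g agree near s except possibly at s itself, where
  the normalisation of poles and removable points decides.\<close>

lemma nicely_meromorphic_eqI: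
  assumes f: "f nicely_meromorphic_on {s. Re s > \<sigma>}" and g: "g nicely_meromorphic_on {s. Re
      s > \<sigma>}"
    and eq: "\<And>s. Re s > b \<Longrightarrow> f s = g s" and s: "Re s > \<sigma>"
  shows "f s = g s"
proof -
  define D where "D = {s. Re s > \<sigma>}"
  have D: "open D" "connected D"
    unfolding D_def by (auto intro: open_halfspace_Re_gt convex_connected convex_halfspace_Re_gt)
  have mero: "(\<lambda>s. f s - g s) meromorphic_on D"
    using f g unfolding nicely_meromorphic_on_def D_def by (auto intro!: meromorphic_intros)
  define h where "h = remove_sings (\<lambda>s. f s - g s)"
  have h: "h nicely_meromorphic_on D"
    unfolding h_def by (rule remove_sings_nicely_meromorphic[OF mero])
  define z where "z = complex_of_real (max b \<sigma> + 1)"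
  have z: "z \<in> D" "Re z > b" by (simp_all add: D_def z_def)
  have ev: "eventually (\<lambda>w. w \<in> {s. Re s > b}) (at z)"
    using z open_halfspace_Re_gt[of b] by (intro eventually_at_in_open') auto
  have "eventually (\<lambda>w. h w = 0) (at z)"
    using ev
  proof eventually_elim
    case (elim w)
    have "eventually (\<lambda>v. f v - g v = 0) (nhds w)"
      using eventually_nhds_in_open[OF open_halfspace_Re_gt[of b], of w] elim
      by (auto elim!: eventually_mono simp: eq)
    then have "(\<lambda>v. f v - g v) analytic_on {w}"
      by (subst analytic_at_cong[where g = "\<lambda>_. 0"]) auto
    then show ?case using elim by (simp add: h_def eq)
  qed
  then have "frequently (\<lambda>w. h w = 0) (at z)"
    by (intro eventually_frequently) auto
  from frequently_eq_meromorphic_imp_constant[OF this h D z(1)]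
  have h0: "h w = 0" if "w \<in> D" for w using that by blast
  have "eventually (\<lambda>w. h w = f w - g w) (cosparse D)"
    unfolding h_def by (rule eventually_remove_sings_eq[OF mero])
  then have "eventually (\<lambda>w. h w = f w - g w) (at s)"
    using s D by (auto simp: eventually_cosparse_open_eq D_def)
  moreover have "eventually (\<lambda>w. w \<in> D) (at s)"
    using s D by (intro eventually_at_in_open') (auto simp: D_def)
  ultimately have fg: "eventually (\<lambda>w. f w = g w) (at s)"
    by eventually_elim (use h0 in auto)
  have cong: "is_pole f s \<longleftrightarrow> is_pole g s" "f \<midarrow>s\<rightarrow> c
      \<longleftrightarrow> g \<midarrow>s\<rightarrow> c" for c
    using fg by (auto intro!: is_pole_cong tendsto_cong)
  have "(is_pole f s \<and> f s = 0) \<or> f \<midarrow>s\<rightarrow> f s" "(is_pole g s \<and> g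
      s = 0) \<or> g \<midarrow>s\<rightarrow> g s"
    using f g s by (auto simp: nicely_meromorphic_on_def)
  then show ?thesis
    using cong not_tendsto_and_filterlim_at_infinity[of "at s" g] LIM_unique[of g]
    unfolding is_pole_def by (metis at_neq_bot)
qed

lemma nicely_meromorphic_local:
  assumes "\<And>z. z \<in> S \<Longrightarrow> \<exists>U g. open U \<and> z \<in> U \<and> g
      nicely_meromorphic_on U \<and> (\<forall>w\<in>U. f w = g w)"
  shows "f nicely_meromorphic_on S"
  unfolding nicely_meromorphic_on_def
proof (intro conjI ballI)
  have ev: "\<exists>g. g nicely_meromorphic_on {z} \<and> eventually (\<lambda>w. f w = g w) (nhds
      z)" if z: "z \<in> S" for z
  proof -
    obtain U g where "open U" "z \<in> U" "g nicely_meromorphic_on U" "\<forall>w\<in>U. f w = g w"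
      using assms[OF z] by blast
    then show ?thesis
      by (intro exI[of _ g]) (auto intro: nicely_meromorphic_on_subset eventually_mono[OF
          eventually_nhds_in_open])
  qed
  have "f meromorphic_on {z}" if z: "z \<in> S" for z
  proof -
    obtain g where g: "g nicely_meromorphic_on {z}" "eventually (\<lambda>w. f w = g w) (nhds z)"
      using ev[OF z] by blast
    then have "eventually (\<lambda>w. f w = g w) (at z)" by (simp add: eventually_nhds_conv_at)
    then show ?thesis
      using g(1) meromorphic_on_cong[of "{z}" f g "{z}"] by (auto simp: nicely_meromorphic_on_def)
  qed
  then show "f meromorphic_on S" using meromorphic_on_meromorphic_at by blast
  fix z assume z: "z \<in> S"
  obtain g where g: "g nicely_meromorphic_on {z}" "eventually (\<lambda>w. f w = g w) (nhds z)"
    using ev[OF z] by blast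
  then have fg: "eventually (\<lambda>w. f w = g w) (at z)" "f z = g z"
    by (auto simp: eventually_nhds_conv_at)
  have "is_pole f z \<longleftrightarrow> is_pole g z" "f \<midarrow>z\<rightarrow> c
      \<longleftrightarrow> g \<midarrow>z\<rightarrow> c" for c
    using fg by (auto intro!: is_pole_cong tendsto_cong)
  then show "is_pole f z \<and> f z = 0 \<or> f \<midarrow>z\<rightarrow> f z"
    using g(1) fg(2) by (auto simp: nicely_meromorphic_on_def)
qed

text \<open>The candidates G n need to agree with H only beyond abscissas b n depending on n, which
  is all that a convergent decomposition supplies. After normalisation, uniqueness extends the
  agreement to all overlaps.\<close>

lemma meromorphic_continuation_glue:
  assumes G: "\<And>n::nat. G n meromorphic_on {s. Re s > - real n}"
    and eq: "\<And>n s. Re s > b n \<Longrightarrow> G n s = H s" and H: "H holomorphic_on {s. Re s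
        > a}"
  obtains F where "F nicely_meromorphic_on UNIV" "\<And>s. Re s > a \<Longrightarrow> F s = H s"
proof -
  define N where "N n = remove_sings (G n)" for n
  have nice: "N n nicely_meromorphic_on {s. Re s > - real n}" for n
    unfolding N_def by (rule remove_sings_nicely_meromorphic[OF G])
  have H': "H analytic_on {s. Re s > c}" if "c \<ge> a" for c
    using H that open_halfspace_Re_gt by (subst analytic_on_open) (auto intro:
        holomorphic_on_subset)
  have Hn: "H nicely_meromorphic_on {s. Re s > a}"
    by (rule analytic_on_imp_nicely_meromorphic_on[OF H'[OF order_refl]])
  have NH': "N n s = H s" if s: "Re s > max (b n) a" for n s
  proof -
    have "eventually (\<lambda>w. G n w = H w) (nhds s)"
      using eventually_nhds_in_open[OF open_halfspace_Re_gt[of "max (b n) a"], of s] s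
      by (auto elim!: eventually_mono simp: eq)
    moreover have "H analytic_on {s}" using H'[of a] s by (auto intro: analytic_on_subset)
    ultimately have "G n analytic_on {s}" using analytic_at_cong by blast
    then show ?thesis using s by (simp add: N_def eq)
  qed
  have NN: "N n s = N m s" if "Re s > - real n" "Re s > - real m" for n m s
    by (rule nicely_meromorphic_eqI[of _ "max (- real n) (- real m)" _ "Max {b n, b m, a}"])
       (use that nice NH' in \<open>auto intro: nicely_meromorphic_on_subset\<close>)
  have NH: "N n s = H s" if "Re s > - real n" "Re s > a" for n s
    by (rule nicely_meromorphic_eqI[where f = "N n" and g = H and \<sigma> = "max (- real n) a" and
        b = "max (b n) a"])
       (use that nice NH' Hn in \<open>auto intro: nicely_meromorphic_on_subset\<close>)
  \<comment> \<open>The index is chosen so large that s lies inside the half plane of the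
    candidate.\<close>
  define F where "F s = N (nat \<lceil>1 - Re s\<rceil>) s" for s
  have ge: "Re s > - real (nat \<lceil>1 - Re s\<rceil>)" for s by linarith
  have FN: "F s = N n s" if "Re s > - real n" for n s
    unfolding F_def by (rule NN[OF ge that])
  show ?thesis
  proof (rule that)
    show "F nicely_meromorphic_on UNIV"
    proof (rule nicely_meromorphic_local)
      fix z :: complex
      show "\<exists>U g. open U \<and> z \<in> U \<and> g nicely_meromorphic_on U \<and>
          (\<forall>w\<in>U. F w = g w)"
        by (rule exI[of _ "{s. Re s > - real (nat \<lceil>1 - Re z\<rceil>)}"], rule exI[of _ "N
            (nat \<lceil>1 - Re z\<rceil>)"])
           (use ge nice FN in \<open>auto intro: open_halfspace_Re_gt\<close>)
    qed
    show "F s = H s" if "Re s > a" for s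
      unfolding F_def by (rule NH[OF ge that])
  qed
qed

text \<open>The formula of \<open>contour_int_mellin\<close> with the Mellin transform in split
  form: explicit poles from I, and the transform of a remainder that converges further to the
  left.\<close>

definition cont_local :: "real \<Rightarrow> real \<Rightarrow> (complex \<Rightarrow> complex)
    \<Rightarrow> (nat \<Rightarrow> real) \<Rightarrow> (nat \<Rightarrow> complex) \<Rightarrow>
    (nat \<Rightarrow> complex) \<Rightarrow> nat set \<Rightarrow> complex \<Rightarrow> complex"
        where
  "cont_local \<theta> \<rho> p \<gamma> A B I s = \<i> / (2 * of_real pi) *
     (2 * \<i> * sin (of_real pi * s) * exp (- \<i> * s * of_real (\<theta> - pi)) *
       (polar_part \<rho> \<gamma> A B I s +
        mellin \<rho> (\<lambda>r. cis \<theta> * p (rcis r \<theta>) - power_log_sum \<gamma> A B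
            I r) s) -
      circle_int \<theta> \<rho> s p)"

locale contour_function =
  fixes \<theta> \<rho> :: real and p :: "complex \<Rightarrow> complex" and M :: real
  assumes rho_pos: "\<rho> > 0" and continuous_p: "continuous_on (contour_set \<theta> \<rho>) p"
    and norm_p_le: "\<And>z. z \<in> contour_set \<theta> \<rho> \<Longrightarrow> norm (p z) \<le>
        M"
begin

definition q :: "real \<Rightarrow> complex" where "q r = cis \<theta> * p (rcis r \<theta>)"

lemma continuous_q: "continuous_on {\<rho>..} q"
  unfolding q_def by (intro continuous_intros continuous_on_compose2[OF continuous_p]) (use rho_pos
      in auto)

text \<open>The exponent is written as 1 - 1 to match the form a - 1 with a = 1, the abscissa
  belonging to a merely bounded function.\<close>

lemma norm_q_le: "r \<ge> \<rho> \<Longrightarrow> norm (q r) \<le> M * r powr (1 - 1)"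
  using norm_p_le rho_pos by (simp add: q_def norm_mult)

lemma continuous_rem: "continuous_on {\<rho>..} (\<lambda>r. q r - power_log_sum \<gamma> A B I r)"
  by (intro continuous_intros continuous_q continuous_on_power_log_sum rho_pos)

lemma continuous_p_circle: "continuous_on (sphere 0 \<rho>) p"
  by (rule continuous_on_subset[OF continuous_p]) (auto simp: contour_set_def)

lemma contour_int_holomorphic: "(\<lambda>s. contour_int \<theta> \<rho> s p) holomorphic_on {s. Re
    s > 1}"
  unfolding contour_int_mellin q_def[symmetric]
  by (intro holomorphic_intros mellin_holomorphic[OF rho_pos continuous_q norm_q_le]
      holomorphic_on_subset[OF circle_int_holomorphic(1)[OF rho_pos continuous_p_circle]]) auto

lemma cont_local_eq:
  assumes "finite I" "\<And>r. r \<ge> \<rho> \<Longrightarrow> norm (q r - power_log_sum \<gamma>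
      A B I r) \<le> C * r powr (\<sigma> - 1)"
    and "Re s > \<sigma>" "\<And>j. j \<in> I \<Longrightarrow> Re s > \<gamma> j"
  shows "cont_local \<theta> \<rho> p \<gamma> A B I s = \<i> / (2 * of_real pi) * contour_int
      \<theta> \<rho> s p"
  unfolding cont_local_def contour_int_mellin q_def[symmetric]
  using mellin_decompose[OF rho_pos assms(1) continuous_q assms(2-4)] by simp

lemma cont_local_meromorphic:
  assumes "finite I" "\<And>r. r \<ge> \<rho> \<Longrightarrow> norm (q r - power_log_sum \<gamma>
      A B I r) \<le> C * r powr (\<sigma> - 1)"
  shows "cont_local \<theta> \<rho> p \<gamma> A B I meromorphic_on {s. Re s > \<sigma>}"
proof -
  have "mellin \<rho> (\<lambda>r. q r - power_log_sum \<gamma> A B I r) analytic_on {s. Re s >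
      \<sigma>}"
    using mellin_holomorphic[OF rho_pos continuous_rem assms(2)] open_halfspace_Re_gt
    by (simp add: analytic_on_open)
  moreover have "(\<lambda>s. circle_int \<theta> \<rho> s p) analytic_on {s. Re s > \<sigma>}"
    using circle_int_holomorphic(1)[OF rho_pos continuous_p_circle, of \<theta>]
    by (meson analytic_on_open analytic_on_subset open_UNIV subset_UNIV)
  ultimately show ?thesis
    unfolding cont_local_def q_def[symmetric]
    by (intro meromorphic_intros polar_part_meromorphic assms(1) analytic_on_imp_meromorphic_on)
       (auto intro!: analytic_intros)
qed

text \<open>A remainder of order r^(-n-1) gives a continuation to Re s > -n, and these are glued.
  The last property lets the behaviour near a point be read off from any sufficiently long
  expansion; it speaks of a punctured neighbourhood because \<open>cont_local\<close> has default
  values at its poles.\<close>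

lemma contour_continuation:
  assumes exp: "\<And>\<sigma>. \<exists>N C. \<forall>r\<ge>\<rho>. norm (q r - power_log_sum
      \<gamma> A B {..<N::nat} r) \<le> C * r powr (\<sigma> - 1)"
  obtains F where "F nicely_meromorphic_on UNIV"
    "\<And>s. Re s > 1 \<Longrightarrow> F s = \<i> / (2 * of_real pi) * contour_int \<theta>
        \<rho> s p"
    "\<And>\<sigma> I C s. finite I \<Longrightarrow> (\<And>r. r \<ge> \<rho> \<Longrightarrow>
        norm (q r - power_log_sum \<gamma> A B I r) \<le> C * r powr (\<sigma> - 1))
        \<Longrightarrow>
       Re s > \<sigma> \<Longrightarrow> eventually (\<lambda>w. F w = cont_local \<theta> \<rho> p
           \<gamma> A B I w) (at s)"
proof -
  define H where "H s = \<i> / (2 * of_real pi) * contour_int \<theta> \<rho> s p" for s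
  have H: "H holomorphic_on {s. Re s > 1}"
    unfolding H_def by (intro holomorphic_intros contour_int_holomorphic)
  have "\<forall>n::nat. \<exists>N C. \<forall>r\<ge>\<rho>. norm (q r - power_log_sum \<gamma> A
      B {..<N::nat} r) \<le> C * r powr (- real n - 1)"
    using exp by blast
  then obtain N C where NC: "\<And>n::nat. \<And>r. r \<ge> \<rho> \<Longrightarrow>
      norm (q r - power_log_sum \<gamma> A B {..<N n} r) \<le> C n * r powr (- real n - 1)"
    by metis
  define G where "G n = cont_local \<theta> \<rho> p \<gamma> A B {..<N n}" for n
  have Gm: "G n meromorphic_on {s. Re s > - real n}" for n
    unfolding G_def by (rule cont_local_meromorphic[OF _ NC]) auto
  have GH: "G n s = H s" if "Re s > Max (insert (- real n) (\<gamma> ` {..<N n}))" for n s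
    unfolding G_def H_def by (rule cont_local_eq[OF _ NC]) (use that in auto)
  obtain F where F: "F nicely_meromorphic_on UNIV" "\<And>s. Re s > 1 \<Longrightarrow> F s = H s"
    using meromorphic_continuation_glue[where G = G and H = H and a = 1 and
        b = "\<lambda>n. Max (insert (- real n) (\<gamma> ` {..<N n}))", OF Gm GH H] by metis
  show ?thesis
  proof (rule that[OF F(1)])
    show "F s = \<i> / (2 * of_real pi) * contour_int \<theta> \<rho> s p" if "Re s > 1" for s
      using F(2)[OF that] by (simp add: H_def)
    fix \<sigma> I D s
    assume I: "finite I" "\<And>r. r \<ge> \<rho> \<Longrightarrow> norm (q r - power_log_sum
        \<gamma> A B I r) \<le> D * r powr (\<sigma> - 1)" and s: "Re s > \<sigma>"
    note mero = cont_local_meromorphic[OF I]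
    \<comment> \<open>To the right of b lie no poles of the split form, and both it and the contour
      integral converge there.\<close>
    define b where "b = Max (insert 1 (insert \<sigma> (\<gamma> ` I)))"
    have b: "b \<ge> x" if "x \<in> insert 1 (insert \<sigma> (\<gamma> ` I))" for x
      unfolding b_def by (rule Max_ge[OF _ that]) (use I(1) in auto)
    then have b: "b \<ge> 1" "b \<ge> \<sigma>" "\<And>j. j \<in> I \<Longrightarrow> b \<ge>
        \<gamma> j" by auto
    have loc: "cont_local \<theta> \<rho> p \<gamma> A B I s = H s" if "Re s > b" for s
      unfolding H_def by (rule cont_local_eq[OF I]) (use that b(2) b(3) in force)+
    have rs: "remove_sings (cont_local \<theta> \<rho> p \<gamma> A B I) s = H s" if s: "Re s > b"
        for s
    proof -
      have "eventually (\<lambda>w. cont_local \<theta> \<rho> p \<gamma> A B I w = H w) (nhds s)"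
        using eventually_nhds_in_open[OF open_halfspace_Re_gt[of b], of s] s
        by (auto elim!: eventually_mono simp: loc)
      moreover have "H analytic_on {s}"
        using H s b open_halfspace_Re_gt[of 1] by (auto simp: analytic_at)
      ultimately have "cont_local \<theta> \<rho> p \<gamma> A B I analytic_on {s}" using
          analytic_at_cong by blast
      then show ?thesis using s by (simp add: loc)
    qed
    have "remove_sings (cont_local \<theta> \<rho> p \<gamma> A B I) w = F w" if "Re w > \<sigma>"
        for w
    proof (rule nicely_meromorphic_eqI[OF _ _ _ that])
      show "remove_sings (cont_local \<theta> \<rho> p \<gamma> A B I) nicely_meromorphic_on {s.
          \<sigma> < Re s}"
        by (rule remove_sings_nicely_meromorphic[OF mero])
      show "F nicely_meromorphic_on {s. \<sigma> < Re s}"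
        using F(1) by (rule nicely_meromorphic_on_subset) auto
      show "remove_sings (cont_local \<theta> \<rho> p \<gamma> A B I) s = F s" if "Re s > b" for s
        using rs[OF that] F(2)[of s] that b by simp
    qed
    moreover have "eventually (\<lambda>w. w \<in> {s. Re s > \<sigma>}) (at s)"
      using s open_halfspace_Re_gt[of \<sigma>] by (intro eventually_at_in_open') auto
    moreover have "eventually (\<lambda>w. remove_sings (cont_local \<theta> \<rho> p \<gamma> A B
        I) w = cont_local \<theta> \<rho> p \<gamma> A B I w) (at s)"
      using eventually_remove_sings_eq[OF mero] s open_halfspace_Re_gt[of \<sigma>]
      by (auto simp: eventually_cosparse_open_eq)
    ultimately show "eventually (\<lambda>w. F w = cont_local \<theta> \<rho> p \<gamma> A B I w)
        (at s)"
      by (auto elim: eventually_elim2)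
  qed
qed

lemma field_differentiable_mellin_rem:
  assumes "\<And>r. r \<ge> \<rho> \<Longrightarrow> norm (q r - power_log_sum \<gamma> A B I r)
      \<le> C * r powr (\<sigma> - 1)" "Re s > \<sigma>"
  shows "mellin \<rho> (\<lambda>r. q r - power_log_sum \<gamma> A B I r) field_differentiable at s"
  using mellin_holomorphic[OF rho_pos continuous_rem assms(1)] assms(2) open_halfspace_Re_gt[of
      \<sigma>]
  by (intro holomorphic_on_imp_differentiable_at) auto

text \<open>At the zeros of the sine the simple poles are removed, the double ones are not.\<close>

lemma cont_local_tendsto:
  assumes I: "finite I" "\<And>r. r \<ge> \<rho> \<Longrightarrow> norm (q r - power_log_sum
      \<gamma> A B I r) \<le> C * r powr (\<sigma> - 1)"
    and z: "Re z > \<sigma>" "sin (of_real pi * z) = 0"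
    and B: "\<And>j. j \<in> I \<Longrightarrow> of_real (\<gamma> j) = z \<Longrightarrow> B j = 0"
  obtains c where "cont_local \<theta> \<rho> p \<gamma> A B I \<midarrow>z\<rightarrow> c"
proof -
  have sc: "((\<lambda>s. sin (of_real pi * s)) \<longlongrightarrow> sin (of_real pi * z)) (at z)"
    by (intro tendsto_intros)
  have "\<exists>c. ((\<lambda>s. sin (of_real pi * s) * (exp ((of_real (\<gamma> j) - s) * of_real
      (ln \<rho>)) *
     ((A j + B j * of_real (ln \<rho>)) / (s - of_real (\<gamma> j)) + B j / (s - of_real (\<gamma>
         j))\<^sup>2))) \<longlongrightarrow> c) (at z)"
    if j: "j \<in> I" for j
  proof (cases "of_real (\<gamma> j) = z")
    case True
    have "((\<lambda>s. sin (of_real pi * s)) has_field_derivative cos (of_real pi * z) * of_real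
        pi) (at z)"
      by (auto intro!: derivative_eq_intros)
    then have "((\<lambda>s. (sin (of_real pi * s) - sin (of_real pi * z)) / (s - z))
        \<longlongrightarrow> cos (of_real pi * z) * of_real pi) (at z)"
      by (simp add: has_field_derivative_iff)
    then have "((\<lambda>s. sin (of_real pi * s) / (s - z)) \<longlongrightarrow> cos (of_real pi
        * z) * of_real pi) (at z)"
      using z(2) by simp
    then have "((\<lambda>s. sin (of_real pi * s) / (s - z) * (exp ((z - s) * of_real (ln \<rho>))
        * A j)) \<longlongrightarrow>
        cos (of_real pi * z) * of_real pi * (exp ((z - z) * of_real (ln \<rho>)) * A j)) (at z)"
      by (intro tendsto_intros)
    moreover have "sin (of_real pi * s) * (exp ((of_real (\<gamma> j) - s) * of_real (ln \<rho>)) *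
        ((A j + B j * of_real (ln \<rho>)) / (s - of_real (\<gamma> j)) + B j / (s - of_real
            (\<gamma> j))\<^sup>2)) =
        sin (of_real pi * s) / (s - z) * (exp ((z - s) * of_real (ln \<rho>)) * A j)" for s
      using B[OF j True] True by simp
    ultimately show ?thesis by auto
  next
    case False
    then have "isCont (\<lambda>s. sin (of_real pi * s) * (exp ((of_real (\<gamma> j) - s) *
        of_real (ln \<rho>)) *
        ((A j + B j * of_real (ln \<rho>)) / (s - of_real (\<gamma> j)) + B j / (s - of_real
            (\<gamma> j))\<^sup>2))) z"
      by (intro continuous_intros) auto
    then show ?thesis unfolding isCont_def by blast
  qed
  then have "\<forall>j\<in>I. \<exists>c. ((\<lambda>s. sin (of_real pi * s) * (exp ((of_real
      (\<gamma> j) - s) * of_real (ln \<rho>)) *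
     ((A j + B j * of_real (ln \<rho>)) / (s - of_real (\<gamma> j)) + B j / (s - of_real (\<gamma>
         j))\<^sup>2))) \<longlongrightarrow> c) (at z)"
    by (intro ballI)
  from bchoice[OF this] obtain c where c: "\<forall>j\<in>I. ((\<lambda>s. sin (of_real pi * s) *
      (exp ((of_real (\<gamma> j) - s) * of_real (ln \<rho>)) *
     ((A j + B j * of_real (ln \<rho>)) / (s - of_real (\<gamma> j)) + B j / (s - of_real (\<gamma>
         j))\<^sup>2))) \<longlongrightarrow> c j) (at z)" ..
  have "((\<lambda>s. sin (of_real pi * s) * polar_part \<rho> \<gamma> A B I s)
      \<longlongrightarrow> (\<Sum>j\<in>I. c j)) (at z)"
    unfolding polar_part_def sum_distrib_left using c by (intro tendsto_sum) auto
  moreover have "(mellin \<rho> (\<lambda>r. q r - power_log_sum \<gamma> A B I r)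
      \<longlongrightarrow> mellin \<rho> (\<lambda>r. q r - power_log_sum \<gamma> A B I r) z) (at
      z)"
    using field_differentiable_imp_continuous_at[OF field_differentiable_mellin_rem[OF I(2) z(1)]]
        by (simp add: isCont_def)
  moreover have "((\<lambda>s. circle_int \<theta> \<rho> s p) \<longlongrightarrow> circle_int
      \<theta> \<rho> z p) (at z)"
    using field_differentiable_imp_continuous_at[OF circle_int_holomorphic(2)[OF rho_pos
        continuous_p_circle]]
    by (simp add: isCont_def)
  ultimately have "((\<lambda>s. \<i> / (2 * of_real pi) * (2 * \<i> * exp (- \<i> * s * of_real
      (\<theta> - pi)) *
       (sin (of_real pi * s) * polar_part \<rho> \<gamma> A B I s + sin (of_real pi * s) * mellin
           \<rho> (\<lambda>r. q r - power_log_sum \<gamma> A B I r) s) -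
      circle_int \<theta> \<rho> s p)) \<longlongrightarrow>
      \<i> / (2 * of_real pi) * (2 * \<i> * exp (- \<i> * z * of_real (\<theta> - pi)) *
       ((\<Sum>j\<in>I. c j) + sin (of_real pi * z) * mellin \<rho> (\<lambda>r. q r -
           power_log_sum \<gamma> A B I r) z) -
      circle_int \<theta> \<rho> z p)) (at z)"
    by (intro tendsto_intros)
  then show ?thesis
    using that unfolding cont_local_def q_def[symmetric] by (simp add: algebra_simps)
qed

text \<open>The pole A J / s meets the zero of the sine. As sin(\<pi>s)/s is even, it adds nothing
  to the derivative at 0. What remains are the derivatives of the phase and of \<rho>^(-s), both
  multiplied by A J, the finite part of the Mellin transform and the circle. The prefactors multiply
  to i/(2\<pi>) * 2i * \<pi> = -1.\<close>

lemma cont_local_at_0: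
  assumes I: "finite I" "\<And>r. r \<ge> \<rho> \<Longrightarrow> norm (q r - power_log_sum
      \<gamma> A B I r) \<le> C * r powr (\<sigma> - 1)"
    and \<sigma>: "\<sigma> < 0" and J: "J \<in> I" "\<gamma> J = 0" "B J = 0" "\<And>j. j \<in> I
        - {J} \<Longrightarrow> \<gamma> j \<noteq> 0"
  obtains g where "eventually (\<lambda>s. cont_local \<theta> \<rho> p \<gamma> A B I s = g s) (at
      0)"
    "g 0 = - A J - \<i> / (2 * of_real pi) * circle_int \<theta> \<rho> 0 p"
    "(g has_field_derivative (A J * (of_real (ln \<rho>) + \<i> * of_real (\<theta> - pi)) -
        (polar_part \<rho> \<gamma> A B (I - {J}) 0 + integral {\<rho>..} (\<lambda>r. q r -
            power_log_sum \<gamma> A B I r)) -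
        \<i> / (2 * of_real pi) * deriv (\<lambda>s. circle_int \<theta> \<rho> s p) 0)) (at 0)"
proof -
  define S where "S s = (if s = 0 then of_real pi else sin (of_real pi * s) / s)" for s :: complex
  have S0: "(S has_field_derivative 0) (at 0)"
  proof -
    have D: "((\<lambda>s. sin (of_real pi * s)) has_field_derivative of_real pi) (at (0::complex))"
      by (auto intro!: derivative_eq_intros)
    have "(\<lambda>s. if s = 0 then deriv (\<lambda>s. sin (of_real pi * s)) 0
        else (sin (of_real pi * s) - sin (of_real pi * 0)) / (s - 0)) holomorphic_on UNIV"
      by (rule pole_lemma_open) (auto intro!: holomorphic_intros)
    moreover have "(\<lambda>s. if s = 0 then deriv (\<lambda>s. sin (of_real pi * s)) 0
        else (sin (of_real pi * s) - sin (of_real pi * 0)) / (s - 0)) = S"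
      unfolding DERIV_imp_deriv[OF D] by (auto simp: S_def fun_eq_iff)
    ultimately have "S holomorphic_on UNIV" by (simp only:)
    then have dS: "(S has_field_derivative deriv S 0) (at 0)"
      by (rule holomorphic_derivI) auto
    then have "((S \<circ> uminus) has_field_derivative deriv S 0 * (-1)) (at 0)"
      by (intro DERIV_chain) (auto intro!: derivative_eq_intros)
    \<comment> \<open>Evenness gives the vanishing derivative at 0 without the Taylor series of the
      sine.\<close>
    moreover have "S \<circ> uminus = S" by (auto simp: S_def fun_eq_iff)
    ultimately have "deriv S 0 * (-1) = deriv S 0"
      using dS DERIV_unique by metis
    then have "deriv S 0 = 0" by (simp add: equal_neg_zero[symmetric])
    then show ?thesis using dS by simp
  qed
  \<comment> \<open>The part of the split Mellin transform that is regular at s = 0.\<close>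
  define h where "h s = polar_part \<rho> \<gamma> A B (I - {J}) s + mellin \<rho> (\<lambda>r. q r
      - power_log_sum \<gamma> A B I r) s" for s
  have "polar_part \<rho> \<gamma> A B (I - {J}) field_differentiable at 0"
  proof (rule holomorphic_on_imp_differentiable_at[OF polar_part_holomorphic])
    show "open (- (\<lambda>j. complex_of_real (\<gamma> j)) ` (I - {J}))"
      using I(1) by (intro open_Compl finite_imp_closed) auto
    show "0 \<in> - (\<lambda>j. complex_of_real (\<gamma> j)) ` (I - {J})"
      using J(4) by fastforce
  qed (use I(1) in auto)
  then have "h field_differentiable at 0"
    unfolding h_def[abs_def] using field_differentiable_mellin_rem[OF I(2), of 0] \<sigma>
    by (intro field_differentiable_add) auto
  then obtain h' where h': "(h has_field_derivative h') (at 0)"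
    by (auto simp: field_differentiable_def)
  have h0: "h 0 = polar_part \<rho> \<gamma> A B (I - {J}) 0 + integral {\<rho>..} (\<lambda>r. q r
      - power_log_sum \<gamma> A B I r)"
    by (simp add: h_def mellin_def)
  have circ: "((\<lambda>s. circle_int \<theta> \<rho> s p) has_field_derivative deriv (\<lambda>s.
      circle_int \<theta> \<rho> s p) 0) (at 0)"
    using circle_int_holomorphic(2)[OF rho_pos continuous_p_circle, of \<theta> 0]
    by (simp add: field_differentiable_derivI)
  define g where "g s = \<i> / (2 * of_real pi) * (2 * \<i> * S s * exp (- \<i> * s * of_real
      (\<theta> - pi)) *
      (A J * exp (- s * of_real (ln \<rho>)) + s * h s) - circle_int \<theta> \<rho> s p)" for s
  show ?thesis
  proof (rule that[of g])
    have "cont_local \<theta> \<rho> p \<gamma> A B I s = g s" if "s \<noteq> 0" for s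
    proof -
      have *: "polar_part \<rho> \<gamma> A B I s = exp (- s * of_real (ln \<rho>)) * (A J / s) +
          polar_part \<rho> \<gamma> A B (I - {J}) s"
        unfolding polar_part_def using I(1) J by (subst sum.remove[of _ J]) auto
      have "sin (of_real pi * s) * (polar_part \<rho> \<gamma> A B I s + mellin \<rho> (\<lambda>r.
          q r - power_log_sum \<gamma> A B I r) s) =
          S s * (A J * exp (- s * of_real (ln \<rho>)) + s * h s)"
        unfolding * using that by (simp add: S_def h_def field_simps)
      then show ?thesis
        unfolding cont_local_def g_def q_def[symmetric] by (simp add: mult_ac)
    qed
    then show "eventually (\<lambda>s. cont_local \<theta> \<rho> p \<gamma> A B I s = g s) (at 0)"
      by (auto simp: eventually_at_filter)
    show "g 0 = - A J - \<i> / (2 * of_real pi) * circle_int \<theta> \<rho> 0 p"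
      by (simp add: g_def S_def algebra_simps)
    have "((\<lambda>s. \<i> / (2 * of_real pi) * (2 * \<i> * S s * exp (- \<i> * s * of_real
        (\<theta> - pi)) *
      (A J * exp (- s * of_real (ln \<rho>)) + s * h s) - circle_int \<theta> \<rho> s p))
          has_field_derivative
       \<i> / (2 * of_real pi) * (2 * \<i> * (S 0 * (- \<i> * of_real (\<theta> - pi)) * A J + S 0
           * (- of_real (ln \<rho>) * A J + h 0)) -
        deriv (\<lambda>s. circle_int \<theta> \<rho> s p) 0)) (at 0)"
      by (rule derivative_eq_intros S0 h' circ refl | simp add: algebra_simps)+
    then show "(g has_field_derivative (A J * (of_real (ln \<rho>) + \<i> * of_real (\<theta> -
        pi)) -
        (polar_part \<rho> \<gamma> A B (I - {J}) 0 + integral {\<rho>..} (\<lambda>r. q r -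
            power_log_sum \<gamma> A B I r)) -
        \<i> / (2 * of_real pi) * deriv (\<lambda>s. circle_int \<theta> \<rho> s p) 0)) (at 0)"
      unfolding g_def[abs_def] h0[symmetric]
      by (rule DERIV_cong) (simp add: S_def field_simps)
  qed
qed

end

section \<open>Regular points, and the contribution of the circle at s = 0\<close>

lemma nicely_meromorphic_tendsto_imp_analytic:
  assumes F: "F nicely_meromorphic_on UNIV" and "F \<midarrow>z\<rightarrow> c"
  shows "F analytic_on {z}" "F z = c"
proof -
  have np: "\<not> is_pole F z"
    using assms(2) not_tendsto_and_filterlim_at_infinity[of "at z" F c] by (auto simp: is_pole_def)
  then show "F analytic_on {z}" using nicely_meromorphic_on_imp_analytic_at[OF F] by auto
  then have "isCont F z" by (rule analytic_at_imp_isCont)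
  then show "F z = c" using assms(2) LIM_unique by (auto simp: isCont_def)
qed

lemma nicely_meromorphic_eventually_eq:
  assumes F: "F nicely_meromorphic_on UNIV" and ev: "eventually (\<lambda>w. F w = g w) (at z)"
    and g: "(g has_field_derivative D) (at z)"
  shows "F z = g z" "deriv F z = D"
proof -
  have "g \<midarrow>z\<rightarrow> g z" using DERIV_isCont[OF g] by (simp add: isCont_def)
  then have "F \<midarrow>z\<rightarrow> g z" using ev tendsto_cong by blast
  from nicely_meromorphic_tendsto_imp_analytic[OF F this] show Fz: "F z = g z" by simp
  then have "eventually (\<lambda>w. F w = g w) (nhds z)"
    using ev by (auto simp: eventually_at_filter elim: eventually_mono)
  then have "deriv F z = deriv g z" by (rule deriv_cong_ev) simp
  then show "deriv F z = D" using DERIV_imp_deriv[OF g] by simp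
qed

text \<open>Differentiation in s at 0 brings down minus the logarithm ln \<rho> + i\<phi>.
  Integration by parts in \<phi> leaves the jump 2\<pi>i of this logarithm over a full turn, times L
  at the endpoint, and the mean of L over the circle, which is L(0).\<close>

lemma circle_int_deriv:
  assumes \<rho>: "\<rho> > 0" and U: "open U" "cball 0 \<rho> \<subseteq> U" and L: "L
      holomorphic_on U"
  shows "circle_int \<theta> \<rho> 0 (\<lambda>z. - deriv L z) = 0"
    and "deriv (\<lambda>s. circle_int \<theta> \<rho> s (\<lambda>z. - deriv L z)) 0 = 2 * of_real
        pi * \<i> * (L (rcis \<rho> \<theta>) - L 0)"
proof -
  have sph: "rcis \<rho> \<phi> \<in> U" for \<phi> using U \<rho> by auto
  have dL: "((\<lambda>\<phi>. L (rcis \<rho> \<phi>)) has_vector_derivative (\<i> * rcis \<rho>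
      \<phi>) * deriv L (rcis \<rho> \<phi>)) (at \<phi>)" for \<phi>
    using field_vector_diff_chain_at[OF has_vector_derivative_rcis_circle[of \<rho> \<phi>]
        holomorphic_derivI[OF L U(1) sph[of \<phi>]]]
    by (simp add: o_def)
  have "((\<lambda>\<phi>. (\<i> * rcis \<rho> \<phi>) * deriv L (rcis \<rho> \<phi>)) has_integral
      L (rcis \<rho> \<theta>) - L (rcis \<rho> (\<theta> - 2 * pi))) {\<theta> - 2 * pi..\<theta>}"
    by (rule fundamental_theorem_of_calculus) (auto intro!: has_vector_derivative_at_within dL)
  then have "integral {\<theta> - 2 * pi..\<theta>} (\<lambda>\<phi>. - ((\<i> * rcis \<rho>
      \<phi>) * deriv L (rcis \<rho> \<phi>))) = 0"
    by (simp add: rcis_diff_2pi integral_unique)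
  then show "circle_int \<theta> \<rho> 0 (\<lambda>z. - deriv L z) = 0"
    by (simp add: circle_int_def polar_power_def mult_ac)
  have mean: "((\<lambda>\<phi>. L (rcis \<rho> \<phi>)) has_integral 2 * of_real pi * L 0)
      {\<theta> - 2 * pi..\<theta>}"
  proof -
    \<comment> \<open>Rotation by \<theta> makes the standard circle path, which starts at argument
      0, match the interval from \<theta> - 2\<pi> to \<theta>.\<close>
    define f where "f z = L (z * cis \<theta>)" for z
    have f: "f holomorphic_on cball 0 \<rho>"
      unfolding f_def using U \<rho>
      by (intro holomorphic_on_compose_gen[OF _ L, unfolded o_def] holomorphic_intros) (auto simp:
          norm_mult)
    then have "((\<lambda>u. f u / (u - 0)) has_contour_integral (2 * of_real pi * \<i> * f 0))
        (circlepath 0 \<rho>)"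
      using \<rho> by (intro Cauchy_integral_circlepath holomorphic_on_imp_continuous_on
          holomorphic_on_subset[OF f]) auto
    then have "((\<lambda>t. f (0 + \<rho> * cis t) / (0 + \<rho> * cis t - 0) * \<rho> * \<i> *
        cis t) has_integral (2 * of_real pi * \<i> * f 0)) {0..2 * pi}"
      unfolding circlepath_def by (subst (asm) has_contour_integral_part_circlepath_iff) auto
    then have "((\<lambda>t. - \<i> * (f (0 + \<rho> * cis t) / (0 + \<rho> * cis t - 0) * \<rho> *
        \<i> * cis t)) has_integral - \<i> * (2 * of_real pi * \<i> * f 0)) {0..2 * pi}"
      by (rule has_integral_mult_right)
    moreover have "- \<i> * (f (0 + \<rho> * cis t) / (0 + \<rho> * cis t - 0) * \<rho> * \<i> *
        cis t) = L (rcis \<rho> (\<theta> - 2 * pi + t))" for t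
    proof -
      have "cis (\<theta> - 2 * pi + t) = cis \<theta> * cis t" by (simp only: cis_mult[symmetric]
          cis_diff_2pi)
      then show ?thesis using \<rho> by (simp add: f_def rcis_def mult_ac)
    qed
    ultimately have "(((\<lambda>\<phi>. L (rcis \<rho> \<phi>)) \<circ> (+) (\<theta> - 2 * pi))
        has_integral 2 * of_real pi * L 0) {0..2 * pi}"
      by (simp add: o_def f_def mult_ac)
    then show ?thesis
      unfolding has_integral_shift_Icc_real by simp
  qed
  \<comment> \<open>The continuous logarithm along the circle, with the determination used on the
    contour.\<close>
  define w where "w \<phi> = of_real (ln \<rho>) + \<i> * complex_of_real \<phi>" for \<phi>
  have dw: "(w has_vector_derivative \<i>) (at \<phi>)" for \<phi>
    unfolding w_def[abs_def] by (auto intro!: derivative_eq_intros)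
  have "((\<lambda>\<phi>. w \<phi> * ((\<i> * rcis \<rho> \<phi>) * deriv L (rcis \<rho> \<phi>))
      + \<i> * L (rcis \<rho> \<phi>)) has_integral
      w \<theta> * L (rcis \<rho> \<theta>) - w (\<theta> - 2 * pi) * L (rcis \<rho> (\<theta> - 2
          * pi))) {\<theta> - 2 * pi..\<theta>}"
  proof (rule fundamental_theorem_of_calculus)
    show "((\<lambda>\<phi>. w \<phi> * L (rcis \<rho> \<phi>)) has_vector_derivative
        w \<phi> * ((\<i> * rcis \<rho> \<phi>) * deriv L (rcis \<rho> \<phi>)) + \<i> * L (rcis
            \<rho> \<phi>)) (at \<phi> within {\<theta> - 2 * pi..\<theta>})" for \<phi>
      by (rule has_vector_derivative_at_within[OF has_vector_derivative_mult[OF dw dL]])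
  qed auto
  from has_integral_diff[OF this[unfolded rcis_diff_2pi] has_integral_mult_right[OF mean, of \<i>]]
  have int: "((\<lambda>\<phi>. w \<phi> * ((\<i> * rcis \<rho> \<phi>) * deriv L (rcis \<rho>
      \<phi>))) has_integral 2 * of_real pi * \<i> * (L (rcis \<rho> \<theta>) - L 0)) {\<theta> -
      2 * pi..\<theta>}"
    by (simp add: w_def algebra_simps)
  have C: "continuous_on (sphere 0 \<rho>) (\<lambda>z. - deriv L z)"
    using U by (intro continuous_intros holomorphic_on_imp_continuous_on
      holomorphic_on_subset[OF holomorphic_deriv[OF L U(1)]]) auto
  have "deriv (\<lambda>s. circle_int \<theta> \<rho> s (\<lambda>z. - deriv L z)) 0 =
      integral {\<theta> - 2 * pi..\<theta>} (\<lambda>\<phi>. w \<phi> * ((\<i> * rcis \<rho>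
          \<phi>) * deriv L (rcis \<rho> \<phi>)))"
    unfolding circle_int_holomorphic(3)[OF \<rho> C]
    by (rule integral_cong) (simp add: w_def polar_power_def algebra_simps)
  then show "deriv (\<lambda>s. circle_int \<theta> \<rho> s (\<lambda>z. - deriv L z)) 0 = 2 *
      of_real pi * \<i> * (L (rcis \<rho> \<theta>) - L 0)"
    using integral_unique[OF int] by simp
qed

section \<open>The logarithm and the cut region\<close>

lemma arg_cut_exp:
  assumes "\<theta> - 2 * pi \<le> Im u" "Im u < \<theta>"
  shows "arg_cut \<theta> (exp u) = Im u"
proof -
  have "Arg2pi (exp u * cis (- \<theta>)) = Im u - \<theta> + 2 * pi"
  proof (rule Arg2pi_unique)
    have "exp (\<i> * complex_of_real (Im u - \<theta> + 2 * pi)) = exp (\<i> * of_real (Im u)) *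
        cis (- \<theta>)"
      by (simp add: cis_conv_exp exp_add[symmetric] exp_diff exp_minus algebra_simps)
         (simp add: exp_add exp_diff exp_minus field_simps exp_two_pi_i' mult.commute)
    then show "complex_of_real (exp (Re u)) * exp (\<i> * complex_of_real (Im u - \<theta> + 2 *
        pi)) = exp u * cis (- \<theta>)"
      by (subst (3) complex_eq) (simp add: exp_add exp_of_real mult_ac)
  qed (use assms in auto)
  then show ?thesis by (simp add: arg_cut_def)
qed

lemma log_cut_exp:
  "\<theta> - 2 * pi \<le> Im u \<Longrightarrow> Im u < \<theta> \<Longrightarrow> log_cut
      \<theta> (exp u) = u"
  by (simp add: log_cut_def arg_cut_exp complex_eq_iff)

lemma pow_cut_exp:
  "\<theta> - 2 * pi \<le> Im u \<Longrightarrow> Im u < \<theta> \<Longrightarrow> pow_cut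
      \<theta> (exp u) a = exp (of_real a * u)"
  by (simp add: pow_cut_def log_cut_exp)

lemma exp_log_cut:
  assumes "z \<noteq> 0" shows "exp (log_cut \<theta> z) = z"
proof -
  have "exp (log_cut \<theta> z) = rcis (cmod z) (arg_cut \<theta> z)"
    using assms by (simp add: log_cut_def Complex_eq exp_add exp_of_real rcis_def cis_conv_exp)
  then show ?thesis using arg_cut(3)[of z \<theta>] by simp
qed

text \<open>On the ray the argument of -\<lambda> is \<theta> - \<pi>, the midpoint of the branch
  interval. So u = log(-\<lambda>) is a smooth coordinate near the ray, although \<lambda> itself
  lies on the cut.\<close>

lemma minus_rcis_eq_exp: "r > 0 \<Longrightarrow> - rcis r \<theta> = exp (Complex (ln r) (\<theta>
    - pi))"
proof -
  assume "r > 0"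
  have "exp (Complex (ln r) (\<theta> - pi)) = of_real r * cis (\<theta> - pi)"
    using \<open>r > 0\<close> by (simp add: Complex_eq exp_add exp_of_real cis_conv_exp)
  also have "cis (\<theta> - pi) = - cis \<theta>" by (simp add: cis_divide[symmetric])
  finally show ?thesis by (simp add: rcis_def)
qed

lemma minus_exp_times_cis: "- exp u * cis (- \<theta>) = rcis (exp (Re u)) (Im u - (\<theta> - pi))"
proof -
  have "cis (Im u - (\<theta> - pi)) = cis (Im u) * cis (- \<theta>) * cis pi"
    by (simp only: cis_mult) (simp add: algebra_simps)
  moreover have "exp u = of_real (exp (Re u)) * cis (Im u)"
    by (simp add: exp_eq_polar)
  ultimately show ?thesis by (simp add: rcis_def mult.assoc)
qed

text \<open>The absolute value absorbs the boundary case y = -\<pi>, where \<open>Arg\<close>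
  returns \<pi>.\<close>

lemma abs_Arg_rcis:
  assumes "r > 0" "\<bar>y\<bar> \<le> pi"
  shows "\<bar>Arg (rcis r y)\<bar> = \<bar>y\<bar>"
proof (cases "y = - pi")
  case True
  have "cis (- pi) = - 1" by (simp add: complex_eq_iff)
  then have "rcis r y = of_real (- r)" by (simp add: True rcis_def)
  then show ?thesis using assms True by (simp only: Arg_of_real) simp
next
  case False
  then show ?thesis using assms by (subst Arg_rcis) auto
qed

lemma minus_exp_in_cut_region:
  assumes "\<bar>Im u - (\<theta> - pi)\<bar> < \<delta>" "\<bar>Im u - (\<theta> - pi)\<bar> \<le>
      pi"
  shows "- exp u \<in> cut_region \<theta> \<delta> \<rho>"
proof -
  have "\<bar>Arg (- exp u * cis (- \<theta>))\<bar> < \<delta>"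
    unfolding minus_exp_times_cis using assms by (simp add: abs_Arg_rcis)
  then show ?thesis by (simp add: cut_region_def)
qed

text \<open>The lower bound on |z| excludes the disc, so z lies in the sector. In the coordinate u =
  log(-z) the sector is a horizontal strip about Im u = \<theta> - \<pi>, of half width \<delta> or,
  if that is larger, confined to the branch interval.\<close>

lemma cut_region_log:
  assumes "z \<in> cut_region \<theta> \<delta> \<rho>" "\<rho> \<le> cmod z" "z \<noteq> 0"
  shows "\<bar>Im (log_cut \<theta> (- z)) - (\<theta> - pi)\<bar> < \<delta>" "\<bar>Im (log_cut
      \<theta> (- z)) - (\<theta> - pi)\<bar> \<le> pi"
    "\<theta> - 2 * pi \<le> Im (log_cut \<theta> (- z))" "Im (log_cut \<theta> (- z)) < \<theta>"
        "- exp (log_cut \<theta> (- z)) = z"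
    "Re (log_cut \<theta> (- z)) = ln (cmod z)"
proof -
  define u where "u = log_cut \<theta> (- z)"
  show r: "\<theta> - 2 * pi \<le> Im (log_cut \<theta> (- z))" "Im (log_cut \<theta> (- z)) <
      \<theta>"
    using arg_cut(1,2)[of \<theta> "- z"] by (auto simp: log_cut_def)
  then show "\<bar>Im (log_cut \<theta> (- z)) - (\<theta> - pi)\<bar> \<le> pi" by linarith
  show z: "- exp (log_cut \<theta> (- z)) = z" using assms by (simp add: exp_log_cut)
  show "Re (log_cut \<theta> (- z)) = ln (cmod z)" by (simp add: log_cut_def)
  have A: "\<bar>Arg (z * cis (- \<theta>))\<bar> < \<delta>"
    using assms by (auto simp: cut_region_def)
  define y where "y = Im u - (\<theta> - pi)"
  have y: "- pi \<le> y" "y < pi" using r by (auto simp: y_def u_def)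
  have "z * cis (- \<theta>) = rcis (exp (Re u)) y"
    using minus_exp_times_cis[of u \<theta>] z by (simp add: u_def y_def)
  moreover have "\<bar>Arg (rcis (exp (Re u)) y)\<bar> = \<bar>y\<bar>"
    using y by (intro abs_Arg_rcis) auto
  ultimately show "\<bar>Im (log_cut \<theta> (- z)) - (\<theta> - pi)\<bar> < \<delta>"
    using A by (simp add: y_def u_def)
qed

lemma rcis_in_cut_region:
  assumes "r > 0" "\<delta> > 0"
  shows "rcis r \<theta> \<in> cut_region \<theta> \<delta> \<rho>"
proof -
  have "rcis r \<theta> = - exp (Complex (ln r) (\<theta> - pi))"
    using minus_rcis_eq_exp[OF assms(1)] by (metis minus_minus)
  then show ?thesis
    using minus_exp_in_cut_region[of "Complex (ln r) (\<theta> - pi)" \<theta> \<delta> \<rho>]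
        assms(2) by simp
qed

lemma contour_set_subset_cut_region:
  assumes "\<delta> > 0" "0 < \<rho>" "\<rho> < \<rho>\<^sub>0"
  shows "contour_set \<theta> \<rho> \<subseteq> cut_region \<theta> \<delta> \<rho>\<^sub>0"
proof -
  have "rcis r \<theta> \<in> cut_region \<theta> \<delta> \<rho>\<^sub>0" if "r \<ge> \<rho>" for r
    by (rule rcis_in_cut_region) (use assms that in auto)
  moreover have "z \<in> cut_region \<theta> \<delta> \<rho>\<^sub>0" if "z \<in> sphere 0 \<rho>"
      for z
    using assms that by (simp add: cut_region_def)
  ultimately show ?thesis unfolding contour_set_def by blast
qed

section \<open>Estimates at infinity inside a region\<close>

lemma eventually_at_infinity_within:
  "eventually P (at_infinity_within \<Lambda>) \<longleftrightarrow> (\<exists>B.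
      \<forall>z\<in>\<Lambda>. B \<le> cmod z \<longrightarrow> P z)"
  unfolding at_infinity_within_def eventually_inf_principal eventually_at_infinity by blast

lemma bigo_at_infinity_within:
  assumes "(\<lambda>z. cmod (h z)) \<in> O[at_infinity_within \<Lambda>](\<lambda>z. cmod z powr
      e)"
  shows "\<exists>B C. \<forall>z\<in>\<Lambda>. B \<le> cmod z \<longrightarrow> cmod (h z) \<le>
      C * cmod z powr e"
proof -
  obtain C where "eventually (\<lambda>z. norm (cmod (h z)) \<le> C * norm (cmod z powr e))
      (at_infinity_within \<Lambda>)"
    using landau_o.bigE[OF assms] by blast
  then obtain B where "\<forall>z\<in>\<Lambda>. B \<le> cmod z \<longrightarrow> norm (cmod (h z))
      \<le> C * norm (cmod z powr e)"
    unfolding eventually_at_infinity_within ..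
  then show ?thesis by (intro exI[of _ B] exI[of _ C]) simp
qed

section \<open>Expansions along the ray\<close>

text \<open>On the ray log(-\<lambda>) = ln r + i(\<theta> - \<pi>), so a logarithmic term also
  contributes to the pure power. The factor cis \<theta> comes from d\<lambda> = cis \<theta>
  dr.\<close>

definition ray_coeff_A :: "real \<Rightarrow> (nat \<Rightarrow> real) \<Rightarrow> (nat
    \<Rightarrow> nat \<Rightarrow> complex) \<Rightarrow> nat \<Rightarrow> complex" where
  "ray_coeff_A \<theta> \<beta> c j =
     cis \<theta> * exp (- of_real (\<beta> j) * (\<i> * of_real (\<theta> - pi))) * (c j 0 + \<i>
         * of_real (\<theta> - pi) * c j 1)"

definition ray_coeff_B :: "real \<Rightarrow> (nat \<Rightarrow> real) \<Rightarrow> (nat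
    \<Rightarrow> nat \<Rightarrow> complex) \<Rightarrow> nat \<Rightarrow> complex" where
  "ray_coeff_B \<theta> \<beta> c j = cis \<theta> * exp (- of_real (\<beta> j) * (\<i> * of_real
      (\<theta> - pi))) * c j 1"

lemma power_log_sum_ray:
  assumes "r > 0"
  shows "cis \<theta> * (\<Sum>j\<in>I. \<Sum>k\<le>1. c j k * pow_cut \<theta> (- rcis r \<theta>)
      (- \<beta> j) * log_cut \<theta> (- rcis r \<theta>) ^ k) =
    power_log_sum (\<lambda>j. 1 - \<beta> j) (ray_coeff_A \<theta> \<beta> c) (ray_coeff_B
        \<theta> \<beta> c) I r"
proof -
  have log: "log_cut \<theta> (- rcis r \<theta>) = of_real (ln r) + \<i> * of_real (\<theta> - pi)"
    unfolding minus_rcis_eq_exp[OF assms]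
    by (subst log_cut_exp) (auto simp: Complex_eq)
  have pow: "pow_cut \<theta> (- rcis r \<theta>) (- \<beta> j) = of_real (r powr (1 - \<beta> j -
      1)) * exp (- of_real (\<beta> j) * (\<i> * of_real (\<theta> - pi)))" for j
  proof -
    have "complex_of_real (r powr (1 - \<beta> j - 1)) = exp (of_real (- \<beta> j * ln r))"
      using assms by (simp only: powr_def exp_of_real) simp
    then show ?thesis
      unfolding pow_cut_def log by (simp add: exp_add[symmetric] algebra_simps)
  qed
  show ?thesis
    unfolding power_log_sum_def sum_distrib_left
    by (intro sum.cong refl)
       (simp add: log pow ray_coeff_A_def ray_coeff_B_def algebra_simps)
qed

text \<open>The bound, given for large |\<lambda>| in the sector, is moved to the whole half line by
  continuity. It is stated for all large N since N will have to satisfy further conditions at the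
  same time.\<close>

lemma log_expansion_ray:
  assumes exp: "log_expansion \<theta> (cut_region \<theta> \<delta> \<rho>\<^sub>0) f \<beta> c
      (\<lambda>_. 0)" and \<delta>: "\<delta> > 0" and \<rho>: "\<rho> > 0"
    and cont: "continuous_on {\<rho>..} (\<lambda>r. f (rcis r \<theta>))"
  shows "\<forall>\<^sub>F N in sequentially. \<exists>C. \<forall>r\<ge>\<rho>. norm (cis \<theta>
      * f (rcis r \<theta>) -
     power_log_sum (\<lambda>j. 1 - \<beta> j) (ray_coeff_A \<theta> \<beta> c) (ray_coeff_B
         \<theta> \<beta> c) {..<N} r) \<le> C * r powr (\<sigma> - 1)"
proof -
  have "\<forall>\<^sub>F N in sequentially. (\<lambda>z. cmod (f z - (\<Sum>j<N. \<Sum>k\<le>1. c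
      j k * pow_cut \<theta> (- z) (- \<beta> j) * log_cut \<theta> (- z) ^ k) - 0))
          \<in> O[at_infinity_within (cut_region \<theta> \<delta> \<rho>\<^sub>0)](\<lambda>z.
              cmod z powr (- \<beta> N + 1))"
    using exp unfolding log_expansion_def by simp
  \<comment> \<open>The loss \<epsilon> was fixed to 1 above, so this makes the remainder exponent
    -\<beta> N + 1 at most \<sigma> - 1.\<close>
  moreover have "\<forall>\<^sub>F N in sequentially. \<beta> N \<ge> 2 - \<sigma>"
    using exp unfolding log_expansion_def filterlim_at_top by blast
  ultimately show ?thesis
  proof eventually_elim
    case (elim N)
    obtain B C where CB: "\<forall>z\<in>cut_region \<theta> \<delta> \<rho>\<^sub>0. B \<le> cmod
        z \<longrightarrow>
        cmod (f z - (\<Sum>j<N. \<Sum>k\<le>1. c j k * pow_cut \<theta> (- z) (- \<beta> j) *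
            log_cut \<theta> (- z) ^ k)) \<le> C * cmod z powr (- \<beta> N + 1)"
      using bigo_at_infinity_within[OF elim(1)[unfolded diff_zero]] by (elim exE)
    define g where "g r = cis \<theta> * f (rcis r \<theta>) -
       power_log_sum (\<lambda>j. 1 - \<beta> j) (ray_coeff_A \<theta> \<beta> c) (ray_coeff_B
           \<theta> \<beta> c) {..<N} r" for r
    have g_le: "eventually (\<lambda>r. norm (g r) \<le> \<bar>C\<bar> * r powr (\<sigma> - 1))
        at_top"
      using eventually_ge_at_top[of "max B 1"]
    proof eventually_elim
      case (elim r)
      then have r: "r > 0" "r \<ge> 1" "r \<ge> B" by auto
      have "g r = cis \<theta> * (f (rcis r \<theta>) - (\<Sum>j<N. \<Sum>k\<le>1. c j k * pow_cut
          \<theta> (- rcis r \<theta>) (- \<beta> j) * log_cut \<theta> (- rcis r \<theta>) ^ k))"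
        unfolding g_def right_diff_distrib power_log_sum_ray[OF r(1)] ..
      then have "norm (g r) \<le> C * r powr (- \<beta> N + 1)"
        using CB[rule_format, OF rcis_in_cut_region[OF r(1) \<delta>]] r by (simp add: norm_mult)
      also have "\<dots> \<le> \<bar>C\<bar> * r powr (\<sigma> - 1)"
        using r \<open>\<beta> N \<ge> 2 - \<sigma>\<close> by (intro mult_mono powr_mono) auto
      finally show ?case .
    qed
    have cg: "continuous_on {\<rho>..} g"
      unfolding g_def by (intro continuous_intros cont continuous_on_power_log_sum \<rho>)
    have cp: "continuous_on {\<rho>..} (\<lambda>r. r powr (\<sigma> - 1))"
      using \<rho> by (auto intro!: continuous_intros)
    have "r powr (\<sigma> - 1) > 0" if "r \<ge> \<rho>" for r using that \<rho> by simp
    from bounded_on_halfline[OF cg cp this g_le]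
    show ?case unfolding g_def by meson
  qed
qed

section \<open>Uniqueness of the regularized limit\<close>

lemma linear_exp_tendsto_0:
  assumes "d < (0::real)"
  shows "((\<lambda>x. (P + Q * Complex x c) * exp (of_real d * Complex x c)) \<longlongrightarrow>
      0) at_top"
proof (rule Lim_null_comparison)
  show "((\<lambda>x. (cmod P + cmod Q * (x + \<bar>c\<bar>)) * exp (d * x)) \<longlongrightarrow>
      0) at_top"
    using assms by real_asymp
  show "eventually (\<lambda>x. norm ((P + Q * Complex x c) * exp (of_real d * Complex x c)) \<le>
      (cmod P + cmod Q * (x + \<bar>c\<bar>)) * exp (d * x)) at_top"
    using eventually_ge_at_top[of 0]
  proof eventually_elim
    case (elim x)
    have "norm (P + Q * Complex x c) \<le> cmod P + cmod Q * cmod (Complex x c)"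
      by (metis norm_mult norm_triangle_ineq)
    also have "\<dots> \<le> cmod P + cmod Q * (x + \<bar>c\<bar>)"
      using cmod_le[of "Complex x c"] elim by (intro add_left_mono mult_left_mono) auto
    finally show ?case by (simp add: norm_mult mult_right_mono)
  qed
qed

text \<open>Dividing by the exponential of the largest exponent b keeps the limit 0, as b >= 0, and
  makes all other terms decay. So P b + Q b u tends to 0, both coefficients vanish, and the next
  exponent is treated. Terms with negative exponents decay by themselves, hence the restriction to
  \<gamma> >= 0.\<close>

lemma exp_poly_tendsto_0:
  fixes \<Gamma> :: "real set"
  assumes "finite \<Gamma>"
    and "((\<lambda>x. \<Sum>\<gamma>\<in>\<Gamma>. (P \<gamma> + Q \<gamma> * Complex x c) * exp
        (of_real \<gamma> * Complex x c)) \<longlongrightarrow> 0) at_top"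
    and "\<gamma> \<in> \<Gamma>" "\<gamma> \<ge> 0"
  shows "P \<gamma> = 0 \<and> Q \<gamma> = 0"
  using assms
proof (induction \<Gamma> rule: finite_linorder_max_induct)
  case (insert b A)
  define F where "F x = (\<Sum>\<gamma>\<in>insert b A. (P \<gamma> + Q \<gamma> * Complex x c) *
      exp (of_real \<gamma> * Complex x c))" for x
  have F: "(F \<longlongrightarrow> 0) at_top" using insert.prems(1) by (simp add: F_def[abs_def])
  have b: "b \<ge> 0" using insert.prems insert.hyps(2) by force
  have "b \<notin> A" using insert.hyps(2) by auto
  have small: "((\<lambda>x. \<Sum>\<gamma>\<in>A. (P \<gamma> + Q \<gamma> * Complex x c) * exp
      (of_real (\<gamma> - b) * Complex x c)) \<longlongrightarrow> 0) at_top"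
    using insert.hyps(2) by (intro tendsto_null_sum linear_exp_tendsto_0) auto
  have "((\<lambda>x. F x * exp (- of_real b * Complex x c)) \<longlongrightarrow> 0) at_top"
  proof (rule Lim_null_comparison)
    show "((\<lambda>x. norm (F x)) \<longlongrightarrow> 0) at_top" using F by (rule
        tendsto_norm_zero)
    show "eventually (\<lambda>x. norm (F x * exp (- of_real b * Complex x c)) \<le> norm (F x))
        at_top"
      using eventually_ge_at_top[of 0]
      by eventually_elim (use b in \<open>auto simp: norm_mult intro!: mult_left_le\<close>)
  qed
  moreover have "F x * exp (- of_real b * Complex x c) = (P b + Q b * Complex x c) +
      (\<Sum>\<gamma>\<in>A. (P \<gamma> + Q \<gamma> * Complex x c) * exp (of_real (\<gamma> - b)
          * Complex x c))" for x
  proof -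
    have "exp (of_real \<gamma> * Complex x c) * exp (- of_real b * Complex x c) = exp (of_real
        (\<gamma> - b) * Complex x c)" for \<gamma>
      by (simp add: exp_add[symmetric] algebra_simps)
    then have *: "F x * exp (- of_real b * Complex x c) =
        (\<Sum>\<gamma>\<in>insert b A. (P \<gamma> + Q \<gamma> * Complex x c) * exp (of_real
            (\<gamma> - b) * Complex x c))"
      unfolding F_def sum_distrib_right by (simp add: mult.assoc)
    show ?thesis unfolding * using \<open>b \<notin> A\<close> insert.hyps(1) by simp
  qed
  ultimately have "((\<lambda>x. (P b + Q b * Complex x c) +
      (\<Sum>\<gamma>\<in>A. (P \<gamma> + Q \<gamma> * Complex x c) * exp (of_real (\<gamma> - b)
          * Complex x c))) \<longlongrightarrow> 0) at_top"
    by simp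
  from tendsto_diff[OF this small] have lin: "((\<lambda>x. P b + Q b * Complex x c)
      \<longlongrightarrow> 0) at_top" by simp
  \<comment> \<open>Division by x isolates Q b; only afterwards is the remaining expression the
    constant P b.\<close>
  have "((\<lambda>x. (P b + Q b * Complex x c) / of_real x) \<longlongrightarrow> 0) at_top"
    using tendsto_mult[OF lin tendsto_of_real[OF tendsto_inverse_0_at_top[OF filterlim_ident]]]
    by (simp add: divide_inverse)
  moreover have "((\<lambda>x. (P b + Q b * Complex x c) / of_real x) \<longlongrightarrow> Q b)
      at_top"
  proof -
    have "((\<lambda>x. (P b + Q b * \<i> * of_real c) * of_real (inverse x) + Q b)
        \<longlongrightarrow> (P b + Q b * \<i> * of_real c) * of_real 0 + Q b) at_top"
      by (intro tendsto_intros tendsto_inverse_0_at_top filterlim_ident)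
    moreover have "eventually (\<lambda>x. (P b + Q b * \<i> * of_real c) * of_real (inverse x) + Q
        b = (P b + Q b * Complex x c) / of_real x) at_top"
      using eventually_gt_at_top[of 0]
      by eventually_elim (simp add: Complex_eq field_simps)
    ultimately show ?thesis using tendsto_cong by fastforce
  qed
  ultimately have Q: "Q b = 0" using tendsto_unique trivial_limit_at_top_linorder by blast
  then have P: "P b = 0" using lin by (simp add: tendsto_const_iff)
  have "((\<lambda>x. \<Sum>\<gamma>\<in>A. (P \<gamma> + Q \<gamma> * Complex x c) * exp (of_real
      \<gamma> * Complex x c)) \<longlongrightarrow> 0) at_top"
    using insert.prems(1) \<open>b \<notin> A\<close> insert.hyps(1) P Q by simp
  then show ?case using insert.IH insert.prems P Q by blast
qed auto

text \<open>With r = exp x the powers of -\<lambda> become exponentials in u = x + i(\<theta> -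
  \<pi>), and with \<epsilon> = 1 and \<beta> N >= 2 the remainder decays at least like
  exp(-x).\<close>

lemma log_expansion_ray_tendsto:
  assumes exp: "log_expansion \<theta> (cut_region \<theta> \<delta> \<rho>\<^sub>0) f \<beta> c
      (\<lambda>z. c0 * log_cut \<theta> (- z) + c1)" and \<delta>: "\<delta> > 0"
  obtains N where "((\<lambda>x. f (rcis (exp x) \<theta>) - (\<Sum>j<N. (c j 0 + c j 1 * Complex x
      (\<theta> - pi)) * exp (of_real (- \<beta> j) * Complex x (\<theta> - pi)))
      - (c0 * Complex x (\<theta> - pi) + c1)) \<longlongrightarrow> 0) at_top"
proof -
  have "\<forall>\<^sub>F N in sequentially. (\<lambda>z. cmod (f z - (\<Sum>j<N. \<Sum>k\<le>1. c
      j k * pow_cut \<theta> (- z) (- \<beta> j) * log_cut \<theta> (- z) ^ k) - (c0 * log_cut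
      \<theta> (- z) + c1)))
          \<in> O[at_infinity_within (cut_region \<theta> \<delta> \<rho>\<^sub>0)](\<lambda>z.
              cmod z powr (- \<beta> N + 1))"
    using exp unfolding log_expansion_def by simp
  moreover have "\<forall>\<^sub>F N in sequentially. \<beta> N \<ge> 2"
    using exp unfolding log_expansion_def filterlim_at_top by blast
  ultimately have "\<forall>\<^sub>F N in sequentially. (\<lambda>z. cmod (f z - (\<Sum>j<N.
      \<Sum>k\<le>1. c j k * pow_cut \<theta> (- z) (- \<beta> j) * log_cut \<theta> (- z) ^ k) -
      (c0 * log_cut \<theta> (- z) + c1)))
          \<in> O[at_infinity_within (cut_region \<theta> \<delta> \<rho>\<^sub>0)](\<lambda>z.
              cmod z powr (- \<beta> N + 1)) \<and> \<beta> N \<ge> 2"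
    by (rule eventually_conj)
  then obtain N where N: "(\<lambda>z. cmod (f z - (\<Sum>j<N. \<Sum>k\<le>1. c j k * pow_cut
      \<theta> (- z) (- \<beta> j) * log_cut \<theta> (- z) ^ k) - (c0 * log_cut \<theta> (- z) +
      c1)))
          \<in> O[at_infinity_within (cut_region \<theta> \<delta> \<rho>\<^sub>0)](\<lambda>z.
              cmod z powr (- \<beta> N + 1))" "\<beta> N \<ge> 2"
    by (auto simp: eventually_sequentially)
  obtain B C where CB: "\<forall>z\<in>cut_region \<theta> \<delta> \<rho>\<^sub>0. B \<le> cmod z
      \<longrightarrow>
      cmod (f z - (\<Sum>j<N. \<Sum>k\<le>1. c j k * pow_cut \<theta> (- z) (- \<beta> j) * log_cut
          \<theta> (- z) ^ k) - (c0 * log_cut \<theta> (- z) + c1))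
        \<le> C * cmod z powr (- \<beta> N + 1)"
    using bigo_at_infinity_within[OF N(1)] by (elim exE)
  show ?thesis
  proof (rule that[of N], rule Lim_null_comparison)
    show "((\<lambda>x. C * exp ((- \<beta> N + 1) * x)) \<longlongrightarrow> 0) at_top"
      using N(2) by real_asymp
    show "eventually (\<lambda>x. norm (f (rcis (exp x) \<theta>) - (\<Sum>j<N. (c j 0 + c j 1 *
        Complex x (\<theta> - pi)) * exp (of_real (- \<beta> j) * Complex x (\<theta> - pi)))
      - (c0 * Complex x (\<theta> - pi) + c1)) \<le> C * exp ((- \<beta> N + 1) * x)) at_top"
      using eventually_ge_at_top[of "ln (max B 1)"]
    proof eventually_elim
      case (elim x)
      then have "B \<le> exp x" by (smt (verit) exp_ln exp_le_cancel_iff)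
      then have *: "B \<le> cmod (rcis (exp x) \<theta>)" by simp
      have z: "- rcis (exp x) \<theta> = exp (Complex x (\<theta> - pi))"
        using minus_rcis_eq_exp[of "exp x" \<theta>] by simp
      have "(\<Sum>j<N. \<Sum>k\<le>1. c j k * pow_cut \<theta> (- rcis (exp x) \<theta>) (-
          \<beta> j) * log_cut \<theta> (- rcis (exp x) \<theta>) ^ k) =
          (\<Sum>j<N. (c j 0 + c j 1 * Complex x (\<theta> - pi)) * exp (of_real (- \<beta> j) *
              Complex x (\<theta> - pi)))"
        unfolding z by (simp add: pow_cut_exp log_cut_exp algebra_simps)
      moreover have "log_cut \<theta> (- rcis (exp x) \<theta>) = Complex x (\<theta> - pi)"
        unfolding z by (simp add: log_cut_exp)
      ultimately show ?case
        using CB[rule_format, OF rcis_in_cut_region[OF exp_gt_zero \<delta>] *] by (simp add: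
            powr_def)
    qed
  qed
qed

text \<open>The difference of the two expansions on the ray is an exponential polynomial tending to
  0. As no \<beta> j vanishes in either of them, its constant coefficient at exponent 0 is c1' -
  c1.\<close>

lemma reg_limit_unique:
  assumes 1: "log_expansion \<theta> (cut_region \<theta> \<delta> \<rho>\<^sub>0) f \<beta> c
      (\<lambda>z. c0 * log_cut \<theta> (- z) + c1)" "\<And>j. \<beta> j \<noteq> 0"
    and 2: "log_expansion \<theta> (cut_region \<theta> \<delta> \<rho>\<^sub>0) f \<beta>' c'
        (\<lambda>z. c0' * log_cut \<theta> (- z) + c1')" "\<And>j. \<beta>' j \<noteq> 0"
    and \<delta>: "\<delta> > 0"
  shows "c1 = c1'"
proof -
  define u where "u x = Complex x (\<theta> - pi)" for x
  obtain N where N: "((\<lambda>x. f (rcis (exp x) \<theta>) - (\<Sum>j<N. (c j 0 + c j 1 * u x) *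
      exp (of_real (- \<beta> j) * u x))
      - (c0 * u x + c1)) \<longlongrightarrow> 0) at_top"
    using log_expansion_ray_tendsto[OF 1(1) \<delta>] unfolding u_def by blast
  obtain N' where N': "((\<lambda>x. f (rcis (exp x) \<theta>) - (\<Sum>j<N'. (c' j 0 + c' j 1 * u
      x) * exp (of_real (- \<beta>' j) * u x))
      - (c0' * u x + c1')) \<longlongrightarrow> 0) at_top"
    using log_expansion_ray_tendsto[OF 2(1) \<delta>] unfolding u_def by blast
  define \<Gamma> where "\<Gamma> = insert 0 ((\<lambda>j. - \<beta> j) ` {..<N} \<union>
      (\<lambda>j. - \<beta>' j) ` {..<N'})"
  \<comment> \<open>Exponents of the two expansions may coincide, so the coefficients are collected
    per exponent before comparison.\<close>
  define S where "S b c N k \<gamma> = (\<Sum>j\<in>{j\<in>{..<N}. - b j = \<gamma>}. c j k)" for b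
      :: "nat \<Rightarrow> real" and c :: "nat \<Rightarrow> nat \<Rightarrow> complex" and N k
      \<gamma>
  have group: "(\<Sum>j<n. (a j 0 + a j 1 * u x) * exp (of_real (- b j) * u x)) =
      (\<Sum>\<gamma>\<in>\<Gamma>. (S b a n 0 \<gamma> + S b a n 1 \<gamma> * u x) * exp (of_real
      \<gamma> * u x))"
    if "(\<lambda>j. - b j) ` {..<n} \<subseteq> \<Gamma>" for a b n x
  proof -
    have "(\<Sum>j<n. (a j 0 + a j 1 * u x) * exp (of_real (- b j) * u x)) =
        (\<Sum>\<gamma>\<in>\<Gamma>. \<Sum>j\<in>{j\<in>{..<n}. - b j = \<gamma>}. (a j 0 + a j 1
            * u x) * exp (of_real (- b j) * u x))"
      by (rule sum.group[symmetric]) (use that in \<open>auto simp: \<Gamma>_def\<close>)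
    also have "\<dots> = (\<Sum>\<gamma>\<in>\<Gamma>. (S b a n 0 \<gamma> + S b a n 1 \<gamma> * u
        x) * exp (of_real \<gamma> * u x))"
      unfolding S_def sum_distrib_right sum.distrib[symmetric] by (intro sum.cong refl) auto
    finally show ?thesis .
  qed
  define P where "P \<gamma> = S \<beta>' c' N' 0 \<gamma> - S \<beta> c N 0 \<gamma> + (if
      \<gamma> = 0 then c1' - c1 else 0)" for \<gamma>
  define Q where "Q \<gamma> = S \<beta>' c' N' 1 \<gamma> - S \<beta> c N 1 \<gamma> + (if
      \<gamma> = 0 then c0' - c0 else 0)" for \<gamma>
  have fin: "finite \<Gamma>" by (simp add: \<Gamma>_def)
  have "(\<Sum>\<gamma>\<in>\<Gamma>. (P \<gamma> + Q \<gamma> * u x) * exp (of_real \<gamma> * u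
      x)) =
      (\<Sum>j<N'. (c' j 0 + c' j 1 * u x) * exp (of_real (- \<beta>' j) * u x)) - (\<Sum>j<N. (c j
          0 + c j 1 * u x) * exp (of_real (- \<beta> j) * u x))
      + ((c1' - c1) + (c0' - c0) * u x)" for x
  proof -
    have "(\<Sum>\<gamma>\<in>\<Gamma>. (P \<gamma> + Q \<gamma> * u x) * exp (of_real \<gamma> * u
        x)) =
        (\<Sum>\<gamma>\<in>\<Gamma>. (S \<beta>' c' N' 0 \<gamma> + S \<beta>' c' N' 1 \<gamma> *
            u x) * exp (of_real \<gamma> * u x)) -
        (\<Sum>\<gamma>\<in>\<Gamma>. (S \<beta> c N 0 \<gamma> + S \<beta> c N 1 \<gamma> * u x) *
            exp (of_real \<gamma> * u x)) +
        (\<Sum>\<gamma>\<in>\<Gamma>. if \<gamma> = 0 then (c1' - c1) + (c0' - c0) * u x else 0)"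
      unfolding sum_subtractf[symmetric] sum.distrib[symmetric]
      by (intro sum.cong refl) (simp add: P_def Q_def algebra_simps)
    also have "(\<Sum>\<gamma>\<in>\<Gamma>. if \<gamma> = 0 then (c1' - c1) + (c0' - c0) * u x
        else 0) = (c1' - c1) + (c0' - c0) * u x"
      using fin by (simp add: \<Gamma>_def)
    moreover have "(\<lambda>j. - \<beta> j) ` {..<N} \<subseteq> \<Gamma>" "(\<lambda>j. -
        \<beta>' j) ` {..<N'} \<subseteq> \<Gamma>"
      by (auto simp: \<Gamma>_def)
    ultimately show ?thesis by (simp only: group)
  qed
  then have "(\<lambda>x. \<Sum>\<gamma>\<in>\<Gamma>. (P \<gamma> + Q \<gamma> * u x) * exp
      (of_real \<gamma> * u x)) =
      (\<lambda>x. (f (rcis (exp x) \<theta>) - (\<Sum>j<N. (c j 0 + c j 1 * u x) * exp (of_real (-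
          \<beta> j) * u x)) - (c0 * u x + c1)) -
        (f (rcis (exp x) \<theta>) - (\<Sum>j<N'. (c' j 0 + c' j 1 * u x) * exp (of_real (-
            \<beta>' j) * u x)) - (c0' * u x + c1')))"
    by (intro ext) (simp add: left_diff_distrib)
  then have "((\<lambda>x. \<Sum>\<gamma>\<in>\<Gamma>. (P \<gamma> + Q \<gamma> * u x) * exp
      (of_real \<gamma> * u x)) \<longlongrightarrow> 0) at_top"
    using tendsto_diff[OF N N'] by (simp only: diff_0_right)
  then have "P 0 = 0"
    using exp_poly_tendsto_0[OF fin, of P Q "\<theta> - pi" 0] by (simp add: u_def \<Gamma>_def)
  moreover have "S \<beta> c N k 0 = 0" "S \<beta>' c' N' k 0 = 0" for k
    using 1(2) 2(2) by (auto simp: S_def)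
  ultimately show ?thesis by (simp add: P_def)
qed

lemma reg_limit_eqI:
  assumes "log_expansion \<theta> (cut_region \<theta> \<delta> \<rho>\<^sub>0) f \<beta> c
      (\<lambda>z. c0 * log_cut \<theta> (- z) + c1)" "\<And>j. \<beta> j \<noteq> 0"
    and "\<delta> > 0"
  shows "reg_limit \<theta> (cut_region \<theta> \<delta> \<rho>\<^sub>0) f = c1"
  unfolding reg_limit_def
proof (rule the_equality)
  show "\<exists>\<beta> c c0. (\<forall>j. \<beta> j \<noteq> 0) \<and> log_expansion \<theta>
      (cut_region \<theta> \<delta> \<rho>\<^sub>0) f \<beta> c (\<lambda>z. c0 * log_cut \<theta>
      (- z) + c1)"
    using assms by blast
  show "c1' = c1" if "\<exists>\<beta> c c0. (\<forall>j. \<beta> j \<noteq> 0) \<and>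
      log_expansion \<theta> (cut_region \<theta> \<delta> \<rho>\<^sub>0) f \<beta> c (\<lambda>z.
      c0 * log_cut \<theta> (- z) + c1')" for c1'
    using that reg_limit_unique[OF _ _ assms] by blast
qed

section \<open>Integrating the expansion\<close>

text \<open>For \<delta> <= \<pi> the rotated sector avoids the negative axis, where
  \<open>Arg\<close> jumps; for larger \<delta> the sector is the punctured plane.\<close>

lemma open_cut_region: "open (cut_region \<theta> \<delta> \<rho>)"
proof -
  have "open {z. z \<noteq> 0 \<and> \<bar>Arg (z * cis (- \<theta>))\<bar> < \<delta>}"
  proof (cases "\<delta> \<le> pi")
    case True
    have nonpos: "w \<notin> \<real>\<^sub>\<le>\<^sub>0" if "w \<noteq> 0" "\<bar>Arg w\<bar> <
        \<delta>" for w
    proof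
      assume "w \<in> \<real>\<^sub>\<le>\<^sub>0"
      then obtain x where "w = of_real x" "x \<le> 0" by (auto elim: nonpos_Reals_cases)
      then show False using that True by (simp add: Arg_of_real split: if_splits)
    qed
    have "open ((\<lambda>z. z * cis (- \<theta>)) -` (- \<real>\<^sub>\<le>\<^sub>0))"
      by (intro open_vimage continuous_intros) (auto simp: closed_nonpos_Reals_complex)
    moreover have "continuous_on ((\<lambda>z. z * cis (- \<theta>)) -` (-
        \<real>\<^sub>\<le>\<^sub>0)) (\<lambda>z. \<bar>Im (Ln (z * cis (- \<theta>)))\<bar>)"
      by (intro continuous_intros) auto
    ultimately have "open ((\<lambda>z. z * cis (- \<theta>)) -` (- \<real>\<^sub>\<le>\<^sub>0)
        \<inter> (\<lambda>z. \<bar>Im (Ln (z * cis (- \<theta>)))\<bar>) -` {..<\<delta>})"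
      by (intro continuous_open_preimage) auto
    also have "(\<lambda>z. z * cis (- \<theta>)) -` (- \<real>\<^sub>\<le>\<^sub>0) \<inter>
        (\<lambda>z. \<bar>Im (Ln (z * cis (- \<theta>)))\<bar>) -` {..<\<delta>} =
        {z. z \<noteq> 0 \<and> \<bar>Arg (z * cis (- \<theta>))\<bar> < \<delta>}"
    proof -
      have "Arg w = Im (Ln w)" if "w \<notin> \<real>\<^sub>\<le>\<^sub>0" for w
        by (rule Arg_eq_Im_Ln) (use that in auto)
      then have "w \<notin> \<real>\<^sub>\<le>\<^sub>0 \<and> \<bar>Im (Ln w)\<bar> < \<delta>
          \<longleftrightarrow> w \<noteq> 0 \<and> \<bar>Arg w\<bar> < \<delta>" for w
        using nonpos[of w] by (cases "w \<in> \<real>\<^sub>\<le>\<^sub>0") auto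
      from this[of "_ * cis (- \<theta>)"] show ?thesis
        by (simp only: set_eq_iff Int_iff vimage_eq Compl_iff lessThan_iff mem_Collect_eq) simp
    qed
    finally show ?thesis .
  next
    case False
    have "{z. z \<noteq> 0 \<and> \<bar>Arg (z * cis (- \<theta>))\<bar> < \<delta>} = - {0}"
    proof safe
      fix z :: complex
      show "\<bar>Arg (z * cis (- \<theta>))\<bar> < \<delta>"
        using False Arg_bounded[of "z * cis (- \<theta>)"] by auto
    qed
    then show ?thesis by (simp only:) (rule open_Compl, simp)
  qed
  moreover have "open {z :: complex. cmod z < \<rho>}"
    by (intro open_Collect_less continuous_intros)
  ultimately show ?thesis unfolding cut_region_def by (intro open_Un)
qed

lemma filterlim_cmod_at_infinity_within: "filterlim cmod at_top (at_infinity_within \<Lambda>)"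
  unfolding at_infinity_within_def
  by (rule filterlim_mono[OF filterlim_norm_at_top order_refl]) simp

lemma at_infinity_within_cut_region_neq_bot:
  assumes "\<delta> > 0" shows "at_infinity_within (cut_region \<theta> \<delta> \<rho>) \<noteq>
      bot"
proof -
  have "\<not> eventually (\<lambda>_. False) (at_infinity_within (cut_region \<theta> \<delta>
      \<rho>))"
  proof
    assume "eventually (\<lambda>_. False) (at_infinity_within (cut_region \<theta> \<delta>
        \<rho>))"
    then obtain B where B: "\<And>z. z \<in> cut_region \<theta> \<delta> \<rho> \<Longrightarrow>
        B \<le> cmod z \<Longrightarrow> False"
      unfolding eventually_at_infinity_within by blast
    show False
      by (rule B[OF rcis_in_cut_region[of "\<bar>B\<bar> + 1" \<delta>]]) (use assms in auto)
  qed
  then show ?thesis by (auto simp: trivial_limit_def)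
qed

section \<open>The primitive of the expansion in the coordinate log(-\<lambda>)\<close>

locale log_primitive =
  fixes \<theta> \<delta> \<rho>\<^sub>0 \<rho> :: real and L :: "complex \<Rightarrow> complex"
      and \<alpha> :: "nat \<Rightarrow> real"
    and c b' :: "nat \<Rightarrow> nat \<Rightarrow> complex" and J :: nat
  assumes \<delta>: "\<delta> > 0" and \<rho>: "0 < \<rho>" "\<rho> < \<rho>\<^sub>0"
    and L: "L holomorphic_on cut_region \<theta> \<delta> \<rho>\<^sub>0"
    and expansion: "log_expansion \<theta> (cut_region \<theta> \<delta> \<rho>\<^sub>0)
        (\<lambda>z. - deriv L z) \<alpha> c (\<lambda>_. 0)"
    and J: "\<alpha> J = 1" "c J 1 = 0"
    and b'_0: "\<And>j. j \<noteq> J \<Longrightarrow> b' j 0 = c j 0 / of_real (1 - \<alpha> j) -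
        c j 1 / of_real ((1 - \<alpha> j)\<^sup>2)"
    and b'_1: "\<And>j. j \<noteq> J \<Longrightarrow> b' j 1 = c j 1 / of_real (1 - \<alpha> j)"
begin

abbreviation "\<Lambda> \<equiv> cut_region \<theta> \<delta> \<rho>\<^sub>0"

definition T :: "nat \<Rightarrow> complex \<Rightarrow> complex" where
  "T N u = (\<Sum>j<N. \<Sum>k\<le>1. c j k * exp (of_real (- \<alpha> j) * u) * u ^ k)"

definition primitive_term :: "nat \<Rightarrow> complex \<Rightarrow> complex" where
  "primitive_term j u = (\<Sum>k\<le>1. b' j k * exp (of_real (- \<alpha> j + 1) * u) * u ^ k)"

text \<open>With \<lambda> = -exp u the derivative of L(-exp u) in u is exp u times -L'(\<lambda>),
  so the expansion has to be multiplied by exp u and integrated in u. The exponent 1 integrates to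
  u, the origin of the term c0 log(-\<lambda>).\<close>

definition G :: "nat \<Rightarrow> complex \<Rightarrow> complex" where
  "G N u = c J 0 * u + (\<Sum>j\<in>{..<N} - {J}. primitive_term j u)"

definition Q :: "nat \<Rightarrow> complex \<Rightarrow> complex" where
  "Q N u = L (- exp u) - G N u"

definition ray_rem :: "nat \<Rightarrow> real \<Rightarrow> complex" where
  "ray_rem N r = cis \<theta> * (- deriv L (rcis r \<theta>)) -
     power_log_sum (\<lambda>j. 1 - \<alpha> j) (ray_coeff_A \<theta> \<alpha> c) (ray_coeff_B
         \<theta> \<alpha> c) {..<N} r"

text \<open>The limit of Q N along the ray: its value at radius \<rho> plus the integral of its
  derivative -\<open>ray_rem N\<close>. It appears to depend on N.\<close>

definition const :: "nat \<Rightarrow> complex" where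
  "const N = Q N (Complex (ln \<rho>) (\<theta> - pi)) - integral {\<rho>..} (ray_rem N)"

lemma strict_mono_\<alpha>: "strict_mono \<alpha>" and \<alpha>_at_top: "filterlim \<alpha> at_top
    sequentially"
  using expansion by (auto simp: log_expansion_def)

lemma \<alpha>_neq_1: "j \<noteq> J \<Longrightarrow> \<alpha> j \<noteq> 1"
  using strict_mono_eq[OF strict_mono_\<alpha>, of j J] J(1) by auto

text \<open>With g = 1 - \<alpha> j the coefficients b' solve g b'_1 = c_1 and g b'_0 + b'_1 = c_0,
  which explains the second power of 1 - \<alpha> j in their definition.\<close>

lemma has_field_derivative_primitive_term:
  assumes "j \<noteq> J"
  shows "(primitive_term j has_field_derivative exp u * (\<Sum>k\<le>1. c j k * exp (of_real (-
      \<alpha> j) * u) * u ^ k)) (at u)"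
proof -
  define g where "g = complex_of_real (1 - \<alpha> j)"
  have g: "g \<noteq> 0" using \<alpha>_neq_1[OF assms] unfolding g_def of_real_eq_0_iff by simp
  have b: "b' j 0 = c j 0 / g - c j 1 / g\<^sup>2" "b' j 1 = c j 1 / g"
    using b'_0[OF assms] b'_1[OF assms] by (simp_all add: g_def)
  have e: "exp u * exp (of_real (- \<alpha> j) * u) = exp (g * u)"
    by (simp add: g_def exp_add[symmetric] algebra_simps)
  have "exp u * (\<Sum>k\<le>1. c j k * exp (of_real (- \<alpha> j) * u) * u ^ k) =
      (exp u * exp (of_real (- \<alpha> j) * u)) * (c j 0 + c j 1 * u)"
    by (simp add: algebra_simps)
  also have "\<dots> = exp (g * u) * (g * (b' j 0 + b' j 1 * u) + b' j 1)"
    unfolding e b using g by (simp add: field_simps power2_eq_square)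
  finally have *: "exp u * (\<Sum>k\<le>1. c j k * exp (of_real (- \<alpha> j) * u) * u ^ k) =
    exp (g * u) * (g * (b' j 0 + b' j 1 * u) + b' j 1)" .
  have "primitive_term j = (\<lambda>u. exp (g * u) * (b' j 0 + b' j 1 * u))"
    by (auto simp: primitive_term_def g_def fun_eq_iff algebra_simps)
  moreover have "((\<lambda>u. exp (g * u) * (b' j 0 + b' j 1 * u)) has_field_derivative
      exp (g * u) * (g * (b' j 0 + b' j 1 * u) + b' j 1)) (at u)"
    by (auto intro!: derivative_eq_intros simp: algebra_simps)
  ultimately show ?thesis unfolding * by simp
qed

lemma has_field_derivative_G:
  assumes "J < N"
  shows "(G N has_field_derivative exp u * T N u) (at u)"
proof -
  have "exp u * T N u = c J 0 + (\<Sum>j\<in>{..<N} - {J}. exp u * (\<Sum>k\<le>1. c j k * exp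
      (of_real (- \<alpha> j) * u) * u ^ k))"
  proof -
    have "exp u * T N u = (\<Sum>j<N. exp u * (\<Sum>k\<le>1. c j k * exp (of_real (- \<alpha> j) *
        u) * u ^ k))"
      by (simp add: T_def sum_distrib_left)
    also have "\<dots> = exp u * (\<Sum>k\<le>1. c J k * exp (of_real (- \<alpha> J) * u) * u ^ k) +
        (\<Sum>j\<in>{..<N} - {J}. exp u * (\<Sum>k\<le>1. c j k * exp (of_real (- \<alpha> j) * u)
            * u ^ k))"
      by (rule sum.remove) (use assms in auto)
    also have "exp u * (\<Sum>k\<le>1. c J k * exp (of_real (- \<alpha> J) * u) * u ^ k) = c J 0"
      using J by (simp add: exp_minus)
    finally show ?thesis .
  qed
  moreover have "(G N has_field_derivative c J 0 + (\<Sum>j\<in>{..<N} - {J}. exp u *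
      (\<Sum>k\<le>1. c j k * exp (of_real (- \<alpha> j) * u) * u ^ k))) (at u)"
    unfolding G_def[abs_def]
    by (intro DERIV_add DERIV_sum has_field_derivative_primitive_term) (auto intro!:
        derivative_eq_intros)
  ultimately show ?thesis by simp
qed

lemma has_field_derivative_Q:
  assumes "J < N" "- exp u \<in> \<Lambda>"
  shows "(Q N has_field_derivative exp u * (- deriv L (- exp u) - T N u)) (at u)"
proof -
  have "((\<lambda>u. L (- exp u)) has_field_derivative deriv L (- exp u) * (- exp u)) (at u)"
    by (rule DERIV_chain2[where f = L and g = "\<lambda>u. - exp u", OF holomorphic_derivI[OF L
        open_cut_region assms(2)]])
       (auto intro!: derivative_eq_intros)
  from DERIV_diff[OF this has_field_derivative_G[OF assms(1)]]
  show ?thesis unfolding Q_def[abs_def] by (rule DERIV_cong) (simp add: algebra_simps)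
qed

lemma continuous_ray_deriv: "continuous_on {\<rho>..} (\<lambda>r. - deriv L (rcis r \<theta>))"
proof -
  have "continuous_on \<Lambda> (deriv L)"
    by (intro holomorphic_on_imp_continuous_on holomorphic_deriv L open_cut_region)
  moreover have "continuous_on {\<rho>..} (\<lambda>r. rcis r \<theta>)" by (intro
      continuous_intros)
  moreover have "rcis r \<theta> \<in> \<Lambda>" if "r \<ge> \<rho>" for r
    by (rule rcis_in_cut_region[OF _ \<delta>]) (use \<rho> that in simp)
  then have "(\<lambda>r. rcis r \<theta>) ` {\<rho>..} \<subseteq> \<Lambda>" by auto
  ultimately have "continuous_on {\<rho>..} (\<lambda>r. deriv L (rcis r \<theta>))"
    by (rule continuous_on_compose2)
  then show ?thesis by (rule continuous_on_minus)
qed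

lemma continuous_ray_rem: "continuous_on {\<rho>..} (ray_rem N)"
  unfolding ray_rem_def[abs_def]
  by (rule continuous_on_diff[OF continuous_on_mult[OF continuous_on_const continuous_ray_deriv]
        continuous_on_power_log_sum[OF \<rho>(1)]])

lemma ray_rem_eq:
  assumes "r > 0"
  shows "ray_rem N r = cis \<theta> * (- deriv L (rcis r \<theta>) - T N (Complex (ln r) (\<theta>
      - pi)))"
proof -
  have log: "log_cut \<theta> (- rcis r \<theta>) = Complex (ln r) (\<theta> - pi)"
    unfolding minus_rcis_eq_exp[OF assms] by (rule log_cut_exp) auto
  show ?thesis
    unfolding ray_rem_def power_log_sum_ray[OF assms, symmetric] pow_cut_def log T_def
    by (simp only: right_diff_distrib)
qed

lemma has_vector_derivative_Q_ray:
  assumes "J < N" "r > 0"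
  shows "((\<lambda>r. Q N (Complex (ln r) (\<theta> - pi))) has_vector_derivative - ray_rem N r)
      (at r)"
proof -
  have eq: "- exp (Complex (ln r) (\<theta> - pi)) = rcis r \<theta>"
    using minus_rcis_eq_exp[OF assms(2), of \<theta>] by (metis minus_minus)
  have "((\<lambda>r. of_real (ln r) + \<i> * of_real (\<theta> - pi)) has_vector_derivative
      of_real (1 / r) + 0) (at r)"
    using assms by (intro has_vector_derivative_add has_vector_derivative_of_real
        has_vector_derivative_const)
      (auto intro!: derivative_eq_intros simp:
          has_real_derivative_iff_has_vector_derivative[symmetric])
  then have 1: "((\<lambda>r. Complex (ln r) (\<theta> - pi)) has_vector_derivative of_real (1 /
      r)) (at r)"
    by (simp add: Complex_eq)
  have "- exp (Complex (ln r) (\<theta> - pi)) \<in> \<Lambda>"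
    unfolding eq by (rule rcis_in_cut_region[OF assms(2) \<delta>])
  from field_vector_diff_chain_at[OF 1 has_field_derivative_Q[OF assms(1) this]]
  have "((\<lambda>r. Q N (Complex (ln r) (\<theta> - pi))) has_vector_derivative of_real (1 / r) *
      (exp (Complex (ln r) (\<theta> - pi)) * (- deriv L (rcis r \<theta>) - T N (Complex (ln r)
          (\<theta> - pi))))) (at r)"
    by (simp add: o_def eq)
  moreover have "exp (Complex (ln r) (\<theta> - pi)) = - (of_real r * cis \<theta>)"
    using minus_rcis_eq_exp[OF assms(2), of \<theta>] by (simp add: rcis_def)
  ultimately show ?thesis
    using assms(2) by (simp add: ray_rem_eq)
qed

lemma Q_ray_bound:
  assumes N: "J < N" and \<eta>: "\<eta> > 0" and b: "\<And>r. r \<ge> \<rho> \<Longrightarrow>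
      norm (ray_rem N r) \<le> C * r powr (- \<eta> - 1)" and r: "r \<ge> \<rho>"
  shows "norm (Q N (Complex (ln r) (\<theta> - pi)) - const N) \<le> C / \<eta> * r powr (- \<eta>)"
proof -
  have "((\<lambda>r. - ray_rem N r) has_integral Q N (Complex (ln r) (\<theta> - pi)) - Q N
      (Complex (ln \<rho>) (\<theta> - pi))) {\<rho>..r}"
  proof (rule fundamental_theorem_of_calculus[OF r, where f = "\<lambda>r. Q N (Complex (ln r)
      (\<theta> - pi))"])
    show "((\<lambda>r. Q N (Complex (ln r) (\<theta> - pi))) has_vector_derivative - ray_rem N x)
        (at x within {\<rho>..r})"
      if "x \<in> {\<rho>..r}" for x
      by (rule has_vector_derivative_at_within[OF has_vector_derivative_Q_ray[OF N]]) (use that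
          \<rho> in simp)
  qed
  then have "integral {\<rho>..r} (\<lambda>r. - ray_rem N r) = Q N (Complex (ln r) (\<theta> -
      pi)) - Q N (Complex (ln \<rho>) (\<theta> - pi))"
    by (rule integral_unique)
  then have "integral {\<rho>..r} (ray_rem N) = - (Q N (Complex (ln r) (\<theta> - pi)) - Q N
      (Complex (ln \<rho>) (\<theta> - pi)))"
    unfolding integral_neg by (rule minus_equation_iff[THEN iffD1, symmetric])
  then have "Q N (Complex (ln r) (\<theta> - pi)) - const N = integral {\<rho>..} (ray_rem N) -
      integral {\<rho>..r} (ray_rem N)"
    by (simp add: const_def)
  also have "norm \<dots> \<le> C * (r powr (- \<eta> - 1 + 1) / (- (- \<eta> - 1 + 1)))"
    by (rule improper_integral_powr_bound(2)[OF \<rho>(1) continuous_ray_rem _ b r]) (use \<eta> in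
        auto)
  finally show ?thesis by simp
qed

text \<open>From z one moves along the circle |\<lambda>| = |z| to the ray and from there to
  infinity. In the coordinate u the arc is a vertical segment of length at most \<pi>, so both
  pieces contribute O(|z|^(-\<eta>)).\<close>

lemma remainder_bounds:
  assumes N: "J < N" and \<eta>: "\<eta> > 0"
    and b: "\<And>z. z \<in> \<Lambda> \<Longrightarrow> B \<le> cmod z \<Longrightarrow> cmod (-
        deriv L z - T N (log_cut \<theta> (- z))) \<le> C * cmod z powr (- \<eta> - 1)"
  shows "\<exists>B C. \<forall>z\<in>\<Lambda>. B \<le> cmod z \<longrightarrow> cmod (L z - G N
      (log_cut \<theta> (- z)) - const N) \<le> C * cmod z powr (- \<eta>)"
proof -
  have ev: "eventually (\<lambda>r. norm (ray_rem N r) \<le> C * r powr (- \<eta> - 1)) at_top"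
    using eventually_ge_at_top[of "max B 1"]
  proof eventually_elim
    case (elim r)
    then have r: "r > 0" "B \<le> r" by auto
    have log: "log_cut \<theta> (- rcis r \<theta>) = Complex (ln r) (\<theta> - pi)"
      unfolding minus_rcis_eq_exp[OF r(1)] by (rule log_cut_exp) auto
    show ?case
      unfolding ray_rem_eq[OF r(1)]
      using b[OF rcis_in_cut_region[OF r(1) \<delta>]] r by (simp add: norm_mult log)
  qed
  have cp: "continuous_on {\<rho>..} (\<lambda>r. r powr (- \<eta> - 1))"
    using \<rho> by (auto intro!: continuous_intros)
  have "r powr (- \<eta> - 1) > 0" if "r \<ge> \<rho>" for r using that \<rho> by simp
  from bounded_on_halfline[OF continuous_ray_rem cp this ev]
  obtain C' where C': "\<And>r. r \<ge> \<rho> \<Longrightarrow> norm (ray_rem N r) \<le> C' * r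
      powr (- \<eta> - 1)" by metis
  have "cmod (L z - G N (log_cut \<theta> (- z)) - const N) \<le> (\<bar>C\<bar> * pi + C' /
      \<eta>) * cmod z powr (- \<eta>)"
    if z: "z \<in> \<Lambda>" "max B \<rho>\<^sub>0 \<le> cmod z" for z
  proof -
    define u where "u = log_cut \<theta> (- z)"
    define a where "a = Complex (Re u) (\<theta> - pi)"
    have z0: "\<rho>\<^sub>0 \<le> cmod z" "z \<noteq> 0" "cmod z > 0" "B \<le> cmod z" "\<rho>
        \<le> cmod z" using z \<rho> by auto
    note u = cut_region_log[OF z(1) z0(1,2), folded u_def]
    \<comment> \<open>The segment has constant real part and comes no farther from the line Im =
      \<theta> - \<pi> than u. So its image stays in the sector, on the circle through z and on the
      same branch.\<close>
    have seg: "Re v = Re u \<and> \<bar>Im v - (\<theta> - pi)\<bar> \<le> \<bar>Im u - (\<theta> -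
        pi)\<bar> \<and> \<theta> - 2 * pi \<le> Im v \<and> Im v < \<theta>"
      if "v \<in> closed_segment a u" for v
    proof -
      obtain t where t: "0 \<le> t" "t \<le> 1" "v = (1 - t) *\<^sub>R a + t *\<^sub>R u"
        using \<open>v \<in> closed_segment a u\<close> by (auto simp: closed_segment_def)
      have Im: "Im v - (\<theta> - pi) = t * (Im u - (\<theta> - pi))"
        unfolding t(3) by (simp add: a_def algebra_simps)
      have le: "\<bar>Im v - (\<theta> - pi)\<bar> \<le> \<bar>Im u - (\<theta> - pi)\<bar>"
        unfolding Im abs_mult using t mult_right_mono[of t 1 "\<bar>Im u - (\<theta> - pi)\<bar>"]
            by simp
      moreover have "Re v = Re u" unfolding t(3) by (simp add: a_def algebra_simps)
      \<comment> \<open>The branch interval excludes its upper end, so here the distance bound alone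
        is not enough and the sign of the displacement matters.\<close>
      moreover have "Im v - (\<theta> - pi) < pi"
      proof (cases "Im u - (\<theta> - pi) \<ge> 0")
        case True
        then show ?thesis using le u(4) by linarith
      next
        case False
        then have "t * (Im u - (\<theta> - pi)) \<le> 0" using t by (simp add: mult_nonneg_nonpos)
        then show ?thesis unfolding Im using pi_gt_zero by linarith
      qed
      moreover have "\<theta> - 2 * pi \<le> Im v" using le u(2) by linarith
      ultimately show ?thesis by linarith
    qed
    have "norm (Q N u - Q N a) \<le> (\<bar>C\<bar> * cmod z powr (- \<eta>)) * norm (u - a)"
    proof (rule field_differentiable_bound[OF convex_closed_segment])
      fix v assume v: "v \<in> closed_segment a u"
      have cz: "cmod (- exp v) = cmod z"
        using seg[OF v] u(6) z0(3) by simp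
      have in_\<Lambda>: "- exp v \<in> \<Lambda>"
        by (rule minus_exp_in_cut_region) (use seg[OF v] u(1,2) in linarith)+
      show "(Q N has_field_derivative exp v * (- deriv L (- exp v) - T N v)) (at v within
          closed_segment a u)"
        by (rule has_field_derivative_at_within[OF has_field_derivative_Q[OF N in_\<Lambda>]])
      have "log_cut \<theta> (- (- exp v)) = v" using seg[OF v] by (simp add: log_cut_exp)
      then have "norm (- deriv L (- exp v) - T N v) \<le> C * cmod z powr (- \<eta> - 1)"
        using b[OF in_\<Lambda>] z0 cz by simp
      then have "norm (exp v * (- deriv L (- exp v) - T N v)) \<le> cmod z * (C * cmod z powr (-
          \<eta> - 1))"
        using cz z0(3) unfolding norm_mult by (simp add: mult_left_mono)
      also have "\<dots> \<le> cmod z * (\<bar>C\<bar> * cmod z powr (- \<eta> - 1))"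
        by (intro mult_left_mono mult_right_mono) auto
      also have "\<dots> = \<bar>C\<bar> * cmod z powr (- \<eta>)"
        using z0(3) by (simp add: powr_diff)
      finally show "norm (exp v * (- deriv L (- exp v) - T N v)) \<le> \<bar>C\<bar> * cmod z powr
          (- \<eta>)" .
    qed auto
    also have "norm (u - a) \<le> pi"
      using u(2) cmod_le[of "u - a"] by (simp add: a_def)
    finally have 1: "norm (Q N u - Q N a) \<le> \<bar>C\<bar> * cmod z powr (- \<eta>) * pi"
      by (simp add: mult_left_mono)
    have "norm (Q N a - const N) \<le> C' / \<eta> * cmod z powr (- \<eta>)"
      using Q_ray_bound[OF N \<eta> C' z0(5)] u(6) by (simp add: a_def)
    with 1 have "norm (Q N u - const N) \<le> (\<bar>C\<bar> * pi + C' / \<eta>) * cmod z powr (-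
        \<eta>)"
      using norm_triangle_ineq[of "Q N u - Q N a" "Q N a - const N"] by (simp add: algebra_simps)
    then show ?thesis
      unfolding Q_def u(5) unfolding u_def by simp
  qed
  then show ?thesis by blast
qed

text \<open>Only the terms below J are subtracted, so the expression is independent of N. Once c J 0
  is identified with the value of the relative zeta function at 0, this is the bracket of the limit
  formula.\<close>

definition base :: "complex \<Rightarrow> complex" where
  "base z = L z - c J 0 * log_cut \<theta> (- z) - (\<Sum>j<J. primitive_term j (log_cut \<theta>
      (- z)))"

lemma primitive_term_tendsto_0:
  assumes "j > J"
  shows "((\<lambda>z. primitive_term j (log_cut \<theta> (- z))) \<longlongrightarrow> 0)
      (at_infinity_within \<Lambda>)"
proof (rule Lim_null_comparison)
  have "1 - \<alpha> j < 0" using strict_monoD[OF strict_mono_\<alpha> assms] J by simp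
  then have "((\<lambda>r. (cmod (b' j 0) + cmod (b' j 1) * (ln r + (\<bar>\<theta>\<bar> + 2 *
      pi))) * r powr (1 - \<alpha> j)) \<longlongrightarrow> 0) at_top"
    by real_asymp
  from filterlim_compose[OF this filterlim_cmod_at_infinity_within]
  show "((\<lambda>z. (cmod (b' j 0) + cmod (b' j 1) * (ln (cmod z) + (\<bar>\<theta>\<bar> + 2 *
      pi))) * cmod z powr (1 - \<alpha> j)) \<longlongrightarrow> 0) (at_infinity_within
      \<Lambda>)" .
  have "norm (primitive_term j (log_cut \<theta> (- z))) \<le> (cmod (b' j 0) + cmod (b' j 1) * (ln
      (cmod z) + (\<bar>\<theta>\<bar> + 2 * pi))) * cmod z powr (1 - \<alpha> j)"
    if "z \<in> \<Lambda>" "1 \<le> cmod z" for z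
  proof -
    define u where "u = log_cut \<theta> (- z)"
    have Re: "Re u = ln (cmod z)" and Im: "\<bar>Im u\<bar> \<le> \<bar>\<theta>\<bar> + 2 * pi"
      using arg_cut(1,2)[of \<theta> "- z"] pi_gt_zero by (auto simp: u_def log_cut_def)
    have "primitive_term j u = (b' j 0 + b' j 1 * u) * exp (of_real (1 - \<alpha> j) * u)"
      by (simp add: primitive_term_def algebra_simps)
    moreover have "norm (exp (of_real (1 - \<alpha> j) * u)) = cmod z powr (1 - \<alpha> j)"
      using that Re by (auto simp: powr_def)
    moreover have "norm (b' j 0 + b' j 1 * u) \<le> cmod (b' j 0) + cmod (b' j 1) * (ln (cmod z) +
        (\<bar>\<theta>\<bar> + 2 * pi))"
    proof -
      have "norm u \<le> ln (cmod z) + (\<bar>\<theta>\<bar> + 2 * pi)"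
        using cmod_le[of u] Re Im that by simp
      then have "cmod (b' j 1) * norm u \<le> cmod (b' j 1) * (ln (cmod z) + (\<bar>\<theta>\<bar>
          + 2 * pi))"
        by (intro mult_left_mono) auto
      then show ?thesis using norm_triangle_ineq[of "b' j 0" "b' j 1 * u"] by (simp add: norm_mult)
    qed
    ultimately show ?thesis unfolding u_def by (simp add: norm_mult mult_right_mono)
  qed
  then show "eventually (\<lambda>z. norm (primitive_term j (log_cut \<theta> (- z))) \<le>
      (cmod (b' j 0) + cmod (b' j 1) * (ln (cmod z) + (\<bar>\<theta>\<bar> + 2 * pi))) * cmod z
          powr (1 - \<alpha> j)) (at_infinity_within \<Lambda>)"
    unfolding eventually_at_infinity_within by blast
qed

lemma base_tendsto:
  assumes N: "J < N" and \<eta>: "\<eta> > 0"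
    and b: "\<And>z. z \<in> \<Lambda> \<Longrightarrow> B \<le> cmod z \<Longrightarrow> cmod (-
        deriv L z - T N (log_cut \<theta> (- z))) \<le> C * cmod z powr (- \<eta> - 1)"
  shows "(base \<longlongrightarrow> const N) (at_infinity_within \<Lambda>)"
proof -
  obtain B' C' where BC: "\<forall>z\<in>\<Lambda>. B' \<le> cmod z \<longrightarrow> cmod (L z - G
      N (log_cut \<theta> (- z)) - const N) \<le> C' * cmod z powr (- \<eta>)"
  proof -
    have "\<exists>B' C'. \<forall>z\<in>\<Lambda>. B' \<le> cmod z \<longrightarrow> cmod (L z - G
        N (log_cut \<theta> (- z)) - const N) \<le> C' * cmod z powr (- \<eta>)"
      by (rule remainder_bounds[OF N \<eta> b])
    then show ?thesis using that by (elim exE)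
  qed
  have "((\<lambda>z. L z - G N (log_cut \<theta> (- z)) - const N) \<longlongrightarrow> 0)
      (at_infinity_within \<Lambda>)"
  proof (rule Lim_null_comparison)
    have "((\<lambda>r. C' * r powr (- \<eta>)) \<longlongrightarrow> 0) at_top" using \<eta> by
        real_asymp
    from filterlim_compose[OF this filterlim_cmod_at_infinity_within]
    show "((\<lambda>z. C' * cmod z powr (- \<eta>)) \<longlongrightarrow> 0) (at_infinity_within
        \<Lambda>)" .
    show "eventually (\<lambda>z. norm (L z - G N (log_cut \<theta> (- z)) - const N) \<le> C' *
        cmod z powr (- \<eta>)) (at_infinity_within \<Lambda>)"
      unfolding eventually_at_infinity_within using BC by blast
  qed
  moreover have "((\<lambda>z. \<Sum>j\<in>{Suc J..<N}. primitive_term j (log_cut \<theta> (- z)))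
      \<longlongrightarrow> 0) (at_infinity_within \<Lambda>)"
    by (intro tendsto_null_sum primitive_term_tendsto_0) auto
  ultimately have "((\<lambda>z. (L z - G N (log_cut \<theta> (- z)) - const N) + (\<Sum>j\<in>{Suc
      J..<N}. primitive_term j (log_cut \<theta> (- z))) + const N)
      \<longlongrightarrow> 0 + 0 + const N) (at_infinity_within \<Lambda>)"
    by (intro tendsto_intros)
  moreover have "(L z - G N (log_cut \<theta> (- z)) - const N) + (\<Sum>j\<in>{Suc J..<N}.
      primitive_term j (log_cut \<theta> (- z))) + const N = base z" for z
  proof -
    have S: "{..<N} - {J} = {..<J} \<union> {Suc J..<N}" using N by (auto simp: not_less_eq)
    have "(\<Sum>j\<in>{..<N} - {J}. primitive_term j u) = (\<Sum>j<J. primitive_term j u) +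
        (\<Sum>j\<in>{Suc J..<N}. primitive_term j u)" for u
      unfolding S by (rule sum.union_disjoint) auto
    then show ?thesis by (simp add: G_def base_def)
  qed
  ultimately show ?thesis by simp
qed

lemma remainder_eventually:
  assumes "\<epsilon> > 0"
  shows "\<forall>\<^sub>F N in sequentially. J < N \<and> \<alpha> N - \<epsilon> - 1 > 0 \<and>
      (\<exists>B C. \<forall>z\<in>\<Lambda>. B \<le> cmod z \<longrightarrow>
     cmod (- deriv L z - T N (log_cut \<theta> (- z))) \<le> C * cmod z powr (- (\<alpha> N -
         \<epsilon> - 1) - 1))"
proof -
  have "\<forall>\<^sub>F N in sequentially. (\<lambda>z. cmod (- deriv L z - (\<Sum>j<N.
      \<Sum>k\<le>1. c j k * pow_cut \<theta> (- z) (- \<alpha> j) * log_cut \<theta> (- z) ^ k) -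
      0))
          \<in> O[at_infinity_within \<Lambda>](\<lambda>z. cmod z powr (- \<alpha> N +
              \<epsilon>))"
    using expansion assms unfolding log_expansion_def by simp
  moreover have "\<forall>\<^sub>F N in sequentially. \<alpha> N > \<epsilon> + 1"
    using \<alpha>_at_top by (simp add: filterlim_at_top_dense)
  ultimately show ?thesis
    using eventually_gt_at_top[of J]
  proof eventually_elim
    case (elim N)
    have "- \<alpha> N + \<epsilon> = - (\<alpha> N - \<epsilon> - 1) - 1" by simp
    then show ?case
      using elim bigo_at_infinity_within[OF elim(1)[unfolded diff_zero]]
      unfolding pow_cut_def T_def by auto
  qed
qed

text \<open>Since \<open>base\<close> is free of N and limits are unique, \<open>const N\<close> is
  the same number for all large N. It is then the constant term in an expansion of L, and thereby
  the regularized limit.\<close>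

lemma regularized_limit:
  obtains c1 where "reg_limit \<theta> \<Lambda> L = c1" "(base \<longlongrightarrow> c1)
      (at_infinity_within \<Lambda>)"
    "\<forall>\<^sub>F N in sequentially. J < N \<and> const N = c1"
proof -
  have nb: "at_infinity_within \<Lambda> \<noteq> bot" by (rule
      at_infinity_within_cut_region_neq_bot[OF \<delta>])
  have lim: "\<forall>\<^sub>F N in sequentially. J < N \<and> (base \<longlongrightarrow> const N)
      (at_infinity_within \<Lambda>)"
    using remainder_eventually[OF zero_less_one]
    by eventually_elim (use base_tendsto in blast)
  then obtain N0 where N0: "(base \<longlongrightarrow> const N0) (at_infinity_within \<Lambda>)"
    by (auto simp: eventually_sequentially)
  have const: "\<forall>\<^sub>F N in sequentially. J < N \<and> const N = const N0"
    using lim by eventually_elim (use tendsto_unique[OF nb _ N0] in blast)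
  \<comment> \<open>The index J is omitted: its exponent \<alpha> J - 1 is 0, which
    \<open>reg_limit\<close> forbids, and its contribution is the separate logarithmic term.\<close>
  define skip where "skip j = (if j < J then j else Suc j)" for j
  define \<beta> where "\<beta> j = \<alpha> (skip j) - 1" for j
  have "reg_limit \<theta> \<Lambda> L = const N0"
  proof (rule reg_limit_eqI[OF _ _ \<delta>])
    show "\<beta> j \<noteq> 0" for j
      using \<alpha>_neq_1[of "skip j"] by (auto simp: \<beta>_def skip_def split: if_splits)
    show "log_expansion \<theta> \<Lambda> L \<beta> (\<lambda>j. b' (skip j)) (\<lambda>z. c J 0 *
        log_cut \<theta> (- z) + const N0)"
      unfolding log_expansion_def
    proof (intro conjI allI impI)
      have "strict_mono skip" by (auto simp: strict_mono_def skip_def)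
      then show "strict_mono \<beta>"
        using strict_mono_\<alpha> by (auto simp: strict_mono_def \<beta>_def)
      have "filterlim (\<lambda>j. \<alpha> (skip j)) at_top sequentially"
        using \<alpha>_at_top filterlim_subseq[OF \<open>strict_mono skip\<close>] by (rule
            filterlim_compose)
      then show "filterlim \<beta> at_top sequentially"
        unfolding \<beta>_def diff_conv_add_uminus
        using filterlim_tendsto_add_at_top[OF tendsto_const, of "\<lambda>j. \<alpha> (skip j)"
            sequentially "- 1"] by (simp add: add.commute)
      \<comment> \<open>For N > J the first N terms without J use up the original indices below N +
        1, and \<beta> N = \<alpha> (Suc N) - 1; hence the estimates are taken at Suc N.\<close>
      fix \<epsilon> :: real assume "\<epsilon> > 0"
      have "\<forall>\<^sub>F N in sequentially. J < Suc N \<and> \<alpha> (Suc N) - \<epsilon> - 1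
          > 0 \<and> (\<exists>B C. \<forall>z\<in>\<Lambda>. B \<le> cmod z \<longrightarrow>
         cmod (- deriv L z - T (Suc N) (log_cut \<theta> (- z))) \<le> C * cmod z powr (- (\<alpha>
             (Suc N) - \<epsilon> - 1) - 1))"
        using remainder_eventually[OF \<open>\<epsilon> > 0\<close>] eventually_sequentially_Suc by
            (rule iffD2[rotated])
      moreover have "\<forall>\<^sub>F N in sequentially. J < Suc N \<and> const (Suc N) = const N0"
        using const eventually_sequentially_Suc by (rule iffD2[rotated])
      ultimately show "\<forall>\<^sub>F N in sequentially. (\<lambda>z. cmod (L z - (\<Sum>j<N.
          \<Sum>k\<le>1. b' (skip j) k * pow_cut \<theta> (- z) (- \<beta> j) * log_cut \<theta> (-
          z) ^ k)
          - (c J 0 * log_cut \<theta> (- z) + const N0))) \<in> O[at_infinity_within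
              \<Lambda>](\<lambda>z. cmod z powr (- \<beta> N + \<epsilon>))"
        using eventually_gt_at_top[of J]
      proof eventually_elim
        case (elim N)
        define \<eta> where "\<eta> = \<alpha> (Suc N) - \<epsilon> - 1"
        have "\<eta> > 0" using elim by (simp add: \<eta>_def)
        obtain B C where "\<forall>z\<in>\<Lambda>. B \<le> cmod z \<longrightarrow> cmod (- deriv
            L z - T (Suc N) (log_cut \<theta> (- z))) \<le> C * cmod z powr (- \<eta> - 1)"
          using elim unfolding \<eta>_def by blast
        then have "\<exists>B C. \<forall>z\<in>\<Lambda>. B \<le> cmod z \<longrightarrow> cmod (L
            z - G (Suc N) (log_cut \<theta> (- z)) - const (Suc N)) \<le> C * cmod z powr (-
            \<eta>)"
          using elim by (intro remainder_bounds[OF _ \<open>\<eta> > 0\<close>, of _ B C]) auto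
        then obtain B' C' where BC: "\<forall>z\<in>\<Lambda>. B' \<le> cmod z \<longrightarrow>
            cmod (L z - G (Suc N) (log_cut \<theta> (- z)) - const N0) \<le> C' * cmod z powr (-
            \<eta>)"
          using elim by auto
        have bij: "bij_betw skip {..<N} ({..<Suc N} - {J})"
          by (rule bij_betwI[where g = "\<lambda>j. if j < J then j else j - 1"]) (use elim in
              \<open>auto simp: skip_def split: if_splits\<close>)
        have "(\<Sum>j<N. \<Sum>k\<le>1. b' (skip j) k * pow_cut \<theta> (- z) (- \<beta> j) *
            log_cut \<theta> (- z) ^ k) = (\<Sum>j\<in>{..<Suc N} - {J}. primitive_term j (log_cut
            \<theta> (- z)))" for z
          unfolding sum.reindex_bij_betw[OF bij, symmetric] primitive_term_def pow_cut_def
              \<beta>_def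
          by (simp add: algebra_simps)
        then have eq: "L z - (\<Sum>j<N. \<Sum>k\<le>1. b' (skip j) k * pow_cut \<theta> (- z) (-
            \<beta> j) * log_cut \<theta> (- z) ^ k)
          - (c J 0 * log_cut \<theta> (- z) + const N0) = L z - G (Suc N) (log_cut \<theta> (- z))
              - const N0" for z
          by (simp add: G_def)
        have "- \<eta> = - \<beta> N + \<epsilon>" using elim by (simp add: \<eta>_def \<beta>_def
            skip_def)
        show ?case
          unfolding eq \<open>- \<eta> = - \<beta> N + \<epsilon>\<close>[symmetric]
        proof (rule landau_o.bigI[where c = "\<bar>C'\<bar> + 1"])
          have "cmod (L z - G (Suc N) (log_cut \<theta> (- z)) - const N0) \<le> (\<bar>C'\<bar> +
              1) * cmod z powr (- \<eta>)"
            if "z \<in> \<Lambda>" "B' \<le> cmod z" for z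
            by (rule order_trans[OF BC[rule_format, OF that] mult_right_mono]) auto
          then show "eventually (\<lambda>z. norm (cmod (L z - G (Suc N) (log_cut \<theta> (- z)) -
              const N0)) \<le>
              (\<bar>C'\<bar> + 1) * norm (cmod z powr (- \<eta>))) (at_infinity_within \<Lambda>)"
            unfolding eventually_at_infinity_within by auto
        qed simp
      qed
    qed
  qed
  then show ?thesis using that[of "const N0"] N0 const by blast
qed

end

section \<open>Resolvents\<close>

locale cut_operator =
  fixes A :: "'h::chilbert_space operator" and \<theta> \<delta> \<rho>\<^sub>0 :: real
  assumes closed_A: "closed_operator A" and cut: "spectral_cut_on \<theta> \<delta> \<rho>\<^sub>0
      A"
begin

abbreviation "\<Lambda> \<equiv> cut_region \<theta> \<delta> \<rho>\<^sub>0"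
abbreviation "R \<equiv> resolvent A"

lemma delta_pos: "\<delta> > 0" and rho0_pos: "\<rho>\<^sub>0 > 0" and \<Lambda>_subset: "\<Lambda>
    \<subseteq> resolvent_set A"
  using cut by (auto simp: spectral_cut_on_def)

lemma zero_in_\<Lambda>: "0 \<in> \<Lambda>"
  using rho0_pos by (simp add: cut_region_def)

lemma resolvent_dom:
  assumes "z \<in> \<Lambda>"
  shows "R z x \<in> op_dom A" "op_app A (R z x) - z *\<^sub>C R z x = x"
proof -
  have b: "bij_betw (\<lambda>x. op_app A x - z *\<^sub>C x) (op_dom A) UNIV"
    using assms \<Lambda>_subset by (auto simp: resolvent_set_def)
  then have "x \<in> (\<lambda>x. op_app A x - z *\<^sub>C x) ` op_dom A" by (auto simp:
      bij_betw_def)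
  then show "R z x \<in> op_dom A" "op_app A (R z x) - z *\<^sub>C R z x = x"
    unfolding resolvent_def
    by (rule inv_into_into, rule f_inv_into_f[where f = "\<lambda>x. op_app A x - z *\<^sub>C x"])
qed

lemma resolvent_left_inverse:
  assumes "z \<in> \<Lambda>" "x \<in> op_dom A"
  shows "R z (op_app A x - z *\<^sub>C x) = x"
proof -
  have "inj_on (\<lambda>x. op_app A x - z *\<^sub>C x) (op_dom A)"
    using assms \<Lambda>_subset by (auto simp: resolvent_set_def bij_betw_def)
  from inv_into_f_f[OF this assms(2)] show ?thesis unfolding resolvent_def .
qed

lemma resolvent_bound: "z \<in> \<Lambda> \<Longrightarrow> \<exists>C. op_bound (R z) C"
  using \<Lambda>_subset by (auto simp: resolvent_set_def bounded_op_on_UNIV_iff)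

lemma resolvent_bounded_linear: "z \<in> \<Lambda> \<Longrightarrow> bounded_linear (R z)"
  using resolvent_bound op_bound_imp_bounded_linear by blast

lemma resolvent_linear:
  assumes "z \<in> \<Lambda>"
  shows "R z (x + y) = R z x + R z y" "R z (x - y) = R z x - R z y" "R z (c *\<^sub>C x) = c
      *\<^sub>C R z x" "R z 0 = 0"
  using resolvent_bound[OF assms] op_boundD by blast+

lemma op_bound_resolvent_onorm: "z \<in> \<Lambda> \<Longrightarrow> op_bound (R z) (onorm (R z))"
  using onorm[OF resolvent_bounded_linear] resolvent_linear onorm_pos_le[OF
      resolvent_bounded_linear]
  by (auto simp: op_bound_def)

lemma resolvent_identity:
  assumes "z \<in> \<Lambda>" "w \<in> \<Lambda>"
  shows "R z x - R w x = (z - w) *\<^sub>C R z (R w x)"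
proof -
  define y where "y = R w x"
  have y: "y \<in> op_dom A" "op_app A y - w *\<^sub>C y = x"
    using resolvent_dom[OF assms(2)] by (auto simp: y_def)
  have "op_app A y - z *\<^sub>C y = x - (z - w) *\<^sub>C y"
    using y(2) by (simp add: scaleC_diff_left algebra_simps)
  then have "y = R z (x - (z - w) *\<^sub>C y)"
    using resolvent_left_inverse[OF assms(1) y(1)] by simp
  then have "y = R z x - (z - w) *\<^sub>C R z y"
    by (simp add: resolvent_linear[OF assms(1)])
  then show ?thesis unfolding y_def[symmetric] by (simp add: algebra_simps)
qed

text \<open>This is A(A - z)^-1. It turns R(0) into R(z) from either side, and it stays bounded
  where R(z) is O(1/|z|).\<close>

definition Y :: "complex \<Rightarrow> 'h \<Rightarrow> 'h" where "Y z x = x + z *\<^sub>C R z x"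

lemma resolvent_eq_Y: "z \<in> \<Lambda> \<Longrightarrow> R z x = Y z (R 0 x)" "z \<in> \<Lambda>
    \<Longrightarrow> R z x = R 0 (Y z x)"
proof -
  assume z: "z \<in> \<Lambda>"
  show "R z x = Y z (R 0 x)"
    using resolvent_identity[OF z zero_in_\<Lambda>, of x] by (simp add: Y_def algebra_simps)
  show "R z x = R 0 (Y z x)"
    using resolvent_identity[OF zero_in_\<Lambda> z, of x]
    by (simp add: Y_def resolvent_linear[OF zero_in_\<Lambda>] algebra_simps)
qed

lemma Y_bound:
  assumes "z \<in> \<Lambda>" "op_bound (R z) C"
  shows "op_bound (Y z) (1 + cmod z * C)"
  unfolding op_bound_def
proof (intro conjI allI)
  show "norm (Y z x) \<le> (1 + cmod z * C) * norm x" for x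
  proof -
    have "norm (Y z x) \<le> norm x + cmod z * norm (R z x)"
      unfolding Y_def using norm_triangle_ineq[of x "z *\<^sub>C R z x"] by (simp add: norm_scaleC)
    also have "\<dots> \<le> norm x + cmod z * (C * norm x)"
      using op_boundD(3)[OF assms(2)] by (intro add_left_mono mult_left_mono) auto
    finally show ?thesis by (simp add: algebra_simps)
  qed
  show "0 \<le> 1 + cmod z * C" using op_boundD(4)[OF assms(2)] by simp
qed (simp_all add: Y_def resolvent_linear[OF assms(1)] scaleC_add_right scaleC_scaleC mult.commute)

text \<open>Lipschitz continuity in operator norm at the single point z. It passes from R to Y and
  to powers, and applied to the powers of Y it yields the continuity of traces.\<close>

definition op_lip :: "(complex \<Rightarrow> 'h \<Rightarrow> 'h) \<Rightarrow> complex
    \<Rightarrow> bool" where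
  "op_lip F z \<longleftrightarrow> (\<exists>K\<ge>0. \<forall>\<^sub>F w in at z. \<forall>x.
      norm (F w x - F z x) \<le> K * cmod (w - z) * norm x)"

lemma eventually_in_\<Lambda>: "z \<in> \<Lambda> \<Longrightarrow> eventually (\<lambda>w. w \<in>
    \<Lambda>) (at z)"
  by (rule eventually_at_in_open'[OF open_cut_region])

lemma eventually_close: "e > 0 \<Longrightarrow> eventually (\<lambda>w. cmod (w - z) < e) (at z)"
  by (auto simp: eventually_at dist_norm)

lemma resolvent_lip:
  assumes z: "z \<in> \<Lambda>"
  shows "op_lip R z"
proof -
  obtain D where D: "has_op_derivative R D z"
    using cut z by (auto simp: spectral_cut_on_def)
  then obtain K where K: "op_bound D K"
    by (auto simp: has_op_derivative_def bounded_op_on_UNIV_iff)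
  have "\<forall>\<^sub>F w in at z. \<forall>x. norm (R w x - R z x - (w - z) *\<^sub>C D x) \<le>
      1 * cmod (w - z) * norm x"
    using D zero_less_one unfolding has_op_derivative_def by blast
  then have "\<forall>\<^sub>F w in at z. \<forall>x. norm (R w x - R z x) \<le> (1 + K) * cmod (w
      - z) * norm x"
  proof eventually_elim
    case (elim w)
    show ?case
    proof
      fix x
      have "norm (R w x - R z x) \<le> norm (R w x - R z x - (w - z) *\<^sub>C D x) + norm ((w - z)
          *\<^sub>C D x)"
        by (metis diff_add_cancel norm_triangle_ineq)
      also have "\<dots> \<le> cmod (w - z) * norm x + cmod (w - z) * (K * norm x)"
        using elim op_boundD(3)[OF K, of x] by (intro add_mono) (auto simp: norm_scaleC
            mult_left_mono)
      finally show "norm (R w x - R z x) \<le> (1 + K) * cmod (w - z) * norm x"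
        by (simp add: algebra_simps)
    qed
  qed
  then show ?thesis unfolding op_lip_def using op_boundD(4)[OF K] by (intro exI[of _ "1 + K"]) auto
qed

lemma op_lip_locally_bounded:
  assumes F: "op_lip F z" "op_bound (F z) C"
  shows "\<exists>M\<ge>0. \<forall>\<^sub>F w in at z. \<forall>x. norm (F w x) \<le> M * norm x"
proof -
  obtain K where K: "K \<ge> 0" "\<forall>\<^sub>F w in at z. \<forall>x. norm (F w x - F z x)
      \<le> K * cmod (w - z) * norm x"
    using F(1) unfolding op_lip_def by blast
  have "\<forall>\<^sub>F w in at z. \<forall>x. norm (F w x) \<le> (C + K) * norm x"
    using K(2) eventually_close[OF zero_less_one]
  proof eventually_elim
    case (elim w)
    show ?case
    proof
      fix x
      have "norm (F w x) \<le> norm (F z x) + norm (F w x - F z x)"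
        by (metis add.commute diff_add_cancel norm_triangle_ineq)
      also have "\<dots> \<le> C * norm x + K * cmod (w - z) * norm x"
        using elim op_boundD(3)[OF F(2)] by (intro add_mono) auto
      also have "K * cmod (w - z) * norm x \<le> K * 1 * norm x"
        using elim K(1) by (intro mult_right_mono mult_left_mono) auto
      finally show "norm (F w x) \<le> (C + K) * norm x" by (simp add: algebra_simps)
    qed
  qed
  then show ?thesis using op_boundD(4)[OF F(2)] K(1) by (intro exI[of _ "C + K"]) auto
qed

text \<open>Linearity is asked for only near z, since outside \<Lambda> the resolvent is an inverse
  with unspecified values.\<close>

lemma op_lip_comp:
  assumes F: "op_lip F z" "op_bound (F z) C" and lin: "\<forall>\<^sub>F w in at z. \<forall>x y. F
      w (x - y) = F w x - F w y"
    and G: "op_lip G z" "op_bound (G z) C'"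
  shows "op_lip (\<lambda>w x. F w (G w x)) z"
proof -
  obtain K where K: "K \<ge> 0" "\<forall>\<^sub>F w in at z. \<forall>x. norm (F w x - F z x)
      \<le> K * cmod (w - z) * norm x"
    using F(1) unfolding op_lip_def by blast
  obtain K' where K': "K' \<ge> 0" "\<forall>\<^sub>F w in at z. \<forall>x. norm (G w x - G z x)
      \<le> K' * cmod (w - z) * norm x"
    using G(1) unfolding op_lip_def by blast
  obtain M where M: "M \<ge> 0" "\<forall>\<^sub>F w in at z. \<forall>x. norm (F w x) \<le> M *
      norm x"
    using op_lip_locally_bounded[OF F] by blast
  have "\<forall>\<^sub>F w in at z. \<forall>x. norm (F w (G w x) - F z (G z x)) \<le> (M * K' + K
      * C') * cmod (w - z) * norm x"
    using K(2) K'(2) M(2) lin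
  proof eventually_elim
    case (elim w)
    show ?case
    proof
      fix x
      have "F w (G w x) - F z (G z x) = F w (G w x - G z x) + (F w (G z x) - F z (G z x))"
        using elim(4) by simp
      then have "norm (F w (G w x) - F z (G z x)) \<le> norm (F w (G w x - G z x)) + norm (F w (G z
          x) - F z (G z x))"
        by (metis norm_triangle_ineq)
      also have "\<dots> \<le> M * norm (G w x - G z x) + K * cmod (w - z) * norm (G z x)"
        using elim(3)[rule_format, of "G w x - G z x"] elim(1)[rule_format, of "G z x"] by (rule
            add_mono)
      also have "\<dots> \<le> M * (K' * cmod (w - z) * norm x) + K * cmod (w - z) * (C' * norm x)"
        using elim M(1) K(1) op_boundD(3)[OF G(2)] by (intro add_mono mult_left_mono) auto
      finally show "norm (F w (G w x) - F z (G z x)) \<le> (M * K' + K * C') * cmod (w - z) * norm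
          x"
        by (simp add: algebra_simps)
    qed
  qed
  then show ?thesis
    unfolding op_lip_def using M(1) K(1) K'(1) op_boundD(4)[OF G(2)]
    by (intro exI[of _ "M * K' + K * C'"]) auto
qed

lemma Y_lip:
  assumes z: "z \<in> \<Lambda>"
  shows "op_lip Y z"
proof -
  obtain C where C: "op_bound (R z) C" using resolvent_bound[OF z] by blast
  obtain K where K: "K \<ge> 0" "\<forall>\<^sub>F w in at z. \<forall>x. norm (R w x - R z x)
      \<le> K * cmod (w - z) * norm x"
    using resolvent_lip[OF z] unfolding op_lip_def by blast
  have "\<forall>\<^sub>F w in at z. \<forall>x. norm (Y w x - Y z x) \<le> ((cmod z + 1) * K + C)
      * cmod (w - z) * norm x"
    using K(2) eventually_close[OF zero_less_one]
  proof eventually_elim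
    case (elim w)
    have w: "cmod w \<le> cmod z + 1"
      using norm_triangle_ineq[of z "w - z"] elim(2) by simp
    show ?case
    proof
      fix x
      have "Y w x - Y z x = w *\<^sub>C (R w x - R z x) + (w - z) *\<^sub>C R z x"
        by (simp add: Y_def scaleC_diff_left scaleC_diff_right)
      then have "norm (Y w x - Y z x) \<le> cmod w * norm (R w x - R z x) + cmod (w - z) * norm (R
          z x)"
        by (metis norm_scaleC norm_triangle_ineq)
      also have "\<dots> \<le> (cmod z + 1) * (K * cmod (w - z) * norm x) + cmod (w - z) * (C *
          norm x)"
        using elim w op_boundD(3)[OF C] K(1) by (intro add_mono mult_mono) auto
      finally show "norm (Y w x - Y z x) \<le> ((cmod z + 1) * K + C) * cmod (w - z) * norm x"
        by (simp add: algebra_simps)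
    qed
  qed
  then show ?thesis
    unfolding op_lip_def using K(1) op_boundD(4)[OF C] by (intro exI[of _ "(cmod z + 1) * K + C"])
        auto
qed

lemma op_bound_funpow: "op_bound T C \<Longrightarrow> op_bound (T ^^ n) (C ^ n)"
proof (induction n)
  case 0
  then show ?case by (simp add: op_bound_def)
next
  case (Suc n)
  then show ?case using op_bound_comp[of T C "T ^^ n" "C ^ n"] by (simp add: o_def)
qed

lemma Y_pow_lip:
  assumes z: "z \<in> \<Lambda>"
  shows "op_lip (\<lambda>w. Y w ^^ n) z"
proof (induction n)
  case 0
  show ?case by (auto simp: op_lip_def intro!: exI[of _ 0])
next
  case (Suc n)
  obtain C where C: "op_bound (R z) C" using resolvent_bound[OF z] by blast
  have lin: "\<forall>\<^sub>F w in at z. \<forall>x y. Y w (x - y) = Y w x - Y w y"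
    using eventually_in_\<Lambda>[OF z]
    by eventually_elim (simp add: Y_def resolvent_linear scaleC_diff_right)
  have "op_lip (\<lambda>w x. Y w ((Y w ^^ n) x)) z"
    by (rule op_lip_comp[OF Y_lip[OF z] Y_bound[OF z C] lin Suc op_bound_funpow[OF Y_bound[OF z
        C]]])
  then show ?case by (simp add: o_def)
qed

text \<open>The two forms of the resolvent identity with 0 make R(0) commute with Y(z). Derivatives
  of the resolvent at every z are thereby reduced to one operator at 0.\<close>

lemma resolvent_pow_Y:
  assumes "z \<in> \<Lambda>"
  shows "(R z ^^ n) x = (Y z ^^ n) ((R 0 ^^ n) x)"
proof -
  have comm: "R 0 (Y z x) = Y z (R 0 x)" for x
    using resolvent_eq_Y[OF assms, of x] by simp
  have comm': "R 0 ((Y z ^^ n) x) = (Y z ^^ n) (R 0 x)" for n x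
    by (induction n) (simp_all add: comm)
  show ?thesis
  proof (induction n)
    case (Suc n)
    have "(R z ^^ Suc n) x = Y z (R 0 ((R z ^^ n) x))"
      using resolvent_eq_Y(1)[OF assms, of "(R z ^^ n) x"] by simp
    then show ?case by (simp only: Suc comm') simp
  qed simp
qed

text \<open>A quadratic error bound, so that the estimate passes to products by induction.\<close>

lemma resolvent_pow_estimate:
  assumes z: "z \<in> \<Lambda>"
  shows "\<exists>C\<ge>0. \<forall>\<^sub>F w in at z. \<forall>x. norm ((R w ^^ n) x - (R z ^^ n)
      x - (of_nat n * (w - z)) *\<^sub>C (R z ^^ Suc n) x)
      \<le> C * (cmod (w - z))\<^sup>2 * norm x"
proof (induction n)
  case 0
  show ?case by (auto intro!: exI[of _ 0])
next
  case (Suc n)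
  then obtain C where C: "C \<ge> 0" "\<forall>\<^sub>F w in at z. \<forall>x. norm ((R w ^^ n) x -
      (R z ^^ n) x - (of_nat n * (w - z)) *\<^sub>C (R z ^^ Suc n) x)
      \<le> C * (cmod (w - z))\<^sup>2 * norm x" by blast
  obtain B where B: "op_bound (R z) B" using resolvent_bound[OF z] by blast
  obtain K where K: "K \<ge> 0" "\<forall>\<^sub>F w in at z. \<forall>x. norm (R w x - R z x)
      \<le> K * cmod (w - z) * norm x"
    using resolvent_lip[OF z] unfolding op_lip_def by blast
  obtain M where M: "M \<ge> 0" "\<forall>\<^sub>F w in at z. \<forall>x. norm (R w x) \<le> M *
      norm x"
    using op_lip_locally_bounded[OF resolvent_lip[OF z] B] by blast
  note Bn = op_bound_funpow[OF B]
  have B0: "B \<ge> 0" using op_boundD(4)[OF B] .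
  have "\<forall>\<^sub>F w in at z. \<forall>x. norm ((R w ^^ Suc n) x - (R z ^^ Suc n) x -
      (of_nat (Suc n) * (w - z)) *\<^sub>C (R z ^^ Suc (Suc n)) x)
      \<le> (C * M + B ^ n * (K * B) + n * B ^ Suc n * K) * (cmod (w - z))\<^sup>2 * norm x"
    using C(2) K(2) M(2) eventually_in_\<Lambda>[OF z]
  proof eventually_elim
    case (elim w)
    show ?case
    proof
      fix x
      define h where "h = w - z"
      define a where "a = R w x"
      \<comment> \<open>The error d is of first order in h, and e, defined next, is of second order
        by the Lipschitz bound applied to R w - R z.\<close>
      define d where "d = a - R z x"
      define e where "e = d - h *\<^sub>C R z (R z x)"
      have pow: "(R w ^^ Suc n) x = (R w ^^ n) a" "(R z ^^ Suc n) x = (R z ^^ n) (R z x)"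
        "(R z ^^ Suc (Suc n)) x = (R z ^^ n) (R z (R z x))" "(R z ^^ Suc (Suc n)) x = (R z ^^ Suc
            n) (R z x)"
        by (simp_all add: funpow_swap1 a_def)
      have d: "d = h *\<^sub>C R w (R z x)"
        unfolding d_def a_def h_def by (rule resolvent_identity[OF elim(4) z])
      have e: "e = h *\<^sub>C (R w (R z x) - R z (R z x))"
        unfolding e_def d by (simp add: scaleC_diff_right)
      have ad: "a = R z x + d" by (simp add: d_def)
      have de: "d = h *\<^sub>C R z (R z x) + e" by (simp add: e_def)
      \<comment> \<open>The induction hypothesis is applied at a = R w x rather than at R z x; the
        second summand corrects for this and is quadratic in h.\<close>
      have eqn: "(R w ^^ Suc n) x - (R z ^^ Suc n) x - (of_nat (Suc n) * h) *\<^sub>C (R z ^^ Suc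
          (Suc n)) x =
        ((R w ^^ n) a - (R z ^^ n) a - (of_nat n * h) *\<^sub>C (R z ^^ Suc n) a) +
        ((R z ^^ n) e + (of_nat n * h) *\<^sub>C (R z ^^ Suc n) d)"
      proof -
        have 1: "(R z ^^ n) a = (R z ^^ Suc n) x + h *\<^sub>C (R z ^^ Suc (Suc n)) x + (R z ^^ n)
            e"
          unfolding pow(2,3) ad by (subst de) (simp only: op_boundD(1,2)[OF Bn] add.assoc)
        have 2: "(R z ^^ Suc n) a = (R z ^^ Suc (Suc n)) x + (R z ^^ Suc n) d"
          unfolding pow(4) ad by (simp only: op_boundD(1)[OF Bn])
        show ?thesis
          unfolding pow(1) 1 2 by (simp add: scaleC_add_right scaleC_add_left algebra_simps del:
              funpow.simps)
      qed
      have "norm ((R w ^^ Suc n) x - (R z ^^ Suc n) x - (of_nat (Suc n) * h) *\<^sub>C (R z ^^ Suc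
          (Suc n)) x) \<le>
        norm ((R w ^^ n) a - (R z ^^ n) a - (of_nat n * h) *\<^sub>C (R z ^^ Suc n) a) +
        (norm ((R z ^^ n) e) + norm ((of_nat n * h) *\<^sub>C (R z ^^ Suc n) d))"
        unfolding eqn by (rule order_trans[OF norm_triangle_ineq add_left_mono[OF
            norm_triangle_ineq]])
      also have "\<dots> \<le> C * (cmod h)\<^sup>2 * (M * norm x) + (B ^ n * (cmod h * (K * cmod h
          * (B * norm x))) + n * cmod h * (B ^ Suc n * (K * cmod h * norm x)))"
      proof (intro add_mono)
        have "norm ((R w ^^ n) a - (R z ^^ n) a - (of_nat n * h) *\<^sub>C (R z ^^ Suc n) a) \<le>
            C * (cmod h)\<^sup>2 * norm a"
          using elim(1) by (simp add: h_def)
        also have "\<dots> \<le> C * (cmod h)\<^sup>2 * (M * norm x)"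
          using elim(3) C(1) by (intro mult_left_mono) (auto simp: a_def)
        finally show "norm ((R w ^^ n) a - (R z ^^ n) a - (of_nat n * h) *\<^sub>C (R z ^^ Suc n)
            a) \<le> C * (cmod h)\<^sup>2 * (M * norm x)" .
        have "norm e \<le> cmod h * (K * cmod h * norm (R z x))"
          unfolding e norm_scaleC using elim(2) by (intro mult_left_mono) (auto simp: h_def)
        also have "\<dots> \<le> cmod h * (K * cmod h * (B * norm x))"
          using op_boundD(3)[OF B] K(1) by (intro mult_left_mono) auto
        finally have "B ^ n * norm e \<le> B ^ n * (cmod h * (K * cmod h * (B * norm x)))"
          using B0 by (intro mult_left_mono) auto
        then show "norm ((R z ^^ n) e) \<le> B ^ n * (cmod h * (K * cmod h * (B * norm x)))"
          using op_boundD(3)[OF Bn, of n e] by linarith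
        have "norm d \<le> K * cmod h * norm x" using elim(2) by (simp add: d_def a_def h_def)
        then have "B ^ Suc n * norm d \<le> B ^ Suc n * (K * cmod h * norm x)"
          using B0 by (intro mult_left_mono) auto
        then have "norm ((R z ^^ Suc n) d) \<le> B ^ Suc n * (K * cmod h * norm x)"
          using op_boundD(3)[OF Bn, of "Suc n" d] by linarith
        then show "norm ((of_nat n * h) *\<^sub>C (R z ^^ Suc n) d) \<le> n * cmod h * (B ^ Suc n *
            (K * cmod h * norm x))"
          unfolding norm_scaleC norm_mult norm_of_nat by (intro mult_left_mono) auto
      qed
      also have "\<dots> = (C * M + B ^ n * (K * B) + n * B ^ Suc n * K) * (cmod h)\<^sup>2 * norm
          x"
        by (simp add: algebra_simps power2_eq_square)
      finally show "norm ((R w ^^ Suc n) x - (R z ^^ Suc n) x - (of_nat (Suc n) * (w - z))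
          *\<^sub>C (R z ^^ Suc (Suc n)) x)
        \<le> (C * M + B ^ n * (K * B) + n * B ^ Suc n * K) * (cmod (w - z))\<^sup>2 * norm x"
        unfolding h_def .
    qed
  qed
  moreover have "C * M + B ^ n * (K * B) + n * B ^ Suc n * K \<ge> 0"
    using C(1) M(1) K(1) B0 by simp
  ultimately show ?case by blast
qed

lemma has_op_derivative_resolvent_pow:
  assumes z: "z \<in> \<Lambda>"
  shows "has_op_derivative (\<lambda>w x. c *\<^sub>C (R w ^^ n) x) (\<lambda>x. (c * of_nat n)
      *\<^sub>C (R z ^^ Suc n) x) z"
  unfolding has_op_derivative_def
proof (intro conjI allI impI)
  obtain B where B: "op_bound (R z) B" using resolvent_bound[OF z] by blast
  have "op_bound (\<lambda>x. d *\<^sub>C x :: 'h) (cmod d)" for d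
    by (simp add: op_bound_def scaleC_add_right scaleC_scaleC norm_scaleC mult.commute)
  from op_bound_comp[OF this op_bound_funpow[OF B]]
  show "bounded_op_on UNIV (\<lambda>x. (c * of_nat n) *\<^sub>C (R z ^^ Suc n) x)"
    unfolding bounded_op_on_UNIV_iff by blast
  fix \<epsilon> :: real assume \<epsilon>: "\<epsilon> > 0"
  obtain C where C: "C \<ge> 0" "\<forall>\<^sub>F w in at z. \<forall>x. norm ((R w ^^ n) x - (R z
      ^^ n) x - (of_nat n * (w - z)) *\<^sub>C (R z ^^ Suc n) x)
      \<le> C * (cmod (w - z))\<^sup>2 * norm x" using resolvent_pow_estimate[OF z] by blast
  have "\<epsilon> / (cmod c * C + 1) > 0" using \<epsilon> C(1) by (simp add: add_nonneg_pos)
  from C(2) eventually_close[OF this]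
  show "\<forall>\<^sub>F w in at z. \<forall>x. norm (c *\<^sub>C (R w ^^ n) x - c *\<^sub>C (R z
      ^^ n) x - (w - z) *\<^sub>C (c * of_nat n) *\<^sub>C (R z ^^ Suc n) x)
      \<le> \<epsilon> * cmod (w - z) * norm x"
  proof eventually_elim
    case (elim w)
    show ?case
    proof
      fix x
      have "c *\<^sub>C (R w ^^ n) x - c *\<^sub>C (R z ^^ n) x - (w - z) *\<^sub>C (c * of_nat n)
          *\<^sub>C (R z ^^ Suc n) x =
          c *\<^sub>C ((R w ^^ n) x - (R z ^^ n) x - (of_nat n * (w - z)) *\<^sub>C (R z ^^ Suc n)
              x)"
        by (simp add: scaleC_diff_right scaleC_scaleC mult_ac del: funpow.simps)
      then have "norm (c *\<^sub>C (R w ^^ n) x - c *\<^sub>C (R z ^^ n) x - (w - z) *\<^sub>C (c *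
          of_nat n) *\<^sub>C (R z ^^ Suc n) x) \<le>
          cmod c * (C * (cmod (w - z))\<^sup>2 * norm x)"
        using elim(1) by (simp add: norm_scaleC mult_left_mono del: funpow.simps)
      also have "\<dots> = (cmod c * C * cmod (w - z)) * cmod (w - z) * norm x"
        by (simp add: power2_eq_square)
      also have "\<dots> \<le> \<epsilon> * cmod (w - z) * norm x"
      proof (intro mult_right_mono)
        have "cmod c * C * cmod (w - z) \<le> (cmod c * C + 1) * cmod (w - z)"
          by (intro mult_right_mono) auto
        also have "\<dots> \<le> \<epsilon>"
          using elim(2) C(1) by (simp add: pos_less_divide_eq add_nonneg_pos mult.commute)
        finally show "cmod c * C * cmod (w - z) \<le> \<epsilon>" .
      qed auto
      finally show "norm (c *\<^sub>C (R w ^^ n) x - c *\<^sub>C (R z ^^ n) x - (w - z) *\<^sub>C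
          (c * of_nat n) *\<^sub>C (R z ^^ Suc n) x)
          \<le> \<epsilon> * cmod (w - z) * norm x" .
    qed
  qed
qed

end

section \<open>Iterated derivatives of the resolvent and its matrix coefficients\<close>

lemma has_op_derivative_unique:
  assumes "has_op_derivative F D z" "has_op_derivative F D' z"
  shows "D = D'"
proof
  fix x
  have "norm (D x - D' x) \<le> \<epsilon>" if "\<epsilon> > 0" for \<epsilon>
  proof -
    define \<epsilon>' where "\<epsilon>' = \<epsilon> / (2 * (norm x + 1))"
    have n1: "norm x + 1 > 0" by (simp add: add_nonneg_pos)
    then have \<epsilon>': "\<epsilon>' > 0" using that by (simp add: \<epsilon>'_def)
    have ev: "\<forall>\<^sub>F w in at z. norm (F w x - F z x - (w - z) *\<^sub>C D x) \<le>
        \<epsilon>' * cmod (w - z) * norm x"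
      if "has_op_derivative F D z" for D
    proof -
      have "\<forall>\<^sub>F w in at z. \<forall>x. norm (F w x - F z x - (w - z) *\<^sub>C D x)
          \<le> \<epsilon>' * cmod (w - z) * norm x"
        using that \<epsilon>' unfolding has_op_derivative_def by blast
      then show ?thesis by (rule eventually_mono) blast
    qed
    note ev[OF assms(1)] ev[OF assms(2)]
    moreover have "\<forall>\<^sub>F w in at z. w \<noteq> z" by (simp add: eventually_at_filter)
    ultimately have "\<forall>\<^sub>F w in at z. norm (D x - D' x) \<le> \<epsilon>"
    proof eventually_elim
      case (elim w)
      have eq: "(w - z) *\<^sub>C (D x - D' x) = (F w x - F z x - (w - z) *\<^sub>C D' x) - (F w x
          - F z x - (w - z) *\<^sub>C D x)"
        by (simp add: scaleC_diff_right)
      have "norm ((w - z) *\<^sub>C (D x - D' x)) \<le> \<epsilon>' * cmod (w - z) * norm x +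
          \<epsilon>' * cmod (w - z) * norm x"
        unfolding eq by (rule order_trans[OF norm_triangle_ineq4 add_mono[OF elim(2) elim(1)]])
      then have "cmod (w - z) * norm (D x - D' x) \<le> \<epsilon>' * cmod (w - z) * norm x +
          \<epsilon>' * cmod (w - z) * norm x"
        by (simp only: norm_scaleC)
      then have "cmod (w - z) * norm (D x - D' x) \<le> cmod (w - z) * (2 * \<epsilon>' * norm x)"
        by (simp add: algebra_simps)
      then have "norm (D x - D' x) \<le> 2 * \<epsilon>' * norm x"
        using elim by simp
      also have "\<dots> \<le> 2 * \<epsilon>' * (norm x + 1)" using \<epsilon>' by simp
      also have "\<dots> = \<epsilon>" using n1 by (simp add: \<epsilon>'_def field_simps)
      finally show ?case .
    qed
    then show ?thesis by simp
  qed
  then have "norm (D x - D' x) \<le> 0" by (rule field_le_epsilon) simp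
  then show "D x = D' x" by simp
qed

lemma op_deriv_eqI: "has_op_derivative F D z \<Longrightarrow> op_deriv F z = D"
  unfolding op_deriv_def using has_op_derivative_unique by blast

lemma has_op_derivative_transform:
  assumes "has_op_derivative F D z" "open S" "z \<in> S" "\<And>w. w \<in> S \<Longrightarrow> F w
      = G w"
  shows "has_op_derivative G D z"
proof -
  have ev: "eventually (\<lambda>w. w \<in> S) (at z)" using assms(2,3) by (rule
      eventually_at_in_open')
  have "\<forall>\<^sub>F w in at z. \<forall>x. norm (G w x - G z x - (w - z) *\<^sub>C D x) \<le>
      \<epsilon> * cmod (w - z) * norm x" if "\<epsilon> > 0" for \<epsilon>
  proof -
    have "\<forall>\<^sub>F w in at z. \<forall>x. norm (F w x - F z x - (w - z) *\<^sub>C D x)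
        \<le> \<epsilon> * cmod (w - z) * norm x"
      using assms(1) that unfolding has_op_derivative_def by blast
    then show ?thesis
      using ev by eventually_elim (use assms(3,4) in simp)
  qed
  then show ?thesis using assms(1) unfolding has_op_derivative_def by blast
qed

context cut_operator begin

text \<open>The induction runs over all z of the open region at once: the next derivative at a point
  requires the formula in a neighbourhood of it.\<close>

lemma op_deriv_pow_resolvent:
  "z \<in> \<Lambda> \<Longrightarrow> (op_deriv ^^ m) R z = (\<lambda>x. fact m *\<^sub>C (R z ^^
      Suc m) x)"
proof (induction m arbitrary: z)
  case (Suc m)
  have "has_op_derivative (\<lambda>w x. fact m *\<^sub>C (R w ^^ Suc m) x) (\<lambda>x. (fact m *
      of_nat (Suc m)) *\<^sub>C (R z ^^ Suc (Suc m)) x) z"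
    by (rule has_op_derivative_resolvent_pow[OF Suc.prems])
  then have "has_op_derivative ((op_deriv ^^ m) R) (\<lambda>x. (fact m * of_nat (Suc m)) *\<^sub>C
      (R z ^^ Suc (Suc m)) x) z"
    by (rule has_op_derivative_transform[OF _ open_cut_region Suc.prems]) (simp only: Suc.IH)
  from op_deriv_eqI[OF this] show ?case
    by (simp add: mult.commute del: of_nat_Suc)
qed (simp add: fun_eq_iff)

text \<open>The j-th derivative in z of <R(z)e, e> in closed form, so that no choice operator
  appears in the contour integrals.\<close>

definition P :: "'h \<Rightarrow> nat \<Rightarrow> complex \<Rightarrow> complex" where
  "P e j z = fact j * cinner ((R z ^^ Suc j) e) e"

lemma P_eq: "z \<in> \<Lambda> \<Longrightarrow> P e j z = cinner ((op_deriv ^^ j) R z e) e"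
  by (simp add: P_def op_deriv_pow_resolvent cinner_scaleC_left del: funpow.simps)

lemma has_field_derivative_P:
  assumes z: "z \<in> \<Lambda>"
  shows "(P e j has_field_derivative P e (Suc j) z) (at z)"
proof -
  obtain C where C: "C \<ge> 0" "\<forall>\<^sub>F w in at z. \<forall>x. norm ((R w ^^ Suc j) x -
      (R z ^^ Suc j) x - (of_nat (Suc j) * (w - z)) *\<^sub>C (R z ^^ Suc (Suc j)) x)
      \<le> C * (cmod (w - z))\<^sup>2 * norm x" using resolvent_pow_estimate[OF z] by blast
  define f where "f w = cinner ((R w ^^ Suc j) e) e" for w
  define D where "D = of_nat (Suc j) * cinner ((R z ^^ Suc (Suc j)) e) e"
  have "((\<lambda>w. (f w - f z) / (w - z) - D) \<longlongrightarrow> 0) (at z)"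
  proof (rule Lim_null_comparison)
    have "((\<lambda>w. C * cmod (w - z) * norm e * norm e) \<longlongrightarrow> C * cmod (z - z)
        * norm e * norm e) (at z)"
      by (intro tendsto_intros)
    then show "((\<lambda>w. C * cmod (w - z) * norm e * norm e) \<longlongrightarrow> 0) (at z)"
        by simp
    have "\<forall>\<^sub>F w in at z. w \<noteq> z" by (simp add: eventually_at_filter)
    with C(2) show "\<forall>\<^sub>F w in at z. norm ((f w - f z) / (w - z) - D) \<le> C * cmod (w
        - z) * norm e * norm e"
    proof eventually_elim
      case (elim w)
      define v where "v = (R w ^^ Suc j) e - (R z ^^ Suc j) e - (of_nat (Suc j) * (w - z))
          *\<^sub>C (R z ^^ Suc (Suc j)) e"
      have "cinner v e = f w - f z - (w - z) * D"
        unfolding v_def cinner_diff_left cinner_scaleC_left f_def D_def by (simp only: mult_ac)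
      then have "(f w - f z) / (w - z) - D = cinner v e / (w - z)"
        using elim(2) by (simp add: field_simps)
      moreover have "norm (cinner v e) \<le> C * (cmod (w - z))\<^sup>2 * norm e * norm e"
        using cinner_Cauchy_Schwarz[of v e] elim(1)[rule_format, of e] mult_right_mono[of "norm v"
            _ "norm e"]
        unfolding v_def by (meson norm_ge_zero order_trans)
      ultimately have "norm ((f w - f z) / (w - z) - D) \<le> C * (cmod (w - z))\<^sup>2 * norm e *
          norm e / cmod (w - z)"
        by (simp add: norm_divide divide_right_mono)
      also have "\<dots> = C * cmod (w - z) * norm e * norm e"
        using elim(2) by (simp add: power2_eq_square)
      finally show ?case .
    qed
  qed
  then have "(f has_field_derivative D) (at z)"
    unfolding has_field_derivative_iff using LIM_zero_iff by blast
  then have "((\<lambda>w. fact j * f w) has_field_derivative fact j * D) (at z)"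
    by (rule DERIV_cmult)
  then show ?thesis
    by (simp add: P_def[abs_def] f_def[abs_def] D_def mult_ac del: funpow.simps of_nat_Suc)
qed

lemma P_holomorphic: "P e j holomorphic_on \<Lambda>"
  using has_field_derivative_P open_cut_region holomorphic_on_open by blast

lemma deriv_P: "z \<in> \<Lambda> \<Longrightarrow> deriv (P e j) z = P e (Suc j) z"
  using has_field_derivative_P DERIV_imp_deriv by blast

end

section \<open>Traces along the contour\<close>

definition trace_basis :: "'h::chilbert_space set" where
  "trace_basis = (SOME E. orthonormal_basis UNIV E)"

lemma op_trace_eq: "op_trace UNIV T = (\<Sum>\<^sub>\<infinity>e\<in>trace_basis. cinner (T e) e)"
  by (simp add: op_trace_def trace_basis_def)

text \<open>The choice is meaningful once a basis exists; the definition of a trace class operator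
  provides one.\<close>

lemma trace_basis:
  assumes "trace_class UNIV (T :: 'h::chilbert_space \<Rightarrow> 'h)"
  shows "orthonormal_basis UNIV (trace_basis :: 'h set)"
proof -
  have "\<exists>E :: 'h set. orthonormal_basis UNIV E" using assms by (auto simp: trace_class_def)
  then show ?thesis unfolding trace_basis_def by (rule someI_ex)
qed

lemma trace_basis_bound:
  fixes T :: "'h::chilbert_space \<Rightarrow> 'h"
  assumes "trace_class UNIV T"
  obtains \<tau> where "0 \<le> \<tau>"
    "\<And>X Z CX CZ F. op_bound X CX \<Longrightarrow> op_bound Z CZ \<Longrightarrow> F
        \<subseteq> trace_basis \<Longrightarrow> finite F \<Longrightarrow>
       (\<Sum>e\<in>F. cmod (cinner (Z (T (X e))) e)) \<le> CX * CZ * \<tau>"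
proof -
  have on: "orthonormal F" if "F \<subseteq> trace_basis" for F :: "'h set"
    using orthonormal_subset[OF orthonormal_basis_imp_orthonormal[OF trace_basis[OF assms]] that] .
  obtain \<tau> where \<tau>: "0 \<le> \<tau>" "\<And>X Z CX CZ F. op_bound X CX \<Longrightarrow>
      op_bound Z CZ \<Longrightarrow> orthonormal F \<Longrightarrow> finite F \<Longrightarrow>
       (\<Sum>e\<in>F. cmod (cinner (Z (T (X e))) e)) \<le> CX * CZ * \<tau>"
  proof (rule trace_class_bound[OF assms], goal_cases)
    case (1 \<tau>)
    show ?case by (rule 1(1)[OF 1(2-)])
  qed
  show ?thesis
    by (rule that[OF \<tau>(1) \<tau>(2)[OF _ _ on]])
qed

lemma norm_infsum_le:
  fixes g :: "'a \<Rightarrow> complex"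
  assumes "\<And>F. finite F \<Longrightarrow> F \<subseteq> E \<Longrightarrow> (\<Sum>e\<in>F.
      cmod (g e)) \<le> b"
  shows "g summable_on E" "cmod (infsum g E) \<le> b"
proof -
  have n: "(\<lambda>e. norm (g e)) summable_on E"
    by (rule nonneg_bdd_above_summable_on) (use assms in \<open>auto simp: bdd_above_def\<close>)
  show "g summable_on E" by (rule abs_summable_summable[OF n])
  have "cmod (infsum g E) \<le> infsum (\<lambda>e. norm (g e)) E" by (rule norm_infsum_bound[OF n])
  also have "\<dots> \<le> b" by (rule infsum_le_finite_sums[OF n assms])
  finally show "cmod (infsum g E) \<le> b" .
qed

lemma mero_extension_unique:
  assumes "F nicely_meromorphic_on UNIV" "G nicely_meromorphic_on UNIV" "\<And>s. Re s > b
      \<Longrightarrow> F s = G s"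
  shows "F = G"
proof
  fix s
  show "F s = G s"
    by (rule nicely_meromorphic_eqI[of F "Re s - 1" G b])
       (use assms in \<open>auto intro: nicely_meromorphic_on_subset\<close>)
qed

section \<open>Uniform resolvent bounds on the contour\<close>

context cut_operator begin

lemma op_lip_tendsto:
  assumes "op_lip F z"
  shows "((\<lambda>w. F w x) \<longlongrightarrow> F z x) (at z)"
proof -
  obtain K where K: "K \<ge> 0" "\<forall>\<^sub>F w in at z. \<forall>x. norm (F w x - F z x)
      \<le> K * cmod (w - z) * norm x"
    using assms unfolding op_lip_def by blast
  have "((\<lambda>w. F w x - F z x) \<longlongrightarrow> 0) (at z)"
  proof (rule Lim_null_comparison)
    have "((\<lambda>w. K * cmod (w - z) * norm x) \<longlongrightarrow> K * cmod (z - z) * norm x)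
        (at z)"
      by (intro tendsto_intros)
    then show "((\<lambda>w. K * cmod (w - z) * norm x) \<longlongrightarrow> 0) (at z)" by simp
    show "\<forall>\<^sub>F w in at z. norm (F w x - F z x) \<le> K * cmod (w - z) * norm x"
      using K(2) by (rule eventually_mono) blast
  qed
  then show ?thesis by (rule LIM_zero_cancel)
qed

lemma continuous_on_resolvent: "continuous_on \<Lambda> (\<lambda>z. R z x)"
  unfolding continuous_on_eq_continuous_at[OF open_cut_region] isCont_def
  using op_lip_tendsto[OF resolvent_lip] by blast

lemma onorm_le_add:
  assumes "bounded_linear F" "bounded_linear G" "b \<ge> 0" "\<And>x. norm (F x - G x) \<le> b *
      norm x"
  shows "onorm F \<le> onorm G + b"
proof (rule onorm_bound)
  show "0 \<le> onorm G + b" using onorm_pos_le[OF assms(2)] assms(3) by simp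
  fix x
  have "norm (F x) \<le> norm (G x) + norm (F x - G x)"
    by (metis add.commute diff_add_cancel norm_triangle_ineq)
  also have "\<dots> \<le> onorm G * norm x + b * norm x"
    by (intro add_mono onorm assms)
  finally show "norm (F x) \<le> (onorm G + b) * norm x" by (simp add: algebra_simps)
qed

lemma continuous_on_onorm: "continuous_on \<Lambda> (\<lambda>z. onorm (R z))"
  unfolding continuous_on_eq_continuous_at[OF open_cut_region] isCont_def
proof
  fix z assume z: "z \<in> \<Lambda>"
  obtain K where K: "K \<ge> 0" "\<forall>\<^sub>F w in at z. \<forall>x. norm (R w x - R z x)
      \<le> K * cmod (w - z) * norm x"
    using resolvent_lip[OF z] unfolding op_lip_def by blast
  have "((\<lambda>w. onorm (R w) - onorm (R z)) \<longlongrightarrow> 0) (at z)"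
  proof (rule Lim_null_comparison)
    have "((\<lambda>w. K * cmod (w - z)) \<longlongrightarrow> K * cmod (z - z)) (at z)"
      by (intro tendsto_intros)
    then show "((\<lambda>w. K * cmod (w - z)) \<longlongrightarrow> 0) (at z)" by simp
    show "\<forall>\<^sub>F w in at z. norm (onorm (R w) - onorm (R z)) \<le> K * cmod (w - z)"
      using K(2) eventually_in_\<Lambda>[OF z]
    proof eventually_elim
      case (elim w)
      note bl = resolvent_bounded_linear[OF elim(2)] resolvent_bounded_linear[OF z]
      have nn: "0 \<le> K * cmod (w - z)" using K(1) by simp
      have "onorm (R w) \<le> onorm (R z) + K * cmod (w - z)"
        by (rule onorm_le_add[OF bl nn]) (use elim(1) in blast)
      moreover have "onorm (R z) \<le> onorm (R w) + K * cmod (w - z)"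
        by (rule onorm_le_add[OF bl(2,1) nn]) (use elim(1) norm_minus_commute in metis)
      ultimately show ?case by simp
    qed
  qed
  then show "((\<lambda>w. onorm (R w)) \<longlongrightarrow> onorm (R z)) (at z)" by (rule
      LIM_zero_cancel)
qed

text \<open>Far out on the ray the decay O(1/|z|) bounds R(z) as well as z R(z); the remaining part
  of the contour is compact and the operator norm is continuous on it.\<close>

lemma contour_bounds:
  assumes \<rho>: "0 < \<rho>" "\<rho> < \<rho>\<^sub>0"
  obtains M where "\<And>z. z \<in> contour_set \<theta> \<rho> \<Longrightarrow> op_bound (R z) M"
      "\<And>z. z \<in> contour_set \<theta> \<rho> \<Longrightarrow> op_bound (Y z) M"
proof -
  note sub = contour_set_subset_cut_region[OF delta_pos \<rho>, of \<theta>]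
  have "(\<lambda>z. onorm (R z)) \<in> O[at_infinity_within \<Lambda>](\<lambda>z. 1 / cmod z)"
    using cut by (simp add: spectral_cut_on_def)
  then obtain C where "eventually (\<lambda>z. norm (onorm (R z)) \<le> C * norm (1 / cmod z))
      (at_infinity_within \<Lambda>)"
    using landau_o.bigE by blast
  then obtain B where bB: "\<forall>z\<in>\<Lambda>. B \<le> cmod z \<longrightarrow> norm (onorm
      (R z)) \<le> C * norm (1 / cmod z)"
    unfolding eventually_at_infinity_within ..
  have B: "onorm (R z) \<le> \<bar>C\<bar> / cmod z" if "z \<in> \<Lambda>" "B \<le> cmod z" for z
  proof -
    have "onorm (R z) \<le> C * norm (1 / cmod z)"
      using bB[rule_format, OF that] by (simp only: real_norm_def abs_le_iff)
    also have "\<dots> \<le> \<bar>C\<bar> * norm (1 / cmod z)" by (intro mult_right_mono) auto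
    finally show ?thesis by simp
  qed
  define b where "b = max \<rho> B"
  define K where "K = (\<lambda>r. rcis r \<theta>) ` {\<rho>..b} \<union> sphere 0 \<rho>"
  have K: "compact K" "K \<subseteq> contour_set \<theta> \<rho>"
    unfolding K_def contour_set_def by (auto intro!: compact_Un compact_continuous_image
        continuous_intros)
  have "bounded ((\<lambda>z. onorm (R z)) ` K)"
    by (intro compact_imp_bounded compact_continuous_image continuous_on_subset[OF
        continuous_on_onorm] K)
       (use K sub in auto)
  then obtain m where m: "\<And>z. z \<in> K \<Longrightarrow> \<bar>onorm (R z)\<bar> \<le> m"
    unfolding bounded_iff by auto
  have "rcis \<rho> \<theta> \<in> K" using \<rho> by (simp add: K_def)
  then have m0: "m \<ge> 0" using m[of "rcis \<rho> \<theta>"] by linarith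
  have b0: "b > 0" using \<rho> by (simp add: b_def)
  define M where "M = 1 + m + \<bar>C\<bar> / \<rho> + b * m + \<bar>C\<bar>"
  have bd: "onorm (R z) \<le> m + \<bar>C\<bar> / \<rho> \<and> cmod z * onorm (R z) \<le> b * m +
      \<bar>C\<bar>" if z: "z \<in> contour_set \<theta> \<rho>" for z
  proof (cases "z \<in> K")
    case True
    have "cmod z \<le> b" using True \<rho> by (auto simp: K_def b_def)
    moreover have "onorm (R z) \<le> m" using m[OF True] by simp
    ultimately have "cmod z * onorm (R z) \<le> b * m"
      using m0 b0 onorm_pos_le[OF resolvent_bounded_linear] sub z by (intro mult_mono) auto
    then show ?thesis using \<open>onorm (R z) \<le> m\<close> \<rho> by (simp add: add_increasing2)
  next
    case False
    then obtain r where r: "z = rcis r \<theta>" "r \<ge> \<rho>"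
      using z unfolding K_def contour_set_def by blast
    have "r > b"
    proof (rule ccontr)
      assume "\<not> r > b"
      then have "z \<in> K" using r unfolding K_def by auto
      then show False using False by simp
    qed
    note r = r this
    have cz: "cmod z = r" using r \<rho> by simp
    have "onorm (R z) \<le> \<bar>C\<bar> / r"
    proof -
      have "z \<in> \<Lambda>" using sub z by blast
      from B[OF this] show ?thesis using r unfolding cz b_def by simp
    qed
    moreover have "\<bar>C\<bar> / r \<le> \<bar>C\<bar> / \<rho>" using r \<rho> by (intro
        divide_left_mono) auto
    moreover have "r * (\<bar>C\<bar> / r) = \<bar>C\<bar>" using r \<rho> by simp
    then have "r * onorm (R z) \<le> \<bar>C\<bar>"
      using mult_left_mono[OF \<open>onorm (R z) \<le> \<bar>C\<bar> / r\<close>, of r] r \<rho> by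
          simp
    ultimately show ?thesis using m0 b0 by (simp add: cz add_increasing)
  qed
  have nn: "\<bar>C\<bar> / \<rho> \<ge> 0" "b * m \<ge> 0" using \<rho> b0 m0 by auto
  show ?thesis
  proof (rule that[of M])
    fix z assume z: "z \<in> contour_set \<theta> \<rho>"
    then have z\<Lambda>: "z \<in> \<Lambda>" using sub by blast
    note ob = op_bound_resolvent_onorm[OF z\<Lambda>]
    show "op_bound (R z) M"
      by (rule op_bound_mono[OF ob]) (use bd[OF z] nn in \<open>auto simp: M_def\<close>)
    show "op_bound (Y z) M"
      by (rule op_bound_mono[OF Y_bound[OF z\<Lambda> ob]]) (use bd[OF z] nn m0 in \<open>auto
          simp: M_def\<close>)
  qed
qed

section \<open>Zeta functions of a single operator as contour integrals of traces\<close>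

lemma op_power_inner_P:
  assumes \<rho>: "0 < \<rho>" "\<rho> < \<rho>\<^sub>0" and s: "Re s > 1"
  shows "cinner (op_power \<theta> \<rho> A s e) y = \<i> / (2 * of_real pi) * contour_int \<theta>
      \<rho> s (\<lambda>z. cinner (R z e) y)"
proof -
  obtain M where M: "\<And>z. z \<in> contour_set \<theta> \<rho> \<Longrightarrow> op_bound (R z)
      M"
  proof (rule contour_bounds[OF \<rho>], goal_cases)
    case (1 M)
    show ?case by (rule 1(1)[OF 1(2)])
  qed
  show ?thesis
    by (rule op_power_inner[OF \<rho>(1) _ _ s, where M = "M * norm e"])
       (use M op_boundD(3) in \<open>auto intro: continuous_on_subset[OF continuous_on_resolvent
           contour_set_subset_cut_region[OF delta_pos \<rho>]]\<close>)
qed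

lemma norm_P_bound:
  assumes "op_bound (R z) M"
  shows "norm (P e j z) \<le> fact j * (M ^ Suc j * norm e * norm e)"
proof -
  have "cmod (cinner ((R z ^^ Suc j) e) e) \<le> norm ((R z ^^ Suc j) e) * norm e"
    by (rule cinner_Cauchy_Schwarz)
  also have "\<dots> \<le> M ^ Suc j * norm e * norm e"
    by (intro mult_right_mono op_boundD(3)[OF op_bound_funpow[OF assms]]) auto
  finally show ?thesis by (simp add: P_def norm_mult mult_left_mono del: funpow.simps)
qed

text \<open>Each integration by parts lowers s by one and raises the order of the derivative by one.
  The bound m + 2 keeps the real part above 2 before each of the m steps.\<close>

lemma contour_int_P:
  assumes \<rho>: "0 < \<rho>" "\<rho> < \<rho>\<^sub>0" and s: "Re s > real m + 2"
  shows "j \<le> m \<Longrightarrow> contour_int \<theta> \<rho> (s - of_nat j) (P e j) =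
      (\<Prod>i<j. s - of_nat (Suc i)) * contour_int \<theta> \<rho> s (P e 0)"
proof (induction j)
  case (Suc j)
  obtain M where M: "\<And>z. z \<in> contour_set \<theta> \<rho> \<Longrightarrow> op_bound (R z)
      M"
  proof (rule contour_bounds[OF \<rho>], goal_cases)
    case (1 M)
    show ?case by (rule 1(1)[OF 1(2)])
  qed
  note sub = contour_set_subset_cut_region[OF delta_pos \<rho>, of \<theta>]
  have "contour_int \<theta> \<rho> (s - of_nat j - 1) (deriv (P e j)) = (s - of_nat j - 1) *
      contour_int \<theta> \<rho> (s - of_nat j) (P e j)"
  proof (rule contour_int_by_parts[OF \<rho>(1) open_cut_region sub P_holomorphic])
    show "norm (P e j z) \<le> fact j * (M ^ Suc j * norm e * norm e)" if "z \<in> contour_set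
        \<theta> \<rho>" for z
      by (rule norm_P_bound[OF M[OF that]])
    show "norm (deriv (P e j) z) \<le> fact (Suc j) * (M ^ Suc (Suc j) * norm e * norm e)" if "z
        \<in> contour_set \<theta> \<rho>" for z
    proof -
      have "z \<in> \<Lambda>" using sub that by (rule subsetD)
      then show ?thesis using norm_P_bound[OF M[OF that], of e "Suc j"] by (simp only: deriv_P)
    qed
    have "real j < real m" using Suc.prems by simp
    then show "2 < Re (s - of_nat j)" using s by simp
  qed
  moreover have "contour_int \<theta> \<rho> (s - of_nat j - 1) (deriv (P e j)) = contour_int
      \<theta> \<rho> (s - of_nat j - 1) (P e (Suc j))"
    by (rule contour_int_cong[OF \<rho>(1)]) (use deriv_P sub in blast)
  moreover have "s - of_nat j - 1 = s - of_nat (Suc j)" by simp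
  ultimately show ?case
    using Suc by (simp add: mult.commute mult.left_commute del: of_nat_Suc)
qed simp

text \<open>The m-th derivative of the resolvent at z is Y(z)^(m+1) applied after the one at 0. A
  single trace class operator therefore controls the sums of matrix entries uniformly on the
  contour, and the interchange is made for the m-th derivative, where it is absolutely
  convergent.\<close>

lemma trace_pow:
  assumes \<rho>: "0 < \<rho>" "\<rho> < \<rho>\<^sub>0" and tc: "trace_class UNIV ((op_deriv ^^ m)
      R 0)"
  defines "f \<equiv> \<lambda>z. op_trace UNIV ((op_deriv ^^ m) R z)"
  shows "\<exists>M. contour_function \<theta> \<rho> f M"
    and "Re s > real m + 2 \<Longrightarrow> ((\<lambda>e. cinner (op_power \<theta> \<rho> A s e)
        e) has_sum
      \<i> / (2 * of_real pi) * contour_int \<theta> \<rho> (s - of_nat m) f / (\<Prod>i<m. s -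
          of_nat (Suc i))) trace_basis"
proof -
  define T0 where "T0 = (op_deriv ^^ m) R 0"
  note sub = contour_set_subset_cut_region[OF delta_pos \<rho>, of \<theta>]
  obtain M where M: "\<And>z. z \<in> contour_set \<theta> \<rho> \<Longrightarrow> op_bound (R z)
      M" "\<And>z. z \<in> contour_set \<theta> \<rho> \<Longrightarrow> op_bound (Y z) M"
  proof (rule contour_bounds[OF \<rho>], goal_cases)
    case (1 M)
    show ?case by (rule 1(1)[OF 1(2-)])
  qed
  obtain \<tau> where \<tau>: "0 \<le> \<tau>"
    "\<And>X Z CX CZ F. op_bound X CX \<Longrightarrow> op_bound Z CZ \<Longrightarrow> F
        \<subseteq> trace_basis \<Longrightarrow> finite F \<Longrightarrow>
       (\<Sum>e\<in>F. cmod (cinner (Z (T0 (X e))) e)) \<le> CX * CZ * \<tau>"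
  proof (rule trace_basis_bound[OF tc[folded T0_def]], goal_cases)
    case (1 \<tau>)
    show ?case by (rule 1(1)[OF 1(2-)])
  qed
  have id: "op_bound (\<lambda>x::'h. x) 1" by (simp add: op_bound_def)
  have PT: "P e m z = cinner ((Y z ^^ Suc m) (T0 e)) e" if "z \<in> \<Lambda>" for e z
  proof -
    obtain C where C: "op_bound (R z) C" using resolvent_bound[OF \<open>z \<in> \<Lambda>\<close>]
        by blast
    have "(Y z ^^ Suc m) (T0 e) = fact m *\<^sub>C (R z ^^ Suc m) e"
      unfolding T0_def op_deriv_pow_resolvent[OF zero_in_\<Lambda>] resolvent_pow_Y[OF \<open>z
          \<in> \<Lambda>\<close>]
      by (rule op_boundD(2)[OF op_bound_funpow[OF Y_bound[OF \<open>z \<in> \<Lambda>\<close> C]]])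
    then show ?thesis by (simp only: P_def cinner_scaleC_left)
  qed
  have f: "f z = (\<Sum>\<^sub>\<infinity>e\<in>trace_basis. P e m z)" if "z \<in> \<Lambda>" for z
    unfolding f_def op_trace_eq using P_eq[OF that] by simp
  have bd: "(\<Sum>e\<in>F. cmod (P e m z)) \<le> M ^ Suc m * \<tau>" if "finite F" "F \<subseteq>
      trace_basis" "z \<in> contour_set \<theta> \<rho>" for F z
  proof -
    have "z \<in> \<Lambda>" using sub that(3) by (rule subsetD)
    then show ?thesis
      using \<tau>(2)[OF id op_bound_funpow[OF M(2)[OF that(3)]] that(2,1), of "Suc m"] by (simp
          only: PT mult_1)
  qed
  have summ: "(\<lambda>e. P e m z) summable_on trace_basis" if "z \<in> \<Lambda>" for z
  proof -
    obtain C where C: "op_bound (R z) C" using resolvent_bound[OF \<open>z \<in> \<Lambda>\<close>]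
        by blast
    show ?thesis
      by (rule norm_infsum_le(1)) (use \<tau>(2)[OF id op_bound_funpow[OF Y_bound[OF that C]], of _
          "Suc m"] PT[OF that] in auto)
  qed
  \<comment> \<open>Continuity of the trace: the trace estimate is used with the difference of the
    powers of Y as left factor, whose norm is O(|w - z|).\<close>
  have fcont: "(f \<longlongrightarrow> f z) (at z)" if z: "z \<in> \<Lambda>" for z
  proof -
    obtain K where K: "K \<ge> 0" "\<forall>\<^sub>F w in at z. \<forall>x. norm ((Y w ^^ Suc m) x
        - (Y z ^^ Suc m) x) \<le> K * cmod (w - z) * norm x"
      using Y_pow_lip[OF z, of "Suc m"] unfolding op_lip_def by blast
    have "((\<lambda>w. f w - f z) \<longlongrightarrow> 0) (at z)"
    proof (rule Lim_null_comparison)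
      have "((\<lambda>w. K * cmod (w - z) * \<tau>) \<longlongrightarrow> K * cmod (z - z) *
          \<tau>) (at z)"
        by (intro tendsto_intros)
      then show "((\<lambda>w. K * cmod (w - z) * \<tau>) \<longlongrightarrow> 0) (at z)" by simp
      show "\<forall>\<^sub>F w in at z. norm (f w - f z) \<le> K * cmod (w - z) * \<tau>"
        using K(2) eventually_in_\<Lambda>[OF z]
      proof eventually_elim
        case (elim w)
        obtain C where C: "op_bound (Y w ^^ Suc m) C"
          using resolvent_bound[OF elim(2)] op_bound_funpow[OF Y_bound[OF elim(2)]] by blast
        obtain C' where C': "op_bound (Y z ^^ Suc m) C'"
          using resolvent_bound[OF z] op_bound_funpow[OF Y_bound[OF z]] by blast
        have ob: "op_bound (\<lambda>x. (Y w ^^ Suc m) x - (Y z ^^ Suc m) x) (K * cmod (w - z))"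
          unfolding op_bound_def
          using elim(1) K(1) by (simp add: op_boundD(1,2)[OF C] op_boundD(1,2)[OF C']
              scaleC_diff_right del: funpow.simps)
        have "f w - f z = (\<Sum>\<^sub>\<infinity>e\<in>trace_basis. P e m w - P e m z)"
        proof -
          have "((\<lambda>e. P e m w + - P e m z) has_sum f w + - f z) trace_basis"
            unfolding f[OF elim(2)] f[OF z]
            by (intro has_sum_add has_sum_infsum[OF summ[OF elim(2)]])
               (simp add: has_sum_uminus has_sum_infsum[OF summ[OF z]])
          from infsumI[OF this] show ?thesis by simp
        qed
        moreover have "cmod (\<Sum>\<^sub>\<infinity>e\<in>trace_basis. P e m w - P e m z) \<le> K
            * cmod (w - z) * \<tau>"
          by (rule norm_infsum_le(2))
             (use \<tau>(2)[OF id ob] in \<open>simp add: PT[OF elim(2)] PT[OF z] cinner_diff_left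
                 del: funpow.simps\<close>)
        ultimately show ?case by simp
      qed
    qed
    then show ?thesis by (rule LIM_zero_cancel)
  qed
  have "continuous_on \<Lambda> f"
    unfolding continuous_on_eq_continuous_at[OF open_cut_region] isCont_def using fcont by blast
  then have fc: "continuous_on (contour_set \<theta> \<rho>) f" by (rule continuous_on_subset[OF _
      sub])
  have "norm (f z) \<le> M ^ Suc m * \<tau>" if "z \<in> contour_set \<theta> \<rho>" for z
  proof -
    have "z \<in> \<Lambda>" using sub that by blast
    show ?thesis unfolding f[OF \<open>z \<in> \<Lambda>\<close>] by (rule norm_infsum_le(2)[OF
        bd[OF _ _ that]])
  qed
  then have "contour_function \<theta> \<rho> f (M ^ Suc m * \<tau>)"
    using \<rho>(1) fc by (simp add: contour_function_def)
  then show "\<exists>M. contour_function \<theta> \<rho> f M" ..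
  show "((\<lambda>e. cinner (op_power \<theta> \<rho> A s e) e) has_sum
      \<i> / (2 * of_real pi) * contour_int \<theta> \<rho> (s - of_nat m) f / (\<Prod>i<m. s -
          of_nat (Suc i))) trace_basis" if s: "Re s > real m + 2"
  proof -
    define c where "c = (\<Prod>i<m. s - of_nat (Suc i))"
    \<comment> \<open>The factors vanish only at s = 1, ..., m, left of the half plane
      considered.\<close>
    have c: "c \<noteq> 0"
    proof -
      have "s - of_nat (Suc i) \<noteq> 0" if "i < m" for i
      proof
        assume "s - of_nat (Suc i) = 0"
        then have "s = of_nat (Suc i)" by simp
        then have "Re s = real (Suc i)" by simp
        then show False using s that by simp
      qed
      then show ?thesis unfolding c_def by simp
    qed
    have "((\<lambda>e. contour_int \<theta> \<rho> (s - of_nat m) (P e m)) has_sum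
        contour_int \<theta> \<rho> (s - of_nat m) (\<lambda>z.
            \<Sum>\<^sub>\<infinity>e\<in>trace_basis. P e m z)) trace_basis"
      by (rule has_sum_contour_int[OF \<rho>(1) _ _ bd])
         (use s in \<open>auto intro: continuous_on_subset[OF holomorphic_on_imp_continuous_on[OF
             P_holomorphic] sub]\<close>)
    also have "contour_int \<theta> \<rho> (s - of_nat m) (\<lambda>z.
        \<Sum>\<^sub>\<infinity>e\<in>trace_basis. P e m z) = contour_int \<theta> \<rho> (s -
        of_nat m) f"
      by (rule contour_int_cong[OF \<rho>(1)]) (use f sub in auto)
    finally have "((\<lambda>e. (\<i> / (2 * of_real pi) / c) * contour_int \<theta> \<rho> (s -
        of_nat m) (P e m)) has_sum
        (\<i> / (2 * of_real pi) / c) * contour_int \<theta> \<rho> (s - of_nat m) f) trace_basis"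
      by (rule has_sum_cmult_right)
    moreover have "(\<i> / (2 * of_real pi) / c) * contour_int \<theta> \<rho> (s - of_nat m) (P e
        m) = cinner (op_power \<theta> \<rho> A s e) e" for e
    proof -
      have "cinner (op_power \<theta> \<rho> A s e) e = \<i> / (2 * of_real pi) * contour_int
          \<theta> \<rho> s (P e 0)"
        using op_power_inner_P[OF \<rho>, of s e e] s by (simp add: P_def[abs_def])
      then show ?thesis
        using contour_int_P[OF \<rho> s order_refl, of e] c by (simp add: c_def)
    qed
    ultimately show ?thesis by (simp add: c_def)
  qed
qed

text \<open>The zeta function at s is the continued contour integral F at s - m, divided by the
  product from the integrations by parts. Regularity at s = 0 is thus a statement about F at -m. The
  expansion may come from another cut region with the same \<theta>, since only its restriction to
  the ray enters.\<close>

lemma zeta_op_analytic: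
  assumes \<rho>: "0 < \<rho>" "\<rho> < \<rho>\<^sub>0" and tc: "trace_class UNIV ((op_deriv ^^ m)
      R 0)"
    and \<delta>': "\<delta>' > 0"
    and exp: "log_expansion \<theta> (cut_region \<theta> \<delta>' \<rho>') (\<lambda>z. op_trace
        UNIV ((op_deriv ^^ m) R z)) (\<lambda>j. \<alpha> j + real m) a (\<lambda>_. 0)"
    and a1: "\<And>j. \<alpha> j = 1 \<Longrightarrow> a j 1 = 0"
  shows "zeta_op \<theta> \<rho> A nicely_meromorphic_on UNIV" "zeta_op \<theta> \<rho> A
      analytic_on {0}"
    and "Re s > real m + 2 \<Longrightarrow> ((\<lambda>e. cinner (op_power \<theta> \<rho> A s e)
        e) has_sum zeta_op \<theta> \<rho> A s) trace_basis"
proof -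
  define f where "f z = op_trace UNIV ((op_deriv ^^ m) R z)" for z
  note tp = trace_pow[OF \<rho> tc, folded f_def]
  obtain M where "contour_function \<theta> \<rho> f M" using tp(1) by blast
  then interpret contour_function \<theta> \<rho> f M .
  define \<gamma> where "\<gamma> j = 1 - (\<alpha> j + real m)" for j
  define Ac where "Ac = ray_coeff_A \<theta> (\<lambda>j. \<alpha> j + real m) a"
  define Bc where "Bc = ray_coeff_B \<theta> (\<lambda>j. \<alpha> j + real m) a"
  have cont: "continuous_on {\<rho>..} (\<lambda>r. f (rcis r \<theta>))"
    by (rule continuous_on_compose2[OF continuous_p]) (auto intro!: continuous_intros)
  have ray: "\<forall>\<^sub>F N in sequentially. \<exists>C. \<forall>r\<ge>\<rho>. norm (q r -
      power_log_sum \<gamma> Ac Bc {..<N} r) \<le> C * r powr (\<sigma> - 1)" for \<sigma>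
    using log_expansion_ray[OF exp[folded f_def] \<delta>' \<rho>(1) cont, of \<sigma>]
    unfolding q_def \<gamma>_def[abs_def] Ac_def Bc_def .
  have ex: "\<exists>N C. \<forall>r\<ge>\<rho>. norm (q r - power_log_sum \<gamma> Ac Bc {..<N} r)
      \<le> C * r powr (\<sigma> - 1)" for \<sigma>
    using eventually_happens[OF ray] by simp
  obtain F where F: "F nicely_meromorphic_on UNIV"
    "\<And>s. Re s > 1 \<Longrightarrow> F s = \<i> / (2 * of_real pi) * contour_int \<theta>
        \<rho> s f"
    "\<And>\<sigma> I C s. finite I \<Longrightarrow> (\<And>r. r \<ge> \<rho> \<Longrightarrow>
        norm (q r - power_log_sum \<gamma> Ac Bc I r) \<le> C * r powr (\<sigma> - 1))
        \<Longrightarrow>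
       Re s > \<sigma> \<Longrightarrow> eventually (\<lambda>w. F w = cont_local \<theta> \<rho> f
           \<gamma> Ac Bc I w) (at s)"
  proof (rule contour_continuation[OF ex], goal_cases)
    case (1 F)
    show ?case by (rule 1(1)[OF 1(2-)])
  qed
  have F_an: "F analytic_on {- of_nat m}"
  proof -
    obtain N C where NC: "\<And>r. r \<ge> \<rho> \<Longrightarrow> norm (q r - power_log_sum
        \<gamma> Ac Bc {..<N} r) \<le> C * r powr ((- real m - 1) - 1)"
      using eventually_happens[OF ray[of "- real m - 1"]] by auto
    have sin0: "sin (of_real pi * (- of_nat m :: complex)) = 0"
    proof -
      have "sin (of_real pi * (- of_nat m :: complex)) = of_real (sin (- (real m * pi)))"
        unfolding sin_of_real[symmetric] by (simp add: mult.commute)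
      then show ?thesis by simp
    qed
    \<comment> \<open>A pole sits at -m exactly when \<alpha> j = 1, and there the logarithmic
      coefficient vanishes by admissibility. So the pole is simple and the sine removes it.\<close>
    have B0: "Bc j = 0" if "of_real (\<gamma> j) = (- of_nat m :: complex)" for j
    proof -
      have "complex_of_real (\<gamma> j) = of_real (- real m)" using that by simp
      then have "\<gamma> j = - real m" by (simp only: of_real_eq_iff)
      then have "\<alpha> j = 1" by (simp add: \<gamma>_def)
      then show ?thesis using a1 by (simp add: Bc_def ray_coeff_B_def)
    qed
    obtain c where "cont_local \<theta> \<rho> f \<gamma> Ac Bc {..<N} \<midarrow>(- of_nat
        m)\<rightarrow> c"
    proof (rule cont_local_tendsto[where z = "- of_nat m", OF finite_lessThan NC _ sin0 B0],
        goal_cases)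
      case (4 c)
      show ?case by (rule 4(1)[OF 4(2)])
    qed auto
    moreover have "eventually (\<lambda>w. F w = cont_local \<theta> \<rho> f \<gamma> Ac Bc {..<N}
        w) (at (- of_nat m))"
      by (rule F(3)[OF _ NC]) auto
    ultimately have "F \<midarrow>(- of_nat m)\<rightarrow> c" using tendsto_cong by blast
    then show ?thesis by (rule nicely_meromorphic_tendsto_imp_analytic(1)[OF F(1)])
  qed
  define c where "c s = (\<Prod>i<m. s - of_nat (Suc i))" for s :: complex
  \<comment> \<open>The zeros of the product are 1, ..., m, so neither 0 nor the half plane of
    convergence meets them.\<close>
  have c0: "c s \<noteq> 0" if "Re s > real m + 2 \<or> s = 0" for s
  proof -
    have "s - of_nat (Suc i) \<noteq> 0" if "i < m" for i
    proof
      assume "s - of_nat (Suc i) = 0"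
      then have "s = of_nat (Suc i)" by simp
      then have "Re s = real (Suc i)" by simp
      moreover from this have "Re s \<noteq> 0" by simp
      then have "s \<noteq> 0" by auto
      ultimately show False using \<open>Re s > real m + 2 \<or> s = 0\<close> \<open>i < m\<close>
          by simp
    qed
    then show ?thesis unfolding c_def by simp
  qed
  have c_an: "c analytic_on S" for S
    unfolding c_def by (intro analytic_intros)
  define H where "H s = F (s - of_nat m) / c s" for s
  have H_an: "H analytic_on {s}" if "F analytic_on {s - of_nat m}" "c s \<noteq> 0" for s
  proof -
    have "F \<circ> (\<lambda>s. s - of_nat m) analytic_on {s}"
      by (rule analytic_on_compose) (use that in \<open>auto intro!: analytic_intros\<close>)
    then have "(\<lambda>s. F (s - of_nat m)) analytic_on {s}" by (simp add: o_def)
    then show ?thesis unfolding H_def by (intro analytic_on_divide c_an) (use that in auto)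
  qed
  have Hm: "H meromorphic_on UNIV"
  proof -
    have "(\<lambda>s. F (s - of_nat m)) meromorphic_on UNIV"
      by (rule meromorphic_on_compose[of F UNIV]) (use F(1) in \<open>auto simp:
          nicely_meromorphic_on_def intro!: analytic_intros\<close>)
    then show ?thesis
      unfolding H_def
      by (rule meromorphic_on_divide) (rule analytic_on_imp_meromorphic_on[OF c_an])
  qed
  \<comment> \<open>At the zeros of the product the quotient has default values; removing
    singularities brings it into the normal form that \<open>mero_extension\<close>
    requires.\<close>
  define Z where "Z = remove_sings H"
  have Z: "Z nicely_meromorphic_on UNIV"
    unfolding Z_def by (rule remove_sings_nicely_meromorphic[OF Hm])
  have "H analytic_on {0}"
    by (rule H_an) (use F_an c0[of 0] in auto)
  then have Z_an: "Z analytic_on {0}" unfolding Z_def by (rule remove_sings_analytic_on)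
  have Zsum: "((\<lambda>e. cinner (op_power \<theta> \<rho> A s e) e) has_sum Z s) trace_basis" if
      s: "Re s > real m + 2" for s
  proof -
    have "(\<lambda>s. \<i> / (2 * of_real pi) * contour_int \<theta> \<rho> s f) holomorphic_on
        {s. Re s > 1}"
      by (intro holomorphic_intros contour_int_holomorphic)
    then have "F holomorphic_on {s. Re s > 1}"
      using F(2) by (subst holomorphic_cong[OF refl]) auto
    then have "F analytic_on {s - of_nat m}"
      using s open_halfspace_Re_gt[of 1] by (auto simp: analytic_at)
    from H_an[OF this] have "H analytic_on {s}" using c0 s by blast
    then have "Z s = H s" by (simp add: Z_def)
    then show ?thesis
      using tp(2)[OF s] F(2)[of "s - of_nat m"] s by (simp add: H_def c_def)
  qed
  have ex: "mero_extension (real m + 2) (\<lambda>s. op_trace UNIV (op_power \<theta> \<rho> A s))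
      Z"
    unfolding mero_extension_def op_trace_eq using Z infsumI[OF Zsum] by simp
  have "zeta_op \<theta> \<rho> A = Z"
    unfolding zeta_op_def
  proof (rule the_equality)
    show "\<exists>a. mero_extension a (\<lambda>s. op_trace UNIV (op_power \<theta> \<rho> A s))
        Z" using ex ..
    fix G assume "\<exists>a. mero_extension a (\<lambda>s. op_trace UNIV (op_power \<theta> \<rho>
        A s)) G"
    then obtain b where "mero_extension b (\<lambda>s. op_trace UNIV (op_power \<theta> \<rho> A
        s)) G" ..
    with ex show "G = Z"
      unfolding mero_extension_def by (intro mero_extension_unique[of G Z "max b (real m + 2)"])
          auto
  qed
  then show "zeta_op \<theta> \<rho> A nicely_meromorphic_on UNIV" "zeta_op \<theta> \<rho> A
      analytic_on {0}"
    "Re s > real m + 2 \<Longrightarrow> ((\<lambda>e. cinner (op_power \<theta> \<rho> A s e) e)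
        has_sum zeta_op \<theta> \<rho> A s) trace_basis"
    using Z Z_an Zsum by simp_all
qed

end

section \<open>The comparison formula\<close>

text \<open>As \<alpha> J = 1, the extra term is the J-th power with no logarithm, and for N > J it
  can be put back into the sum.\<close>

lemma log_expansion_absorb:
  assumes exp: "log_expansion \<theta> \<Lambda> f \<alpha> (\<lambda>j k. if j = J then 0 else b j
      k) (\<lambda>z. b J 0 * pow_cut \<theta> (- z) (- 1))"
    and J: "\<alpha> J = 1" and fg: "\<And>z. z \<in> \<Lambda> \<Longrightarrow> f z = g z"
  shows "log_expansion \<theta> \<Lambda> g \<alpha> (\<lambda>j k. if j = J then (if k = 0 then b
      J 0 else 0) else b j k) (\<lambda>_. 0)"
  unfolding log_expansion_def
proof (intro conjI allI impI)
  show "strict_mono \<alpha>" "filterlim \<alpha> at_top sequentially" using exp by (auto simp: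
      log_expansion_def)
  fix \<epsilon> :: real assume "\<epsilon> > 0"
  then have "\<forall>\<^sub>F N in sequentially. (\<lambda>z. cmod (f z - (\<Sum>j<N.
      \<Sum>k\<le>1. (if j = J then 0 else b j k) * pow_cut \<theta> (- z) (- \<alpha> j) * log_cut
      \<theta> (- z) ^ k) - b J 0 * pow_cut \<theta> (- z) (- 1)))
          \<in> O[at_infinity_within \<Lambda>](\<lambda>z. cmod z powr (- \<alpha> N +
              \<epsilon>))"
    using exp by (simp add: log_expansion_def)
  then show "\<forall>\<^sub>F N in sequentially. (\<lambda>z. cmod (g z - (\<Sum>j<N.
      \<Sum>k\<le>1. (if j = J then (if k = 0 then b J 0 else 0) else b j k) * pow_cut \<theta> (-
      z) (- \<alpha> j) * log_cut \<theta> (- z) ^ k) - 0))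
          \<in> O[at_infinity_within \<Lambda>](\<lambda>z. cmod z powr (- \<alpha> N +
              \<epsilon>))"
    using eventually_gt_at_top[of J]
  proof eventually_elim
    case (elim N)
    define t where "t j z = (\<Sum>k\<le>1. b j k * pow_cut \<theta> (- z) (- \<alpha> j) * log_cut
        \<theta> (- z) ^ k)" for j z
    have 1: "(\<Sum>j<N. \<Sum>k\<le>1. (if j = J then 0 else b j k) * pow_cut \<theta> (- z) (-
        \<alpha> j) * log_cut \<theta> (- z) ^ k) = (\<Sum>j\<in>{..<N} - {J}. t j z)" for z
      using elim(2) by (subst sum.remove[of _ J]) (auto simp: t_def intro!: sum.cong)
    have 2: "(\<Sum>j<N. \<Sum>k\<le>1. (if j = J then (if k = 0 then b J 0 else 0) else b j k) *
        pow_cut \<theta> (- z) (- \<alpha> j) * log_cut \<theta> (- z) ^ k) =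
        b J 0 * pow_cut \<theta> (- z) (- 1) + (\<Sum>j\<in>{..<N} - {J}. t j z)" for z
      using elim(2) J by (subst sum.remove[of _ J]) (auto simp: t_def intro!: sum.cong)
    have ev: "eventually (\<lambda>z. cmod (g z - (\<Sum>j<N. \<Sum>k\<le>1. (if j = J then (if k =
        0 then b J 0 else 0) else b j k) * pow_cut \<theta> (- z) (- \<alpha> j) * log_cut \<theta>
        (- z) ^ k) - 0) =
       cmod (f z - (\<Sum>j<N. \<Sum>k\<le>1. (if j = J then 0 else b j k) * pow_cut \<theta> (- z)
           (- \<alpha> j) * log_cut \<theta> (- z) ^ k) - b J 0 * pow_cut \<theta> (- z) (- 1)))
           (at_infinity_within \<Lambda>)"
      unfolding eventually_at_infinity_within 1 2 using fg by (auto simp: algebra_simps)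
    show ?case using elim(1) landau_o.big.in_cong[OF ev] by blast
  qed
qed

section \<open>Value and derivative at s = 0 of the continued contour integral\<close>

context log_primitive begin

text \<open>Since cis \<theta> = -exp(i(\<theta> - \<pi>)), the coefficient changes sign. The sign
  in \<open>cont_local_at_0\<close> cancels this one, so that the value at s = 0 is c J 0.\<close>

lemma ray_coeff_J: "ray_coeff_A \<theta> \<alpha> c J = - c J 0" "ray_coeff_B \<theta> \<alpha> c J
    = 0"
proof -
  have "cis \<theta> * exp (- of_real (\<alpha> J) * (\<i> * of_real (\<theta> - pi))) = cis
      \<theta> * cis (- (\<theta> - pi))"
    using J by (simp add: cis_conv_exp algebra_simps)
  also have "\<dots> = - 1" by (simp add: cis_mult)
  finally show "ray_coeff_A \<theta> \<alpha> c J = - c J 0" "ray_coeff_B \<theta> \<alpha> c J = 0"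
    using J by (simp_all add: ray_coeff_A_def ray_coeff_B_def)
qed

text \<open>On the ray the terms of \<open>power_log_sum\<close> with j \<noteq> J are minus the
  r-derivatives of the primitive terms. Their continued integrals from \<rho> to infinity are
  therefore the primitives at the lower end, with no contribution from infinity.\<close>

lemma polar_part_at_0:
  assumes "J \<notin> I"
  shows "polar_part \<rho> (\<lambda>j. 1 - \<alpha> j) (ray_coeff_A \<theta> \<alpha> c)
      (ray_coeff_B \<theta> \<alpha> c) I 0 =
    (\<Sum>j\<in>I. primitive_term j (Complex (ln \<rho>) (\<theta> - pi)))"
  unfolding polar_part_def
proof (intro sum.cong refl)
  fix j assume "j \<in> I"
  then have j: "j \<noteq> J" using assms by auto
  define g where "g = complex_of_real (1 - \<alpha> j)"
  define v where "v = \<i> * complex_of_real (\<theta> - pi)"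
  define l where "l = complex_of_real (ln \<rho>)"
  have u: "Complex (ln \<rho>) (\<theta> - pi) = l + v" by (simp add: Complex_eq l_def v_def)
  have g: "g \<noteq> 0" using \<alpha>_neq_1[OF j] unfolding g_def of_real_eq_0_iff by simp
  have b: "b' j 0 = c j 0 / g - c j 1 / g\<^sup>2" "b' j 1 = c j 1 / g"
    using b'_0[OF j] b'_1[OF j] by (simp_all add: g_def)
  have "cis \<theta> * exp (- of_real (\<alpha> j) * v) = - (exp v * exp (- of_real (\<alpha> j) *
      v))"
  proof -
    have "exp v = cis (\<theta> - pi)" by (simp add: v_def cis_conv_exp)
    also have "\<dots> = - cis \<theta>" by (simp add: cis_divide[symmetric])
    finally show ?thesis by simp
  qed
  also have "exp v * exp (- of_real (\<alpha> j) * v) = exp (g * v)"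
    by (simp add: g_def exp_add[symmetric] algebra_simps)
  finally have e: "cis \<theta> * exp (- of_real (\<alpha> j) * v) = - exp (g * v)" .
  have AB: "ray_coeff_A \<theta> \<alpha> c j = - exp (g * v) * (c j 0 + v * c j 1)" "ray_coeff_B
      \<theta> \<alpha> c j = - exp (g * v) * c j 1"
    unfolding ray_coeff_A_def ray_coeff_B_def v_def[symmetric] e by simp_all
  have "exp ((g - 0) * l) * ((ray_coeff_A \<theta> \<alpha> c j + ray_coeff_B \<theta> \<alpha> c j
      * l) / (0 - g) + ray_coeff_B \<theta> \<alpha> c j / (0 - g)\<^sup>2) =
      (exp (g * l) * exp (g * v)) * (b' j 0 + b' j 1 * (l + v))"
    unfolding AB b using g by (simp add: field_simps power2_eq_square)
  also have "exp (g * l) * exp (g * v) = exp (g * (l + v))" by (simp add: exp_add distrib_left)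
  also have "exp (g * (l + v)) * (b' j 0 + b' j 1 * (l + v)) = primitive_term j (l + v)"
    by (simp add: primitive_term_def g_def algebra_simps)
  finally show "exp ((complex_of_real (1 - \<alpha> j) - 0) * complex_of_real (ln \<rho>)) *
      ((ray_coeff_A \<theta> \<alpha> c j + ray_coeff_B \<theta> \<alpha> c j * complex_of_real (ln
          \<rho>)) / (0 - complex_of_real (1 - \<alpha> j)) +
       ray_coeff_B \<theta> \<alpha> c j / (0 - complex_of_real (1 - \<alpha> j))\<^sup>2) =
           primitive_term j (Complex (ln \<rho>) (\<theta> - pi))"
    unfolding u g_def l_def .
qed

text \<open>In the derivative at 0 the Mellin transform contributes minus the primitive G N at the
  point \<rho>e^(i\<theta>) and minus the integral of the remainder, while the circle contributes
  L(\<rho>e^(i\<theta>)) - L(0). Together they are \<open>const N\<close> - L(0).\<close>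

lemma mellin_continuation_at_0:
  assumes "contour_function \<theta> \<rho> (\<lambda>z. - deriv L z) M"
  shows "\<exists>F. F nicely_meromorphic_on UNIV \<and>
    (\<forall>s. Re s > 1 \<longrightarrow> F s = \<i> / (2 * of_real pi) * contour_int \<theta>
        \<rho> s (\<lambda>z. - deriv L z)) \<and>
    F 0 = c J 0 \<and> deriv F 0 = reg_limit \<theta> \<Lambda> L - L 0 \<and> F analytic_on {0}"
proof -
  interpret contour_function \<theta> \<rho> "\<lambda>z. - deriv L z" M by fact
  define \<gamma> where "\<gamma> j = 1 - \<alpha> j" for j
  define Ac where "Ac = ray_coeff_A \<theta> \<alpha> c"
  define Bc where "Bc = ray_coeff_B \<theta> \<alpha> c"
  have ray: "\<forall>\<^sub>F N in sequentially. \<exists>C. \<forall>r\<ge>\<rho>. norm (q r -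
      power_log_sum \<gamma> Ac Bc {..<N} r) \<le> C * r powr (\<sigma> - 1)" for \<sigma>
    using log_expansion_ray[OF expansion \<delta> \<rho>(1) continuous_ray_deriv, of \<sigma>]
    unfolding q_def \<gamma>_def[abs_def] Ac_def Bc_def .
  have ex: "\<exists>N C. \<forall>r\<ge>\<rho>. norm (q r - power_log_sum \<gamma> Ac Bc {..<N} r)
      \<le> C * r powr (\<sigma> - 1)" for \<sigma>
    using eventually_happens[OF ray] by simp
  obtain F where F: "F nicely_meromorphic_on UNIV"
    "\<And>s. Re s > 1 \<Longrightarrow> F s = \<i> / (2 * of_real pi) * contour_int \<theta>
        \<rho> s (\<lambda>z. - deriv L z)"
    "\<And>\<sigma> I C s. finite I \<Longrightarrow> (\<And>r. r \<ge> \<rho> \<Longrightarrow>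
        norm (q r - power_log_sum \<gamma> Ac Bc I r) \<le> C * r powr (\<sigma> - 1))
        \<Longrightarrow>
       Re s > \<sigma> \<Longrightarrow> eventually (\<lambda>w. F w = cont_local \<theta> \<rho>
           (\<lambda>z. - deriv L z) \<gamma> Ac Bc I w) (at s)"
  proof (rule contour_continuation[OF ex], goal_cases)
    case (1 F)
    show ?case by (rule 1(1)[OF 1(2-)])
  qed
  obtain c1 where c1: "reg_limit \<theta> \<Lambda> L = c1" "\<forall>\<^sub>F N in sequentially. J
      < N \<and> const N = c1"
    using regularized_limit by metis
  have "\<forall>\<^sub>F N in sequentially. (J < N \<and> const N = c1) \<and>
      (\<exists>C. \<forall>r\<ge>\<rho>. norm (q r - power_log_sum \<gamma> Ac Bc {..<N} r) \<le>
          C * r powr (- 1 - 1))"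
    using c1(2) ray[of "- 1"] by (rule eventually_conj)
  \<comment> \<open>One N serves both purposes: \<open>const N\<close> is the regularized limit, and
    the remainder of order r^(-2), that is \<sigma> = -1, has a convergent transform at s =
    0.\<close>
  from eventually_happens[OF this] obtain N C where N: "J < N" "const N = c1"
    and NC: "\<And>r. r \<ge> \<rho> \<Longrightarrow> norm (q r - power_log_sum \<gamma> Ac Bc
        {..<N} r) \<le> C * r powr (- 1 - 1)"
    by auto
  have AJ: "Ac J = - c J 0" "Bc J = 0" using ray_coeff_J by (simp_all add: Ac_def Bc_def)
  have ball: "cball 0 \<rho> \<subseteq> \<Lambda>" using \<rho> by (auto simp: cut_region_def)
  note circ = circle_int_deriv[OF \<rho>(1) open_cut_region ball L, of \<theta>]
  have rem: "ray_rem N = (\<lambda>r. q r - power_log_sum \<gamma> Ac Bc {..<N} r)"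
    by (simp add: fun_eq_iff ray_rem_def q_def \<gamma>_def[abs_def] Ac_def Bc_def)
  define u where "u = Complex (ln \<rho>) (\<theta> - pi)"
  have u: "u = of_real (ln \<rho>) + \<i> * of_real (\<theta> - pi)" by (simp add: u_def Complex_eq)
  have pp: "polar_part \<rho> \<gamma> Ac Bc ({..<N} - {J}) 0 = (\<Sum>j\<in>{..<N} - {J}.
      primitive_term j u)"
    using polar_part_at_0[of "{..<N} - {J}"] by (simp add: \<gamma>_def[abs_def] Ac_def Bc_def
        u_def)
  have "\<exists>g. eventually (\<lambda>s. cont_local \<theta> \<rho> (\<lambda>z. - deriv L z)
      \<gamma> Ac Bc {..<N} s = g s) (at 0) \<and>
    g 0 = - Ac J - \<i> / (2 * of_real pi) * circle_int \<theta> \<rho> 0 (\<lambda>z. - deriv L z)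
        \<and>
    (g has_field_derivative (Ac J * (of_real (ln \<rho>) + \<i> * of_real (\<theta> - pi)) -
        (polar_part \<rho> \<gamma> Ac Bc ({..<N} - {J}) 0 + integral {\<rho>..} (\<lambda>r. q r -
            power_log_sum \<gamma> Ac Bc {..<N} r)) -
        \<i> / (2 * of_real pi) * deriv (\<lambda>s. circle_int \<theta> \<rho> s (\<lambda>z. -
            deriv L z)) 0)) (at 0)"
  proof (rule cont_local_at_0[OF finite_lessThan NC, of J], goal_cases)
    case (7 g)
    then show ?case by blast
  qed (use N J AJ \<alpha>_neq_1 in \<open>auto simp: \<gamma>_def\<close>)
  then obtain g where g: "eventually (\<lambda>s. cont_local \<theta> \<rho> (\<lambda>z. - deriv L
      z) \<gamma> Ac Bc {..<N} s = g s) (at 0)"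
    "g 0 = c J 0"
    "(g has_field_derivative (- c J 0 * u - ((\<Sum>j\<in>{..<N} - {J}. primitive_term j u) +
        integral {\<rho>..} (ray_rem N)) -
        \<i> / (2 * of_real pi) * (2 * of_real pi * \<i> * (L (rcis \<rho> \<theta>) - L 0)))) (at
            0)"
    unfolding AJ(1) circ pp rem u[symmetric] by auto
  have Fg: "eventually (\<lambda>w. F w = g w) (at 0)"
  proof -
    have "eventually (\<lambda>w. F w = cont_local \<theta> \<rho> (\<lambda>z. - deriv L z)
        \<gamma> Ac Bc {..<N} w) (at 0)"
      by (rule F(3)[OF finite_lessThan NC]) auto
    then show ?thesis using g(1) by eventually_elim simp
  qed
  note F0 = nicely_meromorphic_eventually_eq[OF F(1) Fg g(3)]
  have "- exp u = rcis \<rho> \<theta>"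
    using minus_rcis_eq_exp[OF \<rho>(1), of \<theta>] by (metis minus_minus u_def)
  then have "const N = L (rcis \<rho> \<theta>) - (c J 0 * u + (\<Sum>j\<in>{..<N} - {J}.
      primitive_term j u)) - integral {\<rho>..} (ray_rem N)"
    by (simp add: const_def Q_def G_def u_def)
  then have "deriv F 0 = const N - L 0"
    unfolding F0(2) by (simp add: algebra_simps)
  moreover have "F \<midarrow>0\<rightarrow> g 0"
    using DERIV_isCont[OF g(3)] tendsto_cong[OF Fg] by (simp add: isCont_def)
  then have "F analytic_on {0}" by (rule nicely_meromorphic_tendsto_imp_analytic(1)[OF F(1)])
  ultimately show ?thesis
    using F(1,2) F0(1) g(2) N(2) c1(1) by (intro exI[of _ F]) auto
qed

end

section \<open>The relative zeta function and the quotient of determinants\<close>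

lemma zeta_rel_eqI:
  assumes "F nicely_meromorphic_on UNIV"
    and "\<And>s. Re s > 1 \<Longrightarrow> F s = op_trace UNIV (\<lambda>x. op_power \<theta>
        \<rho> A\<^sub>1 s x - op_power \<theta> \<rho> A\<^sub>2 s x)"
  shows "zeta_rel \<theta> \<rho> A\<^sub>1 A\<^sub>2 = F"
  unfolding zeta_rel_def
proof (rule the_equality)
  show "mero_extension 1 (\<lambda>s. op_trace UNIV (\<lambda>x. op_power \<theta> \<rho> A\<^sub>1
      s x - op_power \<theta> \<rho> A\<^sub>2 s x)) F"
    using assms by (simp add: mero_extension_def)
  fix G assume "mero_extension 1 (\<lambda>s. op_trace UNIV (\<lambda>x. op_power \<theta> \<rho>
      A\<^sub>1 s x - op_power \<theta> \<rho> A\<^sub>2 s x)) G"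
  then show "G = F"
    using assms by (intro mero_extension_unique[of G F 1]) (auto simp: mero_extension_def)
qed

lemma resolvent_diff_trace:
  fixes A\<^sub>1 A\<^sub>2 :: "'h::chilbert_space operator"
  assumes A: "cut_operator A\<^sub>1 \<theta> \<delta> \<rho>\<^sub>0" "cut_operator A\<^sub>2
      \<theta> \<delta> \<rho>\<^sub>0" and \<rho>: "0 < \<rho>" "\<rho> < \<rho>\<^sub>0"
    and tc: "trace_class UNIV (\<lambda>x. resolvent A\<^sub>1 0 x - resolvent A\<^sub>2 0 x)"
  defines "f \<equiv> \<lambda>z. op_trace UNIV (\<lambda>x. resolvent A\<^sub>1 z x - resolvent
      A\<^sub>2 z x)"
  shows "\<exists>M. \<forall>z\<in>contour_set \<theta> \<rho>. norm (f z) \<le> M"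
    and "Re s > 1 \<Longrightarrow> op_trace UNIV (\<lambda>x. op_power \<theta> \<rho> A\<^sub>1 s
        x - op_power \<theta> \<rho> A\<^sub>2 s x) =
      \<i> / (2 * of_real pi) * contour_int \<theta> \<rho> s f"
proof -
  interpret A1: cut_operator A\<^sub>1 \<theta> \<delta> \<rho>\<^sub>0 by fact
  interpret A2: cut_operator A\<^sub>2 \<theta> \<delta> \<rho>\<^sub>0 by fact
  define D where "D z x = resolvent A\<^sub>1 z x - resolvent A\<^sub>2 z x" for z x
  note sub = contour_set_subset_cut_region[OF A1.delta_pos \<rho>, of \<theta>]
  have fac: "D z x = A2.Y z (D 0 (A1.Y z x))" if z: "z \<in> A1.\<Lambda>" for z x
  proof -
    obtain C where C: "op_bound (resolvent A\<^sub>2 z) C" using A2.resolvent_bound[OF z] by blast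
    have "A2.Y z (D 0 (A1.Y z x)) = A2.Y z (resolvent A\<^sub>1 0 (A1.Y z x)) - A2.Y z (resolvent
        A\<^sub>2 0 (A1.Y z x))"
      unfolding D_def by (rule op_boundD(6)[OF A2.Y_bound[OF z C]])
    \<comment> \<open>The first factor uses R1(0)Y1(z) = R1(z), the second Y2(z)R2(0) = R2(z). After
      expanding Y the mixed terms z R2(z)R1(z) cancel.\<close>
    also have "\<dots> = A2.Y z (resolvent A\<^sub>1 z x) - resolvent A\<^sub>2 z (A1.Y z x)"
      using A1.resolvent_eq_Y(2)[OF z, of x] A2.resolvent_eq_Y(1)[OF z, of "A1.Y z x"] by simp
    also have "\<dots> = D z x"
      by (simp add: D_def A1.Y_def A2.Y_def A2.resolvent_linear[OF z])
    finally show ?thesis by simp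
  qed
  obtain M1 where M1: "\<And>z. z \<in> contour_set \<theta> \<rho> \<Longrightarrow> op_bound
      (resolvent A\<^sub>1 z) M1" "\<And>z. z \<in> contour_set \<theta> \<rho> \<Longrightarrow>
      op_bound (A1.Y z) M1"
  proof (rule A1.contour_bounds[OF \<rho>], goal_cases)
    case (1 M)
    show ?case by (rule 1(1)[OF 1(2-)])
  qed
  obtain M2 where M2: "\<And>z. z \<in> contour_set \<theta> \<rho> \<Longrightarrow> op_bound
      (resolvent A\<^sub>2 z) M2" "\<And>z. z \<in> contour_set \<theta> \<rho> \<Longrightarrow>
      op_bound (A2.Y z) M2"
  proof (rule A2.contour_bounds[OF \<rho>], goal_cases)
    case (1 M)
    show ?case by (rule 1(1)[OF 1(2-)])
  qed
  have "trace_class UNIV (D 0)" using tc unfolding D_def[abs_def] .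
  then obtain \<tau> where \<tau>: "0 \<le> \<tau>"
    "\<And>X Z CX CZ F. op_bound X CX \<Longrightarrow> op_bound Z CZ \<Longrightarrow> F
        \<subseteq> trace_basis \<Longrightarrow> finite F \<Longrightarrow>
       (\<Sum>e\<in>F. cmod (cinner (Z (D 0 (X e))) e)) \<le> CX * CZ * \<tau>"
  proof (rule trace_basis_bound, goal_cases)
    case (1 \<tau>)
    show ?case by (rule 1(1)[OF 1(2-)])
  qed
  have bd: "(\<Sum>e\<in>F. cmod (cinner (D z e) e)) \<le> M1 * M2 * \<tau>" if "finite F" "F
      \<subseteq> trace_basis" "z \<in> contour_set \<theta> \<rho>" for F z
  proof -
    have "z \<in> A1.\<Lambda>" using sub that(3) by (rule subsetD)
    show ?thesis
      using \<tau>(2)[OF M1(2)[OF that(3)] M2(2)[OF that(3)] that(2,1)] by (simp only: fac[OF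
          \<open>z \<in> A1.\<Lambda>\<close>, symmetric])
  qed
  have f: "f z = (\<Sum>\<^sub>\<infinity>e\<in>trace_basis. cinner (D z e) e)" for z
    by (simp add: f_def op_trace_eq D_def)
  show "\<exists>M. \<forall>z\<in>contour_set \<theta> \<rho>. norm (f z) \<le> M"
    unfolding f using norm_infsum_le(2)[OF bd] by blast
  show "op_trace UNIV (\<lambda>x. op_power \<theta> \<rho> A\<^sub>1 s x - op_power \<theta>
      \<rho> A\<^sub>2 s x) = \<i> / (2 * of_real pi) * contour_int \<theta> \<rho> s f"
    if s: "Re s > 1"
  proof -
    have c1: "continuous_on (contour_set \<theta> \<rho>) (\<lambda>z. cinner (resolvent A\<^sub>1
        z e) e)" for e
      by (rule bounded_linear.continuous_on[OF bounded_linear_cinner_left continuous_on_subset[OF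
          A1.continuous_on_resolvent sub]])
    have c2: "continuous_on (contour_set \<theta> \<rho>) (\<lambda>z. cinner (resolvent A\<^sub>2
        z e) e)" for e
      by (rule bounded_linear.continuous_on[OF bounded_linear_cinner_left continuous_on_subset[OF
          A2.continuous_on_resolvent sub]])
    have b: "norm (cinner (T e) e) \<le> M * norm e * norm e" if "op_bound T M" for T :: "'h
        \<Rightarrow> 'h" and M e
      using order_trans[OF cinner_Cauchy_Schwarz mult_right_mono[OF op_boundD(3)[OF that]]] by simp
    have "((\<lambda>e. contour_int \<theta> \<rho> s (\<lambda>z. cinner (D z e) e)) has_sum
        contour_int \<theta> \<rho> s (\<lambda>z. \<Sum>\<^sub>\<infinity>e\<in>trace_basis.
        cinner (D z e) e)) trace_basis"
      by (rule has_sum_contour_int[OF \<rho>(1) s _ bd]) (simp add: D_def cinner_diff_left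
          continuous_on_diff[OF c1 c2])
    then have "((\<lambda>e. contour_int \<theta> \<rho> s (\<lambda>z. cinner (D z e) e)) has_sum
        contour_int \<theta> \<rho> s f) trace_basis"
      by (simp only: f[abs_def])
    then have "((\<lambda>e. \<i> / (2 * of_real pi) * contour_int \<theta> \<rho> s (\<lambda>z.
        cinner (D z e) e)) has_sum \<i> / (2 * of_real pi) * contour_int \<theta> \<rho> s f)
        trace_basis"
      by (rule has_sum_cmult_right)
    moreover have "\<i> / (2 * of_real pi) * contour_int \<theta> \<rho> s (\<lambda>z. cinner (D z
        e) e) = cinner (op_power \<theta> \<rho> A\<^sub>1 s e - op_power \<theta> \<rho> A\<^sub>2
        s e) e" for e
    proof -
      have "contour_int \<theta> \<rho> s (\<lambda>z. cinner (D z e) e) = contour_int \<theta>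
          \<rho> s (\<lambda>z. cinner (resolvent A\<^sub>1 z e) e) - contour_int \<theta> \<rho> s
          (\<lambda>z. cinner (resolvent A\<^sub>2 z e) e)"
        unfolding D_def cinner_diff_left
        by (rule contour_int_diff[OF \<rho>(1) s c1 b[OF M1(1)] c2 b[OF M2(1)]])
      then show ?thesis
        unfolding cinner_diff_left A1.op_power_inner_P[OF \<rho> s] A2.op_power_inner_P[OF \<rho> s]
        by (simp add: right_diff_distrib)
    qed
    ultimately show ?thesis unfolding op_trace_eq by (simp add: infsumI)
  qed
qed

lemma zeta_admissible_op:
  assumes adm: "zeta_admissible \<theta> A\<^sub>1 A\<^sub>2" and A: "A \<in> {A\<^sub>1,
      A\<^sub>2}"
    and cut: "cut_operator A \<theta> \<delta> \<rho>\<^sub>0" and \<rho>: "0 < \<rho>" "\<rho> <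
        \<rho>\<^sub>0"
  shows "zeta_op \<theta> \<rho> A nicely_meromorphic_on UNIV \<and> zeta_op \<theta> \<rho> A
      analytic_on {0} \<and>
    (\<exists>b. \<forall>s. Re s > b \<longrightarrow> ((\<lambda>e. cinner (op_power \<theta>
        \<rho> A s e) e) has_sum zeta_op \<theta> \<rho> A s) trace_basis)"
proof -
  interpret cut_operator A \<theta> \<delta> \<rho>\<^sub>0 by fact
  obtain \<delta>' \<rho>' and \<alpha> :: "nat \<Rightarrow> real" where adm':
      "\<forall>A\<in>{A\<^sub>1, A\<^sub>2}.
          closed_operator A \<and> invertible_operator A \<and> spectral_cut_on \<theta> \<delta>'
              \<rho>' A \<and>
          (\<exists>a :: nat \<Rightarrow> nat \<Rightarrow> nat \<Rightarrow> complex. \<forall>m.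
              real m > - \<alpha> 0 \<longrightarrow>
             (\<forall>z\<in>cut_region \<theta> \<delta>' \<rho>'. trace_class UNIV ((op_deriv ^^
                 m) (resolvent A) z)) \<and>
             log_expansion \<theta> (cut_region \<theta> \<delta>' \<rho>')
               (\<lambda>z. op_trace UNIV ((op_deriv ^^ m) (resolvent A) z))
               (\<lambda>j. \<alpha> j + real m) (a m) (\<lambda>_. 0) \<and>
             (\<forall>j. \<alpha> j = 1 \<longrightarrow> a m j 1 = 0))"
    using adm unfolding zeta_admissible_def by blast
  from adm'[rule_format, OF A] have pos: "\<delta>' > 0" "\<rho>' > 0" by (auto simp:
      spectral_cut_on_def)
  obtain a :: "nat \<Rightarrow> nat \<Rightarrow> nat \<Rightarrow> complex" where a: "\<forall>m.
      real m > - \<alpha> 0 \<longrightarrow>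
             (\<forall>z\<in>cut_region \<theta> \<delta>' \<rho>'. trace_class UNIV ((op_deriv ^^
                 m) (resolvent A) z)) \<and>
             log_expansion \<theta> (cut_region \<theta> \<delta>' \<rho>')
               (\<lambda>z. op_trace UNIV ((op_deriv ^^ m) (resolvent A) z))
               (\<lambda>j. \<alpha> j + real m) (a m) (\<lambda>_. 0) \<and>
             (\<forall>j. \<alpha> j = 1 \<longrightarrow> a m j 1 = 0)"
    using adm'[rule_format, OF A] by blast
  obtain m :: nat where m: "real m > - \<alpha> 0" using reals_Archimedean2 by blast
  have "0 \<in> cut_region \<theta> \<delta>' \<rho>'" using pos by (simp add: cut_region_def)
  then have tc: "trace_class UNIV ((op_deriv ^^ m) (resolvent A) 0)" using a m by blast
  have exp: "log_expansion \<theta> (cut_region \<theta> \<delta>' \<rho>') (\<lambda>z. op_trace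
      UNIV ((op_deriv ^^ m) (resolvent A) z))
               (\<lambda>j. \<alpha> j + real m) (a m) (\<lambda>_. 0)" and a1: "\<And>j. \<alpha>
                   j = 1 \<Longrightarrow> a m j 1 = 0"
    using a m by blast+
  show ?thesis
    using zeta_op_analytic[OF \<rho> tc pos(1) exp a1] by blast
qed

theorem theorem2p5:
  fixes A\<^sub>1 A\<^sub>2 :: "'h::chilbert_space operator"
    and K :: "complex \<Rightarrow> 'h set" and S :: "complex \<Rightarrow> 'h \<Rightarrow> 'h"
    and L :: "complex \<Rightarrow> complex"
    and \<alpha> :: "nat \<Rightarrow> real" and J :: nat and b b' :: "nat \<Rightarrow> nat \<Rightarrow> complex"
    and \<theta> \<delta> \<rho>\<^sub>0 \<rho> :: real
  assumes "0 \<le> \<theta>" "\<theta> < 2 * pi"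
    and "zeta_comparable \<theta> \<delta> \<rho>\<^sub>0 A\<^sub>1 A\<^sub>2 K S L \<alpha> J b"
    and "0 < \<rho>" "\<rho> < \<rho>\<^sub>0"
    and "\<And>j. j \<noteq> J \<Longrightarrow> b' j 0 = b j 0 / of_real (1 - \<alpha> j) - b j 1 / of_real ((1 - \<alpha> j)\<^sup>2)"
    and "\<And>j. j \<noteq> J \<Longrightarrow> b' j 1 = b j 1 / of_real (1 - \<alpha> j)"
  shows "det_zeta_rel \<theta> \<rho> A\<^sub>1 A\<^sub>2 =
           fredholm_det (K 0) (S 0) * exp (- reg_limit \<theta> (cut_region \<theta> \<delta> \<rho>\<^sub>0) L) \<and>
         ((\<lambda>z. L z - zeta_rel \<theta> \<rho> A\<^sub>1 A\<^sub>2 0 * log_cut \<theta> (- z)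
               - (\<Sum>j<J. \<Sum>k\<le>1. b' j k * pow_cut \<theta> (- z) (- \<alpha> j + 1) * log_cut \<theta> (- z) ^ k))
            \<longlongrightarrow> reg_limit \<theta> (cut_region \<theta> \<delta> \<rho>\<^sub>0) L)
           (at_infinity_within (cut_region \<theta> \<delta> \<rho>\<^sub>0)) \<and>
         (zeta_admissible \<theta> A\<^sub>1 A\<^sub>2 \<longrightarrow>
           det_zeta_rel \<theta> \<rho> A\<^sub>1 A\<^sub>2 = det_zeta \<theta> \<rho> A\<^sub>1 / det_zeta \<theta> \<rho> A\<^sub>2)"
proof -
  have comp: "closed_operator A\<^sub>1" "closed_operator A\<^sub>2" "spectral_cut_on \<theta>
      \<delta> \<rho>\<^sub>0 A\<^sub>1" "spectral_cut_on \<theta> \<delta> \<rho>\<^sub>0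
      A\<^sub>2"
    "\<And>z. z \<in> cut_region \<theta> \<delta> \<rho>\<^sub>0 \<Longrightarrow> trace_class
        UNIV (\<lambda>x. resolvent A\<^sub>1 z x - resolvent A\<^sub>2 z x)"
    "L holomorphic_on cut_region \<theta> \<delta> \<rho>\<^sub>0"
    "\<And>z. z \<in> cut_region \<theta> \<delta> \<rho>\<^sub>0 \<Longrightarrow> exp (L z) =
        fredholm_det (K z) (S z)"
    "\<And>z. z \<in> cut_region \<theta> \<delta> \<rho>\<^sub>0 \<Longrightarrow> op_trace UNIV
        (\<lambda>x. resolvent A\<^sub>1 z x - resolvent A\<^sub>2 z x) = - deriv L z"
    "\<alpha> J = 1"
    "log_expansion \<theta> (cut_region \<theta> \<delta> \<rho>\<^sub>0) (\<lambda>z. op_trace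
        UNIV (\<lambda>x. resolvent A\<^sub>1 z x - resolvent A\<^sub>2 z x)) \<alpha>
        (\<lambda>j k. if j = J then 0 else b j k) (\<lambda>z. b J 0 * pow_cut \<theta> (- z) (-
            1))"
    using assms(3) unfolding zeta_comparable_def Let_def by blast+
  have A: "cut_operator A\<^sub>1 \<theta> \<delta> \<rho>\<^sub>0" "cut_operator A\<^sub>2
      \<theta> \<delta> \<rho>\<^sub>0"
    using comp(1-4) by (simp_all add: cut_operator_def)
  interpret A1: cut_operator A\<^sub>1 \<theta> \<delta> \<rho>\<^sub>0 by (rule A)
  note \<rho> = assms(4,5)
  note sub = contour_set_subset_cut_region[OF A1.delta_pos \<rho>, of \<theta>]
  \<comment> \<open>The value of b at (J, 1) is replaced by 0, which the expansion of a comparable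
    pair prescribes.\<close>
  define c where "c j k = (if j = J then (if k = 0 then b J 0 else 0) else b j k)" for j k :: nat
  have "log_expansion \<theta> (cut_region \<theta> \<delta> \<rho>\<^sub>0) (\<lambda>z. - deriv L
      z) \<alpha> c (\<lambda>_. 0)"
    unfolding c_def[abs_def] by (rule log_expansion_absorb[OF comp(10,9,8)])
  then interpret log_primitive \<theta> \<delta> \<rho>\<^sub>0 \<rho> L \<alpha> c b' J
    using A1.delta_pos \<rho> comp(6,9) assms(6,7) by unfold_locales (auto simp: c_def)
  define f where "f z = op_trace UNIV (\<lambda>x. resolvent A\<^sub>1 z x - resolvent A\<^sub>2 z
      x)" for z
  have f: "f z = - deriv L z" if "z \<in> \<Lambda>" for z using comp(8)[OF that] by (simp add:
      f_def)
  note tr = resolvent_diff_trace[OF A \<rho> comp(5)[OF A1.zero_in_\<Lambda>], folded f_def]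
  obtain M where M: "\<And>z. z \<in> contour_set \<theta> \<rho> \<Longrightarrow> norm (f z)
      \<le> M" using tr(1) by blast
  have cf: "contour_function \<theta> \<rho> (\<lambda>z. - deriv L z) M"
  proof
    show "continuous_on (contour_set \<theta> \<rho>) (\<lambda>z. - deriv L z)"
      by (intro continuous_on_minus continuous_on_subset[OF _ sub] holomorphic_on_imp_continuous_on
          holomorphic_deriv L open_cut_region)
    show "norm (- deriv L z) \<le> M" if "z \<in> contour_set \<theta> \<rho>" for z
      using M[OF that] f[of z] sub that by auto
  qed (use \<rho> in auto)
  obtain F where F: "F nicely_meromorphic_on UNIV"
    "\<And>s. Re s > 1 \<Longrightarrow> F s = \<i> / (2 * of_real pi) * contour_int \<theta>
        \<rho> s (\<lambda>z. - deriv L z)"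
    "F 0 = c J 0" "deriv F 0 = reg_limit \<theta> \<Lambda> L - L 0" "F analytic_on {0}"
    using mellin_continuation_at_0[OF cf] by blast
  have F_trace: "F s = op_trace UNIV (\<lambda>x. op_power \<theta> \<rho> A\<^sub>1 s x - op_power
      \<theta> \<rho> A\<^sub>2 s x)" if "Re s > 1" for s
  proof -
    have "contour_int \<theta> \<rho> s (\<lambda>z. - deriv L z) = contour_int \<theta> \<rho> s f"
      by (rule contour_int_cong[OF \<rho>(1)]) (use f sub in auto)
    then show ?thesis using tr(2)[OF that] F(2)[OF that] by simp
  qed
  have zeta: "zeta_rel \<theta> \<rho> A\<^sub>1 A\<^sub>2 = F"
    by (rule zeta_rel_eqI[OF F(1) F_trace])
  \<comment> \<open>The derivative at 0 is the regularized limit minus L(0), and exp(L(0)) is the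
    Fredholm determinant at 0.\<close>
  have "det_zeta_rel \<theta> \<rho> A\<^sub>1 A\<^sub>2 = fredholm_det (K 0) (S 0) * exp (-
      reg_limit \<theta> \<Lambda> L)"
    unfolding det_zeta_rel_def zeta F(4) comp(7)[OF A1.zero_in_\<Lambda>, symmetric]
    by (simp add: exp_add[symmetric])
  moreover have "((\<lambda>z. L z - zeta_rel \<theta> \<rho> A\<^sub>1 A\<^sub>2 0 * log_cut
      \<theta> (- z)
               - (\<Sum>j<J. \<Sum>k\<le>1. b' j k * pow_cut \<theta> (- z) (- \<alpha> j + 1) *
                   log_cut \<theta> (- z) ^ k))
            \<longlongrightarrow> reg_limit \<theta> \<Lambda> L) (at_infinity_within \<Lambda>)"
  proof -
    have "(base \<longlongrightarrow> reg_limit \<theta> \<Lambda> L) (at_infinity_within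
        \<Lambda>)"
      using regularized_limit by metis
    then show ?thesis
      unfolding base_def[abs_def] primitive_term_def pow_cut_def zeta F(3) .
  qed
  moreover have "det_zeta_rel \<theta> \<rho> A\<^sub>1 A\<^sub>2 = det_zeta \<theta> \<rho>
      A\<^sub>1 / det_zeta \<theta> \<rho> A\<^sub>2" if adm: "zeta_admissible \<theta> A\<^sub>1
      A\<^sub>2"
  proof -
    define Z1 where "Z1 = zeta_op \<theta> \<rho> A\<^sub>1"
    define Z2 where "Z2 = zeta_op \<theta> \<rho> A\<^sub>2"
    obtain b1 where Z1: "Z1 nicely_meromorphic_on UNIV" "Z1 analytic_on {0}"
      "\<And>s. Re s > b1 \<Longrightarrow> ((\<lambda>e. cinner (op_power \<theta> \<rho>
          A\<^sub>1 s e) e) has_sum Z1 s) trace_basis"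
      using zeta_admissible_op[OF adm _ A(1) \<rho>] unfolding Z1_def by blast
    obtain b2 where Z2: "Z2 nicely_meromorphic_on UNIV" "Z2 analytic_on {0}"
      "\<And>s. Re s > b2 \<Longrightarrow> ((\<lambda>e. cinner (op_power \<theta> \<rho>
          A\<^sub>2 s e) e) has_sum Z2 s) trace_basis"
      using zeta_admissible_op[OF adm _ A(2) \<rho>] unfolding Z2_def by blast
    \<comment> \<open>Beyond all three abscissas of convergence the traces can be subtracted in the
      common basis.\<close>
    define b0 where "b0 = max 1 (max b1 b2)"
    have F_diff: "F s = Z1 s - Z2 s" if s: "Re s > b0" for s
    proof -
      have "((\<lambda>e. cinner (op_power \<theta> \<rho> A\<^sub>1 s e) e + - cinner (op_power
          \<theta> \<rho> A\<^sub>2 s e) e) has_sum Z1 s + - Z2 s) trace_basis"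
        using Z1(3)[of s] Z2(3)[of s] s by (intro has_sum_add) (auto simp: b0_def has_sum_uminus)
      then have "op_trace UNIV (\<lambda>x. op_power \<theta> \<rho> A\<^sub>1 s x - op_power
          \<theta> \<rho> A\<^sub>2 s x) = Z1 s - Z2 s"
        unfolding op_trace_eq by (simp add: cinner_diff_left infsumI)
      then show ?thesis using F_trace[of s] s by (simp add: b0_def)
    qed
    have mero: "(\<lambda>s. Z1 s - Z2 s) meromorphic_on UNIV"
      using Z1(1) Z2(1) by (auto simp: nicely_meromorphic_on_def intro!: meromorphic_intros)
    have F_hol: "F holomorphic_on {s. Re s > 1}"
    proof -
      have "(\<lambda>s. \<i> / (2 * of_real pi) * contour_int \<theta> \<rho> s (\<lambda>z. -
          deriv L z)) holomorphic_on {s. Re s > 1}"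
        by (intro holomorphic_intros contour_function.contour_int_holomorphic[OF cf])
      then show ?thesis using F(2) by (subst holomorphic_cong[OF refl]) auto
    qed
    \<comment> \<open>The pointwise difference of normalised functions need not be normalised, for
      instance where poles cancel. At 0 both terms are analytic, so there the passage to
      \<open>remove_sings\<close> leaves the derivative unchanged.\<close>
    have "F = remove_sings (\<lambda>s. Z1 s - Z2 s)"
    proof (rule mero_extension_unique[OF F(1) remove_sings_nicely_meromorphic[OF mero]])
      fix s assume s: "Re s > b0"
      have "eventually (\<lambda>w. w \<in> {s. Re s > b0}) (nhds s)"
        using s by (intro eventually_nhds_in_open open_halfspace_Re_gt) auto
      then have "eventually (\<lambda>w. F w = Z1 w - Z2 w) (nhds s)"
        by eventually_elim (use F_diff in auto)
      moreover have "F analytic_on {s}"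
        using F_hol s open_halfspace_Re_gt[of 1] by (auto simp: analytic_at b0_def)
      ultimately have "(\<lambda>s. Z1 s - Z2 s) analytic_on {s}"
        using analytic_at_cong[of F "\<lambda>s. Z1 s - Z2 s" s s] by simp
      then show "F s = remove_sings (\<lambda>s. Z1 s - Z2 s) s" using F_diff[OF s] by simp
    qed
    moreover have "(\<lambda>s. Z1 s - Z2 s) analytic_on {0}" by (intro analytic_on_diff Z1(2)
        Z2(2))
    ultimately have "deriv F 0 = deriv (\<lambda>s. Z1 s - Z2 s) 0" by simp
    also have "\<dots> = deriv Z1 0 - deriv Z2 0"
      using Z1(2) Z2(2) by (intro deriv_diff analytic_on_imp_differentiable_at) auto
    finally show ?thesis
      unfolding det_zeta_rel_def det_zeta_def zeta Z1_def[symmetric] Z2_def[symmetric]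
      by (simp add: exp_diff exp_minus divide_inverse mult.commute)
  qed
  ultimately show ?thesis by blast
qed

end
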